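(* Let $n\geq 1$, let $V\subset\mathbb{R}^n$ be a nonempty open set, let $s\in(-n/4,\infty)\setminus\mathbb{Z}$ and let $f\in\mathcal{A}_V$. If $(-\Delta)^s f|_V=0$, then $f=0$. If moreover $f\in\mathscr{O}_C'(\mathbb{R}^n)\cap\mathcal{A}_V$, then the claim (that $(-\Delta)^sf|_V=0$ implies $f=0$) holds for all $s\in(-n/2,\infty)\setminus\mathbb{Z}$.
   Context: All functions and distributions are complex valued. The Fourier transform $\hat f=\mathcal{F}(f)$ on tempered distributions $\mathscr{S}'(\mathbb{R}^n)$ is normalized so that $\widehat{D_jf}(\xi)=\xi_j\hat f(\xi)$, where $D_j=-i\partial_j$. For $r\in\mathbb{R}$, $H^r(\mathbb{R}^n)=\{f\in\mathscr{S}'(\mathbb{R}^n):(1+|\cdot|^2)^{r/2}\hat f\in L^2(\mathbb{R}^n)\}$, and $H^{-\infty}(\mathbb{R}^n)=\bigcup_{r\in\mathbb{R}}H^r(\mathbb{R}^n)$. $\mathcal{P}$ is the set of all nonzero polynomials on $\mathbb{R}^n$ with complex coefficients; $P(\xi)=\sum_{|\alpha|\leq m}a_\alpha\xi^\alpha\in\mathcal{P}$ induces the constant coefficient operator $P(D)=\sum_{|\alpha|\leq m}a_\alpha D^\alpha$, $D^\alpha=D_1^{\alpha_1}\cdots D_n^{\alpha_n}$, acting on distributions. For a nonempty open set $V\subset\mathbb{R}^n$ the set of admissible functions is $$\mathcal{A}_V=\{f\in H^{-\infty}(\mathbb{R}^n): P(D)f|_V=0\text{ for some }P\in\mathcal{P}\},$$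 where $|_V$ denotes restriction of distributions to $V$. $\mathscr{O}_C'(\mathbb{R}^n)$ is the space of rapidly decreasing distributions: $f\in\mathscr{S}'(\mathbb{R}^n)$ belongs to it if and only if $\hat f$ is a smooth function which together with all its derivatives is polynomially bounded. The fractional Laplacian is $(-\Delta)^sf=\mathcal{F}^{-1}(|\cdot|^{2s}\hat f)$. It is well defined as a tempered distribution for $f\in H^r(\mathbb{R}^n)$ (any $r\in\mathbb{R}$) when $s\in(-n/4,\infty)\setminus\mathbb{Z}$, and for $f\in\mathscr{O}_C'(\mathbb{R}^n)$ when $s\in(-n/2,\infty)\setminus\mathbb{Z}$. *)

theory Defs
  imports "HOL-Analysis.Analysis" "HOL-Library.Poly_Mapping"
begin

text \<open>
  Euclidean space of dimension \<open>n = CARD('n)\<close> is \<open>real ^ 'n\<close>.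
  A multi-index is an element of \<open>'n \<Rightarrow>\<^sub>0 nat\<close>, and a complex polynomial in the variables
  \<open>\<xi> $ j\<close> is given by its coefficients, an element of \<open>('n \<Rightarrow>\<^sub>0 nat) \<Rightarrow>\<^sub>0 complex\<close>.
\<close>

subsection \<open>Smooth functions, test functions, Schwartz functions\<close>

definition monomial :: "('n \<Rightarrow>\<^sub>0 nat) \<Rightarrow> real ^ 'n::finite \<Rightarrow> real" where
  "monomial \<alpha> x = (\<Prod>j\<in>UNIV. (x $ j) ^ Poly_Mapping.lookup \<alpha> j)"

text \<open>An enumeration of the coordinates, fixing the order of the factors in
  \<open>\<partial>\<^sub>1\<^bsup>\<alpha>1\<^esup> \<dots> \<partial>\<^sub>n\<^bsup>\<alpha>n\<^esup>\<close>; on smooth functions, and on distributions, the order is irrelevant.\<close>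

definition coords :: "'n::finite list" where
  "coords = (SOME js. distinct js \<and> set js = UNIV)"

lemma coords: "distinct (coords :: 'n::finite list)" "set (coords :: 'n list) = UNIV"
proof -
  have "\<exists>js :: 'n list. distinct js \<and> set js = UNIV"
    using finite_distinct_list[of "UNIV :: 'n set"] by auto
  then have "distinct (coords :: 'n list) \<and> set (coords :: 'n list) = UNIV"
    unfolding coords_def by (rule someI_ex)
  then show "distinct (coords :: 'n list)" "set (coords :: 'n list) = UNIV" by auto
qed

definition partial_deriv :: "'n \<Rightarrow> (real ^ 'n::finite \<Rightarrow> complex) \<Rightarrow> real ^ 'n \<Rightarrow> complex" where
  "partial_deriv j \<phi> x = frechet_derivative \<phi> (at x) (axis j 1)"

definition multi_deriv ::
  "('n \<Rightarrow>\<^sub>0 nat) \<Rightarrow> (real ^ 'n::finite \<Rightarrow> complex) \<Rightarrow> real ^ 'n \<Rightarrow> complex" where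
  "multi_deriv \<alpha> = foldr (\<lambda>j. partial_deriv j ^^ Poly_Mapping.lookup \<alpha> j) coords"

definition smooth :: "(real ^ 'n::finite \<Rightarrow> complex) \<Rightarrow> bool" where
  "smooth \<phi> \<longleftrightarrow> (\<forall>js x. foldr partial_deriv js \<phi> differentiable at x)"

definition test_functions :: "(real ^ 'n::finite) set \<Rightarrow> (real ^ 'n \<Rightarrow> complex) set" where
  "test_functions V =
    {\<phi>. smooth \<phi> \<and> compact (closure {x. \<phi> x \<noteq> 0}) \<and> closure {x. \<phi> x \<noteq> 0} \<subseteq> V}"

definition schwartz :: "(real ^ 'n::finite \<Rightarrow> complex) set" where
  "schwartz = {\<phi>. smooth \<phi> \<and>
    (\<forall>\<alpha> \<beta>. bounded (range (\<lambda>x. complex_of_real (monomial \<alpha> x) * multi_deriv \<beta> \<phi> x)))}"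

definition schwartz_seminorm ::
  "('n \<Rightarrow>\<^sub>0 nat) \<Rightarrow> ('n \<Rightarrow>\<^sub>0 nat) \<Rightarrow> (real ^ 'n::finite \<Rightarrow> complex) \<Rightarrow> real" where
  "schwartz_seminorm \<alpha> \<beta> \<phi> =
    (SUP x. norm (complex_of_real (monomial \<alpha> x) * multi_deriv \<beta> \<phi> x))"

subsection \<open>Tempered distributions\<close>

text \<open>A tempered distribution is a continuous linear functional on the Schwartz space. It is
  represented by a functional on all functions, whose values outside \<^term>\<open>schwartz\<close> are
  meaningless; accordingly \<open>u\<close> is the zero distribution iff \<open>\<forall>\<phi>\<in>schwartz. u \<phi> = 0\<close>.\<close>

type_synonym 'n distr = "(real ^ 'n \<Rightarrow> complex) \<Rightarrow> complex"

definition tempered :: "'n::finite distr \<Rightarrow> bool" where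
  "tempered u \<longleftrightarrow>
    (\<forall>\<phi>\<in>schwartz. \<forall>\<psi>\<in>schwartz. u (\<lambda>x. \<phi> x + \<psi> x) = u \<phi> + u \<psi>) \<and>
    (\<forall>c. \<forall>\<phi>\<in>schwartz. u (\<lambda>x. c * \<phi> x) = c * u \<phi>) \<and>
    (\<exists>A C. finite A \<and>
      (\<forall>\<phi>\<in>schwartz. norm (u \<phi>) \<le> C * (\<Sum>(\<alpha>, \<beta>)\<in>A. schwartz_seminorm \<alpha> \<beta> \<phi>)))"

definition vanishes_on :: "'n::finite distr \<Rightarrow> (real ^ 'n) set \<Rightarrow> bool" where
  "vanishes_on u V \<longleftrightarrow> (\<forall>\<phi>\<in>test_functions V. u \<phi> = 0)"

definition distr_mult :: "(real ^ 'n::finite \<Rightarrow> complex) \<Rightarrow> 'n distr \<Rightarrow> 'n distr" where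
  "distr_mult a u = (\<lambda>\<phi>. u (\<lambda>x. a x * \<phi> x))"

text \<open>\<open>D\<^sub>j = -i \<partial>\<^sub>j\<close>, extended to distributions by duality.\<close>

definition distr_D :: "'n \<Rightarrow> 'n::finite distr \<Rightarrow> 'n distr" where
  "distr_D j u = (\<lambda>\<phi>. - u (\<lambda>x. - \<i> * partial_deriv j \<phi> x))"

definition distr_multi_D :: "('n \<Rightarrow>\<^sub>0 nat) \<Rightarrow> 'n::finite distr \<Rightarrow> 'n distr" where
  "distr_multi_D \<alpha> = foldr (\<lambda>j. distr_D j ^^ Poly_Mapping.lookup \<alpha> j) coords"

definition poly_D :: "(('n \<Rightarrow>\<^sub>0 nat) \<Rightarrow>\<^sub>0 complex) \<Rightarrow> 'n::finite distr \<Rightarrow> 'n distr" where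
  "poly_D P u = (\<lambda>\<phi>. \<Sum>\<alpha>\<in>Poly_Mapping.keys P. Poly_Mapping.lookup P \<alpha> * distr_multi_D \<alpha> u \<phi>)"

subsection \<open>Fourier transform\<close>

definition fourier :: "(real ^ 'n::finite \<Rightarrow> complex) \<Rightarrow> real ^ 'n \<Rightarrow> complex" where
  "fourier \<phi> \<xi> = (LINT x|lborel. cis (- (x \<bullet> \<xi>)) * \<phi> x)"

definition inv_fourier :: "(real ^ 'n::finite \<Rightarrow> complex) \<Rightarrow> real ^ 'n \<Rightarrow> complex" where
  "inv_fourier \<phi> x =
    complex_of_real (1 / (2 * pi) ^ CARD('n)) * (LINT \<xi>|lborel. cis (x \<bullet> \<xi>) * \<phi> \<xi>)"

definition distr_fourier :: "'n::finite distr \<Rightarrow> 'n distr" where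
  "distr_fourier u = (\<lambda>\<phi>. u (fourier \<phi>))"

definition distr_inv_fourier :: "'n::finite distr \<Rightarrow> 'n distr" where
  "distr_inv_fourier u = (\<lambda>\<phi>. u (inv_fourier \<phi>))"

subsection \<open>Distributions given by functions; function spaces\<close>

definition distr_of :: "(real ^ 'n::finite \<Rightarrow> complex) \<Rightarrow> 'n distr" where
  "distr_of h = (\<lambda>\<phi>. LINT x|lborel. h x * \<phi> x)"

definition has_density :: "'n::finite distr \<Rightarrow> (real ^ 'n \<Rightarrow> complex) \<Rightarrow> bool" where
  "has_density u h \<longleftrightarrow> h \<in> borel_measurable lborel \<and>
    (\<forall>\<phi>\<in>schwartz. integrable lborel (\<lambda>x. h x * \<phi> x) \<and> u \<phi> = distr_of h \<phi>)"

definition sobolev :: "real \<Rightarrow> 'n::finite distr set" where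
  "sobolev r = {f. tempered f \<and>
    (\<exists>g. integrable lborel (\<lambda>\<xi>. (norm (g \<xi>))\<^sup>2) \<and>
      has_density
        (distr_mult (\<lambda>\<xi>. complex_of_real ((1 + (norm \<xi>)\<^sup>2) powr (r / 2))) (distr_fourier f)) g)}"

definition sobolev_minus_infinity :: "'n::finite distr set" where
  "sobolev_minus_infinity = (\<Union>r. sobolev r)"

definition admissible :: "(real ^ 'n::finite) set \<Rightarrow> 'n distr set" where
  "admissible V =
    {f \<in> sobolev_minus_infinity. \<exists>P. P \<noteq> 0 \<and> vanishes_on (poly_D P f) V}"

definition rapidly_decreasing :: "'n::finite distr set" where
  "rapidly_decreasing = {f. tempered f \<and>
    (\<exists>h. smooth h \<and> (\<forall>\<alpha>. \<exists>C N. \<forall>\<xi>. norm (multi_deriv \<alpha> h \<xi>) \<le> C * (1 + norm \<xi>) ^ N) \<and>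
      has_density (distr_fourier f) h)}"

text \<open>The fractional Laplacian of a distribution whose Fourier transform is a function (as is the
  case for elements of \<^term>\<open>sobolev r\<close> and of \<^term>\<open>rapidly_decreasing\<close>). The function is
  determined almost everywhere, so that the choice does not matter; for the same reason the value of
  \<open>norm \<xi> powr (2 * s)\<close> at \<open>\<xi> = 0\<close> (which is \<open>0\<close> in HOL) does not matter.\<close>

definition frac_laplacian :: "real \<Rightarrow> 'n::finite distr \<Rightarrow> 'n distr" where
  "frac_laplacian s f =
    (let h = (SOME h. has_density (distr_fourier f) h)
     in distr_inv_fourier (distr_of (\<lambda>\<xi>. complex_of_real (norm \<xi> powr (2 * s)) * h \<xi>)))"

end

theory Submission
  imports Defs "HOL-Probability.Probability" "HOL-Real_Asymp.Real_Asymp"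
begin

text \<open>
  Let \<open>h\<close> be the function that represents the Fourier transform of \<open>f\<close>. Tested against \<open>\<phi> \<in> C\<^sub>c\<^sup>\<infinity>(V)\<close> with
  inverse Fourier transform \<open>\<psi>\<close>, the two hypotheses read \<open>\<integral> P h \<psi> = 0\<close> and \<open>\<integral> |\<xi>|\<^bsup>2s\<^esup> h \<psi> = 0\<close>. Differential
  operators do not enlarge supports, so \<open>\<psi>\<close> may be multiplied by arbitrary polynomials in both equations. For
  a bump \<open>\<rho>\<close> of small support with inverse transform \<open>\<beta>\<close>, take \<open>\<phi> = \<rho>(\<cdot> - x)\<close> with \<open>x\<close> in a ball
  inside \<open>V\<close>. Then \<open>F = P h \<beta>\<close> decays faster than any power in the integrated sense, its inverse transform \<open>g\<close>
  vanishes on the ball together with \<open>(-\<Delta>)\<^bsup>s+k\<^esup> g\<close> for all large \<open>k\<close>, and it remains to prove the classical unique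
  continuation property \<open>F = 0\<close>: since \<open>\<beta>\<close> is nonzero on large balls when \<open>\<rho>\<close> has
  small support, and since the zeros of \<open>P\<close> form a null set (\<open>poly_fun_AE_neq_0\<close>), it follows that \<open>h = 0\<close> almost everywhere,
  and \<open>f = 0\<close> by Fourier inversion (\<open>fourier_inv_fourier\<close>).

  Unique continuation is proved with the heat semigroup \<open>u(t) = e\<^bsup>t\<Delta>\<^esup> g\<close>, evaluated at a point of the ball. Because \<open>g\<close>
  vanishes near that point, \<open>u(t) = O(e\<^bsup>-c/t\<^esup>)\<close> as \<open>t \<rightarrow> 0\<close> (\<open>heat_decay\<close>). Write \<open>a\<close> for the fractional part of \<open>s\<close>. Multiplying
  \<open>F\<close> by an even power of \<open>|\<xi>|\<close> if necessary, the exponents \<open>s + k\<close> above may be taken to be \<open>a + j\<close> with all \<open>j \<ge> 0\<close>.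
  The subordination formula \<open>\<Gamma>(1-a) |\<xi>|\<^bsup>2(a+j)\<^esup> = \<integral> t\<^bsup>-a\<^esup> |\<xi>|\<^bsup>2(j+1)\<^esup> e\<^bsup>-t|\<xi>|\<^sup>2\<^esup> dt\<close> turns the vanishing of \<open>(-\<Delta>)\<^bsup>a+j\<^esup> g\<close> into
  \<open>\<integral> t\<^bsup>-a\<^esup> u\<^bsup>(j+1)\<^esup>(t) dt = 0\<close>. Integrating by parts \<open>j + 1\<close> times, without boundary terms thanks to the decay at
  \<open>0\<close>, gives \<open>\<integral> t\<^bsup>-1-a-j\<^esup> u(t) dt = 0\<close> for all \<open>j\<close>; here it is used that \<open>s\<close> is not an integer. The exponential series
  then yields \<open>\<integral> t\<^bsup>-1-a\<^esup> e\<^bsup>-z/t\<^esup> u(t) dt = 0\<close> for small \<open>z > 0\<close>, that is,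
  \<open>\<integral> \<kappa> F e\<^bsup>i x\<bullet>\<xi>\<^esup> d\<xi> = 0\<close> for a positive weight \<open>\<kappa>\<close> of exponential decay (\<open>integral_heat_weight_eq_0\<close>, \<open>heat_weight_decay\<close>).
  The same holds for \<open>F\<close> times any power of a linear form. Thus \<open>\<kappa> F\<close> has a real analytic Fourier transform all of whose
  derivatives vanish at one point (\<open>fourier_integral_eq_0_if_moments_eq_0\<close>), and \<open>F = 0\<close> because the Fourier transform
  is injective (\<open>fourier_integral_injective\<close>).
\<close>

section \<open>Smooth functions\<close>

lemma partial_deriv_eqI:
  "(\<phi> has_derivative D) (at x) \<Longrightarrow> partial_deriv j \<phi> x = D (axis j 1)"
  by (simp add: partial_deriv_def frechet_derivative_at[symmetric])

lemma has_derivative_frechet: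
  "\<phi> differentiable F \<Longrightarrow> (\<phi> has_derivative frechet_derivative \<phi> F) F"
  by (simp add: frechet_derivative_works)

lemma partial_deriv_add:
  assumes "\<phi> differentiable at x" "\<psi> differentiable at x"
  shows "partial_deriv j (\<lambda>x. \<phi> x + \<psi> x) x = partial_deriv j \<phi> x + partial_deriv j \<psi> x"
  using partial_deriv_eqI[OF has_derivative_add[OF assms[THEN has_derivative_frechet]], of j]
  by (simp add: partial_deriv_def[of _ \<phi>] partial_deriv_def[of _ \<psi>])

lemma partial_deriv_mult:
  fixes \<phi> \<psi> :: "real ^ 'n::finite \<Rightarrow> complex"
  assumes "\<phi> differentiable at x" "\<psi> differentiable at x"
  shows "partial_deriv j (\<lambda>x. \<phi> x * \<psi> x) x
    = \<phi> x * partial_deriv j \<psi> x + partial_deriv j \<phi> x * \<psi> x"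
  using partial_deriv_eqI[OF has_derivative_mult[OF assms[THEN has_derivative_frechet]], of j]
  by (simp add: partial_deriv_def[of _ \<phi>] partial_deriv_def[of _ \<psi>])

lemma partial_deriv_const [simp]: "partial_deriv j (\<lambda>x. c) = (\<lambda>x. 0)"
  by (rule ext) (simp add: partial_deriv_eqI[OF has_derivative_const])

lemma partial_deriv_cmult:
  assumes "\<phi> differentiable at x"
  shows "partial_deriv j (\<lambda>x. c * \<phi> x) x = c * partial_deriv j \<phi> x"
  using partial_deriv_mult[of "\<lambda>_. c" x \<phi> j] assms by simp

lemma has_derivative_coord:
  "((\<lambda>x::real^'n::finite. complex_of_real (x $ k)) has_derivative (\<lambda>h. complex_of_real (h $ k))) F"
  by (intro bounded_linear_imp_has_derivative bounded_linear_compose[OF bounded_linear_of_real]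
      bounded_linear_vec_nth)

lemma differentiable_coord:
  "(\<lambda>x::real^'n::finite. complex_of_real (x $ k)) differentiable F"
  using has_derivative_coord differentiable_def by blast

lemma partial_deriv_coord:
  "partial_deriv j (\<lambda>x. complex_of_real (x $ k)) x = (if j = k then 1 else 0)"
  by (subst partial_deriv_eqI[OF has_derivative_coord]) (auto simp: axis_def)

text \<open>
  Families such as "polynomial times a derivative of \<open>\<phi>\<close>" are stable under differentiation only up to
  finite sums. Closing them under addition allows smoothness and rapid decay to be proved by
  coinduction on a family that contains just the typical products.
\<close>

inductive_set finite_sums :: "('a \<Rightarrow> complex) set \<Rightarrow> ('a \<Rightarrow> complex) set" for S where
  base: "\<phi> \<in> S \<Longrightarrow> \<phi> \<in> finite_sums S"
| add: "\<phi> \<in> finite_sums S \<Longrightarrow> \<psi> \<in> finite_sums S \<Longrightarrow> (\<lambda>x. \<phi> x + \<psi> x) \<in> finite_sums S"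

lemma finite_sums_differentiable:
  assumes "\<And>\<phi> x. \<phi> \<in> S \<Longrightarrow> \<phi> differentiable at x" "\<phi> \<in> finite_sums S"
  shows "\<phi> differentiable at x"
  using assms(2) by induction (auto intro: assms(1) differentiable_add)

lemma finite_sums_partial_deriv:
  assumes S: "\<And>\<phi> x. \<phi> \<in> S \<Longrightarrow> \<phi> differentiable at x"
    and pd: "\<And>\<phi> j. \<phi> \<in> S \<Longrightarrow> partial_deriv j \<phi> \<in> finite_sums S"
    and "\<phi> \<in> finite_sums S"
  shows "partial_deriv j \<phi> \<in> finite_sums S"
  using assms(3)
proof induction
  case (add \<phi> \<psi>)
  have "partial_deriv j (\<lambda>x. \<phi> x + \<psi> x) = (\<lambda>x. partial_deriv j \<phi> x + partial_deriv j \<psi> x)"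
    using add by (intro ext partial_deriv_add finite_sums_differentiable[OF S])
  then show ?case using finite_sums.add[OF add.IH] by simp
qed (rule pd)

lemma finite_sums_mult:
  assumes "\<And>\<phi>. \<phi> \<in> S \<Longrightarrow> (\<lambda>x. a x * \<phi> x) \<in> finite_sums S" "\<phi> \<in> finite_sums S"
  shows "(\<lambda>x. a x * \<phi> x) \<in> finite_sums S"
  using assms(2)
proof induction
  case (add \<phi> \<psi>)
  then show ?case using finite_sums.add[OF add.IH] by (simp add: distrib_left)
qed (rule assms)

text \<open>
  Smoothness by coinduction: every iterated partial derivative of a member of \<open>S\<close> stays in the
  additive closure of \<open>S\<close>, so that no explicit formula for higher derivatives is ever needed.
\<close>

lemma smooth_coinduct:
  assumes S: "\<And>\<phi> x. \<phi> \<in> S \<Longrightarrow> \<phi> differentiable at x"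
    and pd: "\<And>\<phi> j. \<phi> \<in> S \<Longrightarrow> partial_deriv j \<phi> \<in> finite_sums S"
    and "\<phi> \<in> S"
  shows "smooth \<phi>"
proof -
  have "foldr partial_deriv js \<phi> \<in> finite_sums S" for js
    by (induction js) (auto intro: finite_sums.base[OF \<open>\<phi> \<in> S\<close>] finite_sums_partial_deriv[OF S pd])
  then show ?thesis unfolding smooth_def using finite_sums_differentiable[OF S] by blast
qed

lemma smooth_differentiable: "smooth \<phi> \<Longrightarrow> \<phi> differentiable at x"
  unfolding smooth_def by (metis foldr.simps(1) id_apply)

lemma smooth_foldr: "smooth \<phi> \<Longrightarrow> smooth (foldr partial_deriv js \<phi>)"
  unfolding smooth_def by (metis foldr_append)

lemma smooth_partial_deriv: "smooth \<phi> \<Longrightarrow> smooth (partial_deriv j \<phi>)"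
  using smooth_foldr[of \<phi> "[j]"] by simp

lemma smooth_const: "smooth (\<lambda>x. c)"
  by (rule smooth_coinduct[of "range (\<lambda>c x. c)"]) (auto intro: finite_sums.base)

lemma smooth_coord: "smooth (\<lambda>x. complex_of_real (x $ k))"
proof (rule smooth_coinduct[of "insert (\<lambda>x. complex_of_real (x $ k)) (range (\<lambda>c x. c))"])
  fix \<phi> :: "real ^ 'a \<Rightarrow> complex" and j
  assume "\<phi> \<in> insert (\<lambda>x. complex_of_real (x $ k)) (range (\<lambda>c x. c))"
  then show "partial_deriv j \<phi> \<in> finite_sums (insert (\<lambda>x. complex_of_real (x $ k)) (range (\<lambda>c x. c)))"
    by (auto intro!: finite_sums.base simp: partial_deriv_coord[abs_def])
qed (auto intro: differentiable_coord)

lemma smooth_mult: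
  assumes "smooth \<phi>" "smooth \<psi>"
  shows "smooth (\<lambda>x::real^'n::finite. \<phi> x * \<psi> x)"
proof (rule smooth_coinduct[of "{\<lambda>x::real^'n. \<phi> x * \<psi> x | \<phi> \<psi>. smooth \<phi> \<and> smooth \<psi>}"])
  let ?S = "{\<lambda>x::real^'n. \<phi> x * \<psi> x | \<phi> \<psi>. smooth \<phi> \<and> smooth \<psi>}"
  fix \<theta> and j :: 'n assume "\<theta> \<in> ?S"
  then obtain \<phi> \<psi> where \<theta>: "\<theta> = (\<lambda>x. \<phi> x * \<psi> x)" "smooth \<phi>" "smooth \<psi>" by auto
  have "partial_deriv j \<theta> = (\<lambda>x. \<phi> x * partial_deriv j \<psi> x + partial_deriv j \<phi> x * \<psi> x)"
    unfolding \<theta> by (intro ext partial_deriv_mult smooth_differentiable \<theta>)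
  moreover have "\<dots> \<in> finite_sums ?S"
    using \<theta> by (intro finite_sums.add finite_sums.base) (auto intro: smooth_partial_deriv)
  ultimately show "partial_deriv j \<theta> \<in> finite_sums ?S" by simp
qed (use assms in \<open>auto intro!: differentiable_mult dest: smooth_differentiable\<close>)

lemma smooth_add:
  assumes "smooth \<phi>" "smooth \<psi>"
  shows "smooth (\<lambda>x::real^'n::finite. \<phi> x + \<psi> x)"
proof (rule smooth_coinduct[of "{\<lambda>x::real^'n. \<phi> x + \<psi> x | \<phi> \<psi>. smooth \<phi> \<and> smooth \<psi>}"])
  let ?S = "{\<lambda>x::real^'n. \<phi> x + \<psi> x | \<phi> \<psi>. smooth \<phi> \<and> smooth \<psi>}"
  fix \<theta> and j :: 'n assume "\<theta> \<in> ?S"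
  then obtain \<phi> \<psi> where \<theta>: "\<theta> = (\<lambda>x. \<phi> x + \<psi> x)" "smooth \<phi>" "smooth \<psi>" by auto
  have "partial_deriv j \<theta> = (\<lambda>x. partial_deriv j \<phi> x + partial_deriv j \<psi> x)"
    unfolding \<theta> by (intro ext partial_deriv_add smooth_differentiable \<theta>)
  moreover have "\<dots> \<in> ?S"
    using \<theta> by (auto intro: smooth_partial_deriv)
  ultimately show "partial_deriv j \<theta> \<in> finite_sums ?S" by (auto intro: finite_sums.base)
qed (use assms in \<open>auto intro!: differentiable_add dest: smooth_differentiable\<close>)

lemma smooth_continuous: "smooth \<phi> \<Longrightarrow> continuous_on A \<phi>"
  by (metis smooth_differentiable differentiable_imp_continuous_within
      continuous_at_imp_continuous_on)

lemma vector_derivative_along_axis: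
  fixes \<psi> :: "real ^ 'n::finite \<Rightarrow> complex"
  assumes "\<psi> differentiable at (x + s *\<^sub>R axis j 1)"
  shows "((\<lambda>s. \<psi> (x + s *\<^sub>R axis j 1)) has_vector_derivative partial_deriv j \<psi> (x + s *\<^sub>R axis j 1)) (at s within A)"
proof -
  let ?u = "axis j 1 :: real^'n"
  let ?D = "frechet_derivative \<psi> (at (x + s *\<^sub>R ?u))"
  have D: "(\<psi> has_derivative ?D) (at (x + s *\<^sub>R ?u))" using assms by (rule has_derivative_frechet)
  interpret D: bounded_linear ?D using D by (rule has_derivative_bounded_linear)
  have "((\<lambda>s. x + s *\<^sub>R ?u) has_derivative (\<lambda>h. h *\<^sub>R ?u)) (at s within A)"
    by (auto intro!: derivative_eq_intros)
  from has_derivative_compose[OF this D] show ?thesis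
    by (simp add: has_vector_derivative_def D.scaleR partial_deriv_def)
qed

lemma norm_diff_le_of_vector_derivative_bound:
  fixes w :: "real \<Rightarrow> 'a::real_normed_vector"
  assumes w: "\<And>s. s \<in> {a..b} \<Longrightarrow> (w has_vector_derivative w' s) (at s within {a..b})"
    and B: "\<And>s. s \<in> {a..b} \<Longrightarrow> norm (w' s) \<le> B" and "a \<le> b"
  shows "norm (w b - w a) \<le> B * (b - a)"
proof -
  have "norm (w b - w a) \<le> B * norm (b - a)"
  proof (rule differentiable_bound[of "{a..b}" w "\<lambda>s h. h *\<^sub>R w' s"])
    fix s assume "s \<in> {a..b}"
    then show "onorm (\<lambda>h. h *\<^sub>R w' s) \<le> B"
      by (intro onorm_le) (metis B abs_ge_zero mult.commute mult_left_mono norm_scaleR real_norm_def)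
  qed (use w \<open>a \<le> b\<close> in \<open>auto simp: has_vector_derivative_def\<close>)
  then show ?thesis using \<open>a \<le> b\<close> by simp
qed

text \<open>
  The mean value inequality, applied in the direction \<open>j\<close> to the increment of \<open>\<phi>\<close> in the direction
  \<open>k\<close>; it uses only that \<open>\<partial>\<^sub>j \<phi>\<close> is differentiable at the single point \<open>x\<close>.
\<close>

lemma second_difference_estimate:
  fixes \<phi> :: "real ^ 'n::finite \<Rightarrow> complex"
  assumes d: "\<And>x. \<phi> differentiable at x" and d2: "partial_deriv j \<phi> differentiable at x" and "e > 0"
  shows "\<exists>\<delta>>0. \<forall>h. 0 < h \<and> h < \<delta> \<longrightarrow>
     norm (\<phi> (x + h *\<^sub>R axis j 1 + h *\<^sub>R axis k 1) - \<phi> (x + h *\<^sub>R axis j 1)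
       - (\<phi> (x + h *\<^sub>R axis k 1) - \<phi> x) - h\<^sup>2 *\<^sub>R partial_deriv k (partial_deriv j \<phi>) x) \<le> e * h\<^sup>2"
proof -
  let ?u = "axis j 1 :: real^'n" and ?v = "axis k 1 :: real^'n"
  let ?g = "partial_deriv j \<phi>"
  define L where "L = frechet_derivative ?g (at x)"
  have L: "(?g has_derivative L) (at x)" using d2 unfolding L_def frechet_derivative_works .
  have Lk: "L ?v = partial_deriv k ?g x" by (simp add: L_def partial_deriv_def)
  interpret L: bounded_linear L using L has_derivative_bounded_linear by blast
  from L have "\<forall>e>0. \<exists>d>0. \<forall>y. norm (y - x) < d \<longrightarrow> norm (?g y - ?g x - L (y - x)) \<le> e * norm (y - x)"
    unfolding has_derivative_at_alt by blast
  then obtain d where "d > 0" and d': "\<And>y. norm (y - x) < d \<Longrightarrow> norm (?g y - ?g x - L (y - x)) \<le> e/4 * norm (y - x)"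
    using \<open>e > 0\<close> by (metis zero_less_divide_iff zero_less_numeral)
  note vd = vector_derivative_along_axis[OF d]
  show ?thesis
  proof (intro exI[of _ "d/2"] conjI allI impI)
    fix h assume h: "0 < h \<and> h < d/2"
    define w where "w s = \<phi> (x + h *\<^sub>R ?v + s *\<^sub>R ?u) - \<phi> (x + s *\<^sub>R ?u) - s *\<^sub>R (h *\<^sub>R L ?v)" for s
    have w: "(w has_vector_derivative (?g (x + h *\<^sub>R ?v + s *\<^sub>R ?u) - ?g (x + s *\<^sub>R ?u) - h *\<^sub>R L ?v)) (at s within {0..h})" for s
      unfolding w_def by (intro derivative_intros vd) (auto intro!: derivative_eq_intros)
    have b: "norm (?g (x + h *\<^sub>R ?v + s *\<^sub>R ?u) - ?g (x + s *\<^sub>R ?u) - h *\<^sub>R L ?v) \<le> e * h" if s: "s \<in> {0..h}" for s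
    proof -
      have n1: "norm (h *\<^sub>R ?v + s *\<^sub>R ?u) \<le> 2 * h"
        using s h norm_triangle_ineq[of "h *\<^sub>R ?v" "s *\<^sub>R ?u"] by simp
      have n2: "norm (s *\<^sub>R ?u) \<le> h" using s h by simp
      have "norm (?g (x + h *\<^sub>R ?v + s *\<^sub>R ?u) - ?g x - L (h *\<^sub>R ?v + s *\<^sub>R ?u)) \<le> e/4 * norm (h *\<^sub>R ?v + s *\<^sub>R ?u)"
        using d'[of "x + h *\<^sub>R ?v + s *\<^sub>R ?u"] n1 h by (simp add: algebra_simps)
      also have "\<dots> \<le> e/4 * (2 * h)" using n1 \<open>e>0\<close> by (intro mult_left_mono) auto
      finally have 1: "norm (?g (x + h *\<^sub>R ?v + s *\<^sub>R ?u) - ?g x - L (h *\<^sub>R ?v + s *\<^sub>R ?u)) \<le> e/4 * (2*h)" .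
      have "norm (?g (x + s *\<^sub>R ?u) - ?g x - L (s *\<^sub>R ?u)) \<le> e/4 * norm (s *\<^sub>R ?u)"
        using d'[of "x + s *\<^sub>R ?u"] n2 h by simp
      also have "\<dots> \<le> e/4 * (2 * h)" using n2 h \<open>e>0\<close> by (intro mult_left_mono) auto
      finally have 2: "norm (?g (x + s *\<^sub>R ?u) - ?g x - L (s *\<^sub>R ?u)) \<le> e/4 * (2*h)" .
      have "?g (x + h *\<^sub>R ?v + s *\<^sub>R ?u) - ?g (x + s *\<^sub>R ?u) - h *\<^sub>R L ?v
        = (?g (x + h *\<^sub>R ?v + s *\<^sub>R ?u) - ?g x - L (h *\<^sub>R ?v + s *\<^sub>R ?u)) - (?g (x + s *\<^sub>R ?u) - ?g x - L (s *\<^sub>R ?u))"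
        by (simp add: L.add L.scaleR)
      then have "norm (?g (x + h *\<^sub>R ?v + s *\<^sub>R ?u) - ?g (x + s *\<^sub>R ?u) - h *\<^sub>R L ?v) \<le> e/4 * (2*h) + e/4 * (2*h)"
        using order_trans[OF norm_triangle_ineq4 add_mono[OF 1 2]] by presburger
      then show ?thesis by (simp add: field_simps)
    qed
    have "norm (w h - w 0) \<le> e * h * (h - 0)"
      by (rule norm_diff_le_of_vector_derivative_bound[OF w b]) (use h in auto)
    then show "norm (\<phi> (x + h *\<^sub>R ?u + h *\<^sub>R ?v) - \<phi> (x + h *\<^sub>R ?u) - (\<phi> (x + h *\<^sub>R ?v) - \<phi> x) - h\<^sup>2 *\<^sub>R partial_deriv k (partial_deriv j \<phi>) x) \<le> e * h\<^sup>2"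
      using h by (simp add: w_def Lk algebra_simps power2_eq_square)
  qed (use \<open>d>0\<close> in auto)
qed

text \<open>
  The second difference is symmetric in the two directions, and by the preceding estimate it
  determines either mixed derivative (Young's form of Schwarz's theorem).
\<close>

lemma partial_deriv_commute:
  assumes "smooth \<phi>"
  shows "partial_deriv j (partial_deriv k \<phi>) = partial_deriv k (partial_deriv j \<phi>)"
proof (rule ext, rule ccontr)
  fix x assume ne: "partial_deriv j (partial_deriv k \<phi>) x \<noteq> partial_deriv k (partial_deriv j \<phi>) x"
  let ?a = "partial_deriv j (partial_deriv k \<phi>) x" and ?b = "partial_deriv k (partial_deriv j \<phi>) x"
  define e where "e = norm (?a - ?b) / 4"
  have "e > 0" using ne by (simp add: e_def)
  note d = smooth_differentiable[OF assms]
  obtain d1 where d1: "d1 > 0" "\<And>h. 0 < h \<Longrightarrow> h < d1 \<Longrightarrow>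
     norm (\<phi> (x + h *\<^sub>R axis j 1 + h *\<^sub>R axis k 1) - \<phi> (x + h *\<^sub>R axis j 1)
       - (\<phi> (x + h *\<^sub>R axis k 1) - \<phi> x) - h\<^sup>2 *\<^sub>R ?b) \<le> e * h\<^sup>2"
    using second_difference_estimate[OF d smooth_differentiable[OF smooth_partial_deriv[OF assms]] \<open>e > 0\<close>] by metis
  obtain d2 where d2: "d2 > 0" "\<And>h. 0 < h \<Longrightarrow> h < d2 \<Longrightarrow>
     norm (\<phi> (x + h *\<^sub>R axis k 1 + h *\<^sub>R axis j 1) - \<phi> (x + h *\<^sub>R axis k 1)
       - (\<phi> (x + h *\<^sub>R axis j 1) - \<phi> x) - h\<^sup>2 *\<^sub>R ?a) \<le> e * h\<^sup>2"
    using second_difference_estimate[OF d smooth_differentiable[OF smooth_partial_deriv[OF assms]] \<open>e > 0\<close>] by metis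
  define h where "h = min d1 d2 / 2"
  have h: "0 < h" "h < d1" "h < d2" using d1(1) d2(1) by (auto simp: h_def)
  let ?D = "\<phi> (x + h *\<^sub>R axis j 1 + h *\<^sub>R axis k 1) - \<phi> (x + h *\<^sub>R axis j 1)
       - (\<phi> (x + h *\<^sub>R axis k 1) - \<phi> x)"
  have "norm (?D - h\<^sup>2 *\<^sub>R ?b) \<le> e * h\<^sup>2" using d1(2) h by auto
  moreover have "norm (?D - h\<^sup>2 *\<^sub>R ?a) \<le> e * h\<^sup>2" using d2(2)[of h] h by (simp add: algebra_simps)
  moreover have "h\<^sup>2 *\<^sub>R (?a - ?b) = (?D - h\<^sup>2 *\<^sub>R ?b) - (?D - h\<^sup>2 *\<^sub>R ?a)"
    by (simp add: scaleR_diff_right)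
  ultimately have "norm (h\<^sup>2 *\<^sub>R (?a - ?b)) \<le> e * h\<^sup>2 + e * h\<^sup>2"
    by (simp only:) (rule order_trans[OF norm_triangle_ineq4 add_mono])
  then have "h\<^sup>2 * (4 * e) \<le> 2 * (e * h\<^sup>2)" by (simp add: e_def)
  moreover have "e * h\<^sup>2 > 0" using \<open>e>0\<close> h by simp
  ultimately show False by (simp add: mult.commute)
qed

section \<open>Schwartz functions and test functions\<close>

text \<open>
  Monomials as words in the coordinates. Compared with multi-indices, words make the Leibniz rule
  a one-step induction.
\<close>

definition coord_prod :: "'n list \<Rightarrow> real ^ 'n::finite \<Rightarrow> complex" where
  "coord_prod ks x = (\<Prod>k\<leftarrow>ks. complex_of_real (x $ k))"

lemma coord_prod_simps [simp]:
  "coord_prod [] = (\<lambda>x. 1)" "coord_prod (k # ks) x = complex_of_real (x $ k) * coord_prod ks x"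
  by (auto simp: coord_prod_def)

lemma coord_prod_append: "coord_prod (ks @ ls) x = coord_prod ks x * coord_prod ls x"
  by (simp add: coord_prod_def)

definition list_of_index :: "('n::finite \<Rightarrow>\<^sub>0 nat) \<Rightarrow> 'n list" where
  "list_of_index \<alpha> = concat (map (\<lambda>j. replicate (Poly_Mapping.lookup \<alpha> j) j) coords)"

lemma mset_list_of_index: "count (mset (list_of_index \<alpha>)) j = Poly_Mapping.lookup \<alpha> j"
proof -
  have "count (mset (concat (map (\<lambda>j. replicate (f j) j) xs))) j = (if j \<in> set xs then f j else 0)"
    if "distinct xs" for xs and f :: "'a \<Rightarrow> nat"
    using that by (induction xs) (auto split: if_splits)
  from this[OF coords(1)] show ?thesis by (simp add: coords(2) list_of_index_def)
qed

lemma foldr_funpow_conv_foldr: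
  "foldr (\<lambda>j. g j ^^ f j) js u = foldr g (concat (map (\<lambda>j. replicate (f j) j) js)) u"
proof -
  have "foldr g (replicate n j) u = (g j ^^ n) u" for n j u
    by (induction n) auto
  then show ?thesis by (induction js) auto
qed

lemma multi_deriv_conv_foldr: "multi_deriv \<alpha> \<phi> = foldr partial_deriv (list_of_index \<alpha>) \<phi>"
  by (simp add: multi_deriv_def list_of_index_def foldr_funpow_conv_foldr)

lemma monomial_conv_coord_prod: "complex_of_real (monomial \<alpha> x) = coord_prod (list_of_index \<alpha>) x"
proof -
  have "coord_prod (concat (map (\<lambda>j. replicate (f j) j) xs)) x = (\<Prod>j\<in>set xs. complex_of_real (x $ j) ^ f j)"
    if "distinct xs" for xs f
    using that by (induction xs) (simp_all add: coord_prod_append, simp add: coord_prod_def)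
  from this[OF coords(1)] show ?thesis by (simp add: coords(2) list_of_index_def monomial_def)
qed

lemma mset_eq_list_of_index: "\<exists>\<alpha>. mset (list_of_index \<alpha>) = mset ks"
proof (rule exI[of _ "Abs_poly_mapping (count (mset ks))"], rule multiset_eqI)
  show "count (mset (list_of_index (Abs_poly_mapping (count (mset ks))))) x = count (mset ks) x" for x
    by (simp add: mset_list_of_index)
qed

lemma coord_prod_mset_cong: "mset ks = mset ls \<Longrightarrow> coord_prod ks = coord_prod ls"
  by (rule ext) (simp only: coord_prod_def prod_mset_prod_list[symmetric] mset_map)

lemma foldr_partial_deriv_mset_cong:
  assumes "smooth \<phi>" "mset js = mset ks"
  shows "foldr partial_deriv js \<phi> = foldr partial_deriv ks \<phi>"
  using assms(2)
proof (induction js arbitrary: ks)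
  case (Cons j js)
  have "j \<in> set ks" using Cons.prems by (metis list.set_intros(1) mset_eq_setD)
  then obtain as bs where ks: "ks = as @ j # bs" by (meson split_list)
  have "foldr partial_deriv (as @ j # bs) \<phi> = partial_deriv j (foldr partial_deriv (as @ bs) \<phi>)"
  proof (induction as)
    case (Cons a as)
    then show ?case using partial_deriv_commute[OF smooth_foldr[OF assms(1)], of a j "as @ bs"] by simp
  qed simp
  moreover have "foldr partial_deriv js \<phi> = foldr partial_deriv (as @ bs) \<phi>"
    using Cons.prems ks by (intro Cons.IH) simp
  ultimately show ?case by (simp add: ks)
qed simp

text \<open>
  Derivatives commute, hence arbitrary words of coordinates and of derivatives may replace the
  ordered multi-indices of the definition. In this form the Schwartz space is visibly
  closed under differentiation.
\<close>

lemma schwartz_iff: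
  fixes \<phi> :: "real ^ 'n::finite \<Rightarrow> complex"
  shows
  "\<phi> \<in> schwartz \<longleftrightarrow> smooth \<phi> \<and>
     (\<forall>ks js. bounded (range (\<lambda>x. coord_prod ks x * foldr partial_deriv js \<phi> x)))"
proof (intro iffI conjI allI)
  fix ks js :: "'n list" assume \<phi>: "\<phi> \<in> schwartz"
  then have "smooth \<phi>" by (simp add: schwartz_def)
  obtain \<alpha> where \<alpha>: "mset (list_of_index \<alpha>) = mset ks"
    using mset_eq_list_of_index[of ks] by blast
  obtain \<beta> where \<beta>: "mset (list_of_index \<beta>) = mset js"
    using mset_eq_list_of_index[of js] by blast
  have "coord_prod ks = coord_prod (list_of_index \<alpha>)"
    by (rule coord_prod_mset_cong) (simp add: \<alpha>)
  moreover have "foldr partial_deriv js \<phi> = multi_deriv \<beta> \<phi>"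
    unfolding multi_deriv_conv_foldr
    by (rule foldr_partial_deriv_mset_cong[OF \<open>smooth \<phi>\<close>]) (simp add: \<beta>)
  ultimately show "bounded (range (\<lambda>x. coord_prod ks x * foldr partial_deriv js \<phi> x))"
    using \<phi> by (simp add: schwartz_def flip: monomial_conv_coord_prod)
qed (auto simp: schwartz_def monomial_conv_coord_prod multi_deriv_conv_foldr)

text \<open>
  It suffices to bound the members of \<open>S\<close> themselves: the weighted derivatives in the definition
  of the Schwartz space lie again in the additive closure of \<open>S\<close>.
\<close>

lemma schwartz_coinduct:
  assumes S: "\<And>\<phi> x. \<phi> \<in> S \<Longrightarrow> \<phi> differentiable at x"
    and pd: "\<And>\<phi> j. \<phi> \<in> S \<Longrightarrow> partial_deriv j \<phi> \<in> finite_sums S"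
    and co: "\<And>\<phi> k. \<phi> \<in> S \<Longrightarrow> (\<lambda>x. complex_of_real (x $ k) * \<phi> x) \<in> finite_sums S"
    and bd: "\<And>\<phi>. \<phi> \<in> S \<Longrightarrow> bounded (range \<phi>)"
    and "\<phi> \<in> S"
  shows "\<phi> \<in> schwartz"
proof -
  have bd: "bounded (range \<phi>)" if "\<phi> \<in> finite_sums S" for \<phi>
    using that by induction (auto intro: bd bounded_plus_comp)
  have 1: "foldr partial_deriv js \<phi> \<in> finite_sums S" for js
    by (induction js) (auto intro: finite_sums.base[OF \<open>\<phi> \<in> S\<close>] finite_sums_partial_deriv[OF S pd])
  have "(\<lambda>x. coord_prod ks x * foldr partial_deriv js \<phi> x) \<in> finite_sums S" for ks js
  proof (induction ks)
    case (Cons k ks)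
    then show ?case using finite_sums_mult[OF co Cons] by (simp add: mult.assoc)
  qed (use 1 in simp)
  then show ?thesis unfolding schwartz_iff
    using smooth_coinduct[OF S pd \<open>\<phi> \<in> S\<close>] bd by blast
qed

lemma schwartz_smooth: "\<phi> \<in> schwartz \<Longrightarrow> smooth \<phi>"
  by (simp add: schwartz_def)

lemmas schwartz_differentiable = smooth_differentiable[OF schwartz_smooth]
lemmas schwartz_continuous = smooth_continuous[OF schwartz_smooth]

lemma schwartz_bounded: "\<phi> \<in> schwartz \<Longrightarrow> bounded (range \<phi>)"
  unfolding schwartz_iff by (elim conjE allE[of _ "[]"]) simp

lemma schwartz_partial_deriv:
  assumes "\<phi> \<in> schwartz" shows "partial_deriv j \<phi> \<in> schwartz"
  unfolding schwartz_iff
proof (intro conjI allI)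
  show "bounded (range (\<lambda>x. coord_prod ks x * foldr partial_deriv js (partial_deriv j \<phi>) x))" for ks js
    using assms unfolding schwartz_iff by (elim conjE allE[of _ ks] allE[of _ "js @ [j]"]) simp
qed (use assms in \<open>auto intro: smooth_partial_deriv schwartz_smooth\<close>)

lemma schwartz_zero: "(\<lambda>x. 0) \<in> schwartz"
  by (rule schwartz_coinduct[of "{\<lambda>x. 0}"]) (auto intro: finite_sums.base)

lemma schwartz_add:
  assumes "\<phi> \<in> schwartz" "\<psi> \<in> schwartz"
  shows "(\<lambda>x. \<phi> x + \<psi> x) \<in> schwartz"
  unfolding schwartz_iff
proof (intro conjI allI)
  fix ks js
  have "foldr partial_deriv js (\<lambda>x. \<phi> x + \<psi> x) = (\<lambda>x. foldr partial_deriv js \<phi> x + foldr partial_deriv js \<psi> x)"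
    by (induction js) (auto intro!: ext partial_deriv_add smooth_differentiable smooth_foldr schwartz_smooth[OF assms(1)] schwartz_smooth[OF assms(2)])
  moreover have "bounded (range (\<lambda>x. coord_prod ks x * foldr partial_deriv js \<phi> x))"
      "bounded (range (\<lambda>x. coord_prod ks x * foldr partial_deriv js \<psi> x))"
    using assms by (auto simp: schwartz_iff)
  ultimately show "bounded (range (\<lambda>x. coord_prod ks x * foldr partial_deriv js (\<lambda>x. \<phi> x + \<psi> x) x))"
    using bounded_plus_comp by (simp add: distrib_left)
qed (use assms in \<open>auto intro: smooth_add schwartz_smooth\<close>)

lemma schwartz_coord_mult:
  assumes "\<phi> \<in> schwartz"
  shows "(\<lambda>x. complex_of_real (x $ k) * \<phi> x) \<in> schwartz"
proof (rule schwartz_coinduct)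
  let ?S = "{\<lambda>x. coord_prod ks x * \<psi> x | ks \<psi>. \<psi> \<in> schwartz}"
  have co: "(\<lambda>x. complex_of_real (x $ k) * \<phi> x) \<in> ?S" if "\<phi> \<in> ?S" for \<phi> k
  proof -
    from that obtain ks \<psi> where "\<phi> = (\<lambda>x. coord_prod ks x * \<psi> x)" "\<psi> \<in> schwartz" by auto
    then show ?thesis by (auto intro!: exI[of _ "k # ks"] exI[of _ \<psi>])
  qed
  have d: "(\<lambda>x. coord_prod ks x * \<psi> x) differentiable at x" if "\<psi> \<in> schwartz" for ks \<psi> x
  proof (induction ks)
    case (Cons k ks)
    then show ?case using differentiable_mult[OF differentiable_coord[of k] Cons] by (simp add: mult.assoc)
  qed (use that in \<open>simp add: schwartz_differentiable\<close>)
  then show "\<phi> differentiable at x" if "\<phi> \<in> ?S" for \<phi> x using that by auto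
  show "(\<lambda>x. complex_of_real (x $ k) * \<phi> x) \<in> finite_sums ?S" if "\<phi> \<in> ?S" for \<phi> k
    using co[OF that] by (rule finite_sums.base)
  show "bounded (range \<phi>)" if "\<phi> \<in> ?S" for \<phi>
  proof -
    from that obtain ks \<psi> where "\<phi> = (\<lambda>x. coord_prod ks x * \<psi> x)" "\<psi> \<in> schwartz" by auto
    then show ?thesis unfolding schwartz_iff by (elim conjE allE[of _ ks] allE[of _ "[]"]) simp
  qed
  show "(\<lambda>x. complex_of_real (x $ k) * \<phi> x) \<in> ?S"
    using assms by (auto intro!: exI[of _ "[k]"] exI[of _ \<phi>])
  show "partial_deriv j \<phi> \<in> finite_sums ?S" if \<phi>: "\<phi> \<in> ?S" for \<phi> j
  proof -
    from \<phi> obtain ks \<psi> where \<phi>: "\<phi> = (\<lambda>x. coord_prod ks x * \<psi> x)" and \<psi>: "\<psi> \<in> schwartz" by auto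
    have "partial_deriv j (\<lambda>x. coord_prod ks x * \<psi> x) \<in> finite_sums ?S"
    proof (induction ks)
      case Nil
      show ?case
        by (rule finite_sums.base) (use \<psi> in \<open>auto intro!: exI[of _ "[]"] schwartz_partial_deriv\<close>)
    next
      case (Cons k ks)
      have eq: "partial_deriv j (\<lambda>x. coord_prod (k # ks) x * \<psi> x) =
          (\<lambda>x. complex_of_real (x $ k) * partial_deriv j (\<lambda>x. coord_prod ks x * \<psi> x) x
            + coord_prod ks x * (if j = k then \<psi> x else 0))"
        by (rule ext, simp only: coord_prod_simps mult.assoc, subst partial_deriv_mult[OF differentiable_coord d[OF \<psi>]])
          (auto simp: partial_deriv_coord)
      have "(if j = k then \<psi> else (\<lambda>x. 0)) \<in> schwartz"
        by (simp add: \<psi> schwartz_zero)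
      then have "(\<lambda>x. coord_prod ks x * (if j = k then \<psi> else (\<lambda>x. 0)) x) \<in> ?S"
        by blast
      then have "(\<lambda>x. coord_prod ks x * (if j = k then \<psi> x else 0)) \<in> ?S"
        by (cases "j = k") auto
      moreover have "(\<lambda>x. complex_of_real (x $ k) * partial_deriv j (\<lambda>x. coord_prod ks x * \<psi> x) x) \<in> finite_sums ?S"
        by (rule finite_sums_mult[OF _ Cons]) (rule finite_sums.base, rule co)
      ultimately show ?case
        unfolding eq by (intro finite_sums.add) (auto intro: finite_sums.base)
    qed
    then show ?thesis by (simp add: \<phi>)
  qed
qed

lemma schwartz_cmult:
  assumes "\<phi> \<in> schwartz" shows "(\<lambda>x. c * \<phi> x) \<in> schwartz"
proof (rule schwartz_coinduct)
  let ?S = "{\<lambda>x. c * \<psi> x | \<psi>. \<psi> \<in> schwartz}"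
  show "\<phi> differentiable at x" if "\<phi> \<in> ?S" for \<phi> x
    using that by (auto intro!: differentiable_mult dest: schwartz_differentiable)
  show "bounded (range \<phi>)" if "\<phi> \<in> ?S" for \<phi>
    using that by (auto dest!: schwartz_bounded simp: bounded_iff norm_mult) (meson mult_left_mono norm_ge_zero)
  show "partial_deriv j \<phi> \<in> finite_sums ?S" if "\<phi> \<in> ?S" for \<phi> j
  proof (rule finite_sums.base)
    from that obtain \<psi> where \<psi>: "\<phi> = (\<lambda>x. c * \<psi> x)" "\<psi> \<in> schwartz" by auto
    then have "partial_deriv j \<phi> = (\<lambda>x. c * partial_deriv j \<psi> x)"
      by (auto intro!: partial_deriv_cmult schwartz_differentiable)
    then show "partial_deriv j \<phi> \<in> ?S" using schwartz_partial_deriv[OF \<psi>(2)] by auto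
  qed
  show "(\<lambda>x. complex_of_real (x $ k) * \<phi> x) \<in> finite_sums ?S" if "\<phi> \<in> ?S" for \<phi> k
  proof (rule finite_sums.base)
    from that obtain \<psi> where \<psi>: "\<phi> = (\<lambda>x. c * \<psi> x)" "\<psi> \<in> schwartz" by auto
    then show "(\<lambda>x. complex_of_real (x $ k) * \<phi> x) \<in> ?S"
      using schwartz_coord_mult[OF \<psi>(2), of k] by (auto intro!: exI[of _ "\<lambda>x. complex_of_real (x $ k) * \<psi> x"])
  qed
qed (use assms in auto)

lemma schwartz_sum:
  "finite A \<Longrightarrow> (\<And>i. i \<in> A \<Longrightarrow> \<phi> i \<in> schwartz) \<Longrightarrow> (\<lambda>x. \<Sum>i\<in>A. \<phi> i x) \<in> schwartz"
  by (induction A rule: finite_induct) (auto intro: schwartz_zero schwartz_add)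

lemma norm_power2_vec: "(norm (x :: real ^ 'n::finite))\<^sup>2 = (\<Sum>k\<in>UNIV. (x $ k)\<^sup>2)"
  by (simp only: power2_norm_eq_inner inner_vec_def inner_real_def power2_eq_square[of "_ $ _"])

lemma schwartz_norm_power2_mult:
  fixes \<phi> :: "real ^ 'n::finite \<Rightarrow> complex"
  assumes "\<phi> \<in> schwartz"
  shows "(\<lambda>x. complex_of_real ((1 + (norm x)\<^sup>2) ^ m) * \<phi> x) \<in> schwartz"
proof (induction m)
  case (Suc m)
  have "(\<lambda>x. (complex_of_real ((1 + (norm x)\<^sup>2) ^ m) * \<phi> x) + (\<Sum>k\<in>UNIV. complex_of_real (x $ k) *
     (complex_of_real (x $ k) * (complex_of_real ((1 + (norm x)\<^sup>2) ^ m) * \<phi> x)))) \<in> schwartz"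
    by (intro schwartz_add Suc schwartz_sum schwartz_coord_mult) auto
  moreover have "(\<lambda>x. (complex_of_real ((1 + (norm x)\<^sup>2) ^ m) * \<phi> x) + (\<Sum>k\<in>UNIV. complex_of_real (x $ k) *
     (complex_of_real (x $ k) * (complex_of_real ((1 + (norm x)\<^sup>2) ^ m) * \<phi> x)))) =
     (\<lambda>x. complex_of_real ((1 + (norm x)\<^sup>2) ^ Suc m) * \<phi> x)"
    unfolding norm_power2_vec by (rule ext) (simp add: sum_distrib_left sum_distrib_right algebra_simps power2_eq_square)
  ultimately show ?case by simp
qed (use assms in simp)

lemma has_derivative_bracket_powr:
  "((\<lambda>x::real^'n::finite. complex_of_real ((1 + (norm x)\<^sup>2) powr a)) has_derivative
    (\<lambda>h. complex_of_real (a * (1 + (norm x)\<^sup>2) powr (a - 1) * (2 * (x \<bullet> h))))) (at x)"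
proof -
  have pos: "1 + (norm x)\<^sup>2 > 0" by (rule add_pos_nonneg) auto
  have "((\<lambda>x. 1 + x \<bullet> x) has_derivative (\<lambda>h. 2 * (x \<bullet> h))) (at x)"
    by (auto intro!: derivative_eq_intros simp: inner_commute)
  moreover have "((\<lambda>t. t powr a) has_real_derivative a * (1 + x \<bullet> x) powr (a - 1)) (at (1 + x \<bullet> x))"
    using pos by (intro has_real_derivative_powr) (simp add: power2_norm_eq_inner)
  ultimately have "((\<lambda>x. (1 + x \<bullet> x) powr a) has_derivative (\<lambda>h. a * (1 + x \<bullet> x) powr (a - 1) * (2 * (x \<bullet> h)))) (at x)"
    using has_derivative_compose[of "\<lambda>x. 1 + x \<bullet> x" _ x UNIV "\<lambda>t. t powr a"] by (simp add: has_field_derivative_def)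
  then show ?thesis
    unfolding power2_norm_eq_inner by (rule has_derivative_of_real)
qed

text \<open>
  Differentiating \<open>(1 + |x|\<^sup>2)\<^sup>a\<close> produces \<open>x\<^sub>j\<close> times the same function with exponent \<open>a - 1\<close>, so the
  products with all exponents form a family to which coinduction applies.
\<close>

lemma schwartz_bracket_powr_mult:
  fixes \<phi> :: "real ^ 'n::finite \<Rightarrow> complex"
  assumes "\<phi> \<in> schwartz"
  shows "(\<lambda>x. complex_of_real ((1 + (norm x)\<^sup>2) powr a) * \<phi> x) \<in> schwartz"
proof (rule schwartz_coinduct)
  let ?S = "{\<lambda>x. complex_of_real ((1 + (norm x)\<^sup>2) powr a) * \<psi> x | a \<psi>. \<psi> \<in> (schwartz :: (real ^ 'n \<Rightarrow> complex) set)}"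
  have d: "(\<lambda>x. complex_of_real ((1 + (norm x)\<^sup>2) powr a)) differentiable at x" for a and x :: "real^'n"
    using has_derivative_bracket_powr differentiable_def by blast
  then show "\<phi> differentiable at x" if "\<phi> \<in> ?S" for \<phi> x
    using that by (auto intro!: differentiable_mult dest: schwartz_differentiable)
  show "bounded (range \<phi>)" if "\<phi> \<in> ?S" for \<phi>
  proof -
    from that obtain a \<psi> where \<psi>: "\<phi> = (\<lambda>x. complex_of_real ((1 + (norm x)\<^sup>2) powr a) * \<psi> x)" "\<psi> \<in> schwartz" by auto
    obtain B where B: "\<And>x. norm (complex_of_real ((1 + (norm x)\<^sup>2) ^ nat \<lceil>a\<rceil>) * \<psi> x) \<le> B"
      using schwartz_bounded[OF schwartz_norm_power2_mult[OF \<psi>(2)]] unfolding bounded_iff by blast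
    have "norm (\<phi> x) \<le> B" for x
    proof -
      have pos: "1 + (norm x)\<^sup>2 > 0" by (rule add_pos_nonneg) auto
      have "(1 + (norm x)\<^sup>2) powr a \<le> (1 + (norm x)\<^sup>2) powr real (nat \<lceil>a\<rceil>)"
        by (intro powr_mono real_nat_ceiling_ge) simp
      also have "\<dots> = (1 + (norm x)\<^sup>2) ^ nat \<lceil>a\<rceil>"
        by (rule powr_realpow[OF pos])
      finally have "(1 + (norm x)\<^sup>2) powr a * norm (\<psi> x) \<le> (1 + (norm x)\<^sup>2) ^ nat \<lceil>a\<rceil> * norm (\<psi> x)"
        by (rule mult_right_mono) simp
      then have "norm (\<phi> x) \<le> norm (complex_of_real ((1 + (norm x)\<^sup>2) ^ nat \<lceil>a\<rceil>) * \<psi> x)"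
        unfolding \<psi>(1) norm_mult norm_of_real using pos by (simp only: abs_of_nonneg powr_ge_zero zero_le_power less_imp_le)
      then show ?thesis using B[of x] by linarith
    qed
    then show ?thesis unfolding bounded_iff by blast
  qed
  show "partial_deriv j \<phi> \<in> finite_sums ?S" if "\<phi> \<in> ?S" for \<phi> j
  proof -
    from that obtain a \<psi> where \<psi>: "\<phi> = (\<lambda>x. complex_of_real ((1 + (norm x)\<^sup>2) powr a) * \<psi> x)" "\<psi> \<in> schwartz" by auto
    have "partial_deriv j \<phi> = (\<lambda>x. complex_of_real ((1 + (norm x)\<^sup>2) powr a) * partial_deriv j \<psi> x
      + complex_of_real ((1 + (norm x)\<^sup>2) powr (a - 1)) * (complex_of_real (2 * a) * (complex_of_real (x $ j) * \<psi> x)))"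
      unfolding \<psi>(1)
      by (rule ext, subst partial_deriv_mult[OF d schwartz_differentiable[OF \<psi>(2)]], subst partial_deriv_eqI[OF has_derivative_bracket_powr])
        (simp add: inner_axis)
    also have "\<dots> \<in> finite_sums ?S"
      by (intro finite_sums.add finite_sums.base CollectI)
        (intro exI conjI, rule refl, rule schwartz_partial_deriv[OF \<psi>(2)],
         intro exI conjI, rule refl, rule schwartz_cmult[OF schwartz_coord_mult[OF \<psi>(2)]])
    finally show ?thesis .
  qed
  show "(\<lambda>x. complex_of_real (x $ k) * \<phi> x) \<in> finite_sums ?S" if "\<phi> \<in> ?S" for \<phi> k
  proof (rule finite_sums.base)
    from that obtain a \<psi> where \<psi>: "\<phi> = (\<lambda>x. complex_of_real ((1 + (norm x)\<^sup>2) powr a) * \<psi> x)" "\<psi> \<in> schwartz" by auto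
    then show "(\<lambda>x. complex_of_real (x $ k) * \<phi> x) \<in> ?S"
      using schwartz_coord_mult[OF \<psi>(2), of k]
      by (auto intro!: exI[of _ a] exI[of _ "\<lambda>x. complex_of_real (x $ k) * \<psi> x"])
  qed
qed (use assms in auto)

text \<open>
  Differential operators do not enlarge supports. This locality is what distinguishes
  polynomial multipliers from \<open>|\<xi>|\<^bsup>2s\<^esup>\<close> in the whole argument.
\<close>

lemma partial_deriv_eq_0_outside_support:
  assumes "x \<notin> closure {x. \<phi> x \<noteq> 0}"
  shows "partial_deriv j \<phi> x = 0"
proof -
  have "(\<phi> has_derivative (\<lambda>h. 0)) (at x)"
  proof (rule has_derivative_transform_within_open[of "\<lambda>_. 0" _ _ _ "- closure {x. \<phi> x \<noteq> 0}"])
    show "0 = \<phi> y" if "y \<in> - closure {x. \<phi> x \<noteq> 0}" for y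
      using that closure_subset[of "{x. \<phi> x \<noteq> 0}"] by auto
  qed (use assms in auto)
  from partial_deriv_eqI[OF this] show ?thesis .
qed

lemma test_functionsI:
  assumes "\<phi> \<in> test_functions V" "smooth \<psi>" "\<And>x. x \<notin> closure {x. \<phi> x \<noteq> 0} \<Longrightarrow> \<psi> x = 0"
  shows "\<psi> \<in> test_functions V"
proof -
  have "closure {x. \<psi> x \<noteq> 0} \<subseteq> closure {x. \<phi> x \<noteq> 0}"
    using assms(3) by (intro closure_minimal) auto
  then show ?thesis using assms(1,2) compact_Int_closed[of "closure {x. \<phi> x \<noteq> 0}" "closure {x. \<psi> x \<noteq> 0}"]
    by (auto simp: test_functions_def Int_absorb1)
qed

lemma test_functions_partial_deriv:
  assumes "\<phi> \<in> test_functions V" shows "partial_deriv j \<phi> \<in> test_functions V"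
  by (rule test_functionsI[OF assms smooth_partial_deriv partial_deriv_eq_0_outside_support])
    (use assms in \<open>auto simp: test_functions_def\<close>)

lemma test_functions_mult:
  assumes "\<phi> \<in> test_functions V" "smooth a" shows "(\<lambda>x. a x * \<phi> x) \<in> test_functions V"
proof (rule test_functionsI[OF assms(1)])
  show "smooth (\<lambda>x. a x * \<phi> x)"
    using assms by (intro smooth_mult) (auto simp: test_functions_def)
  show "a x * \<phi> x = 0" if "x \<notin> closure {x. \<phi> x \<noteq> 0}" for x
    using that closure_subset[of "{x. \<phi> x \<noteq> 0}"] by auto
qed

lemma test_functions_cmult:
  "\<phi> \<in> test_functions V \<Longrightarrow> (\<lambda>x. c * \<phi> x) \<in> test_functions V"
  by (rule test_functions_mult[OF _ smooth_const])

lemma test_functions_add: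
  assumes \<phi>: "\<phi> \<in> test_functions V" and \<psi>: "\<psi> \<in> test_functions V"
  shows "(\<lambda>x. \<phi> x + \<psi> x) \<in> test_functions V"
proof -
  let ?K = "closure {x. \<phi> x \<noteq> 0} \<union> closure {x. \<psi> x \<noteq> 0}"
  have K: "compact ?K" "?K \<subseteq> V" using \<phi> \<psi> by (auto simp: test_functions_def compact_Un)
  have "{x. \<phi> x + \<psi> x \<noteq> 0} \<subseteq> {x. \<phi> x \<noteq> 0} \<union> {x. \<psi> x \<noteq> 0}" by auto
  from closure_mono[OF this] have sub: "closure {x. \<phi> x + \<psi> x \<noteq> 0} \<subseteq> ?K" by simp
  have "compact (?K \<inter> closure {x. \<phi> x + \<psi> x \<noteq> 0})" using K(1) by (rule compact_Int_closed) simp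
  moreover have "?K \<inter> closure {x. \<phi> x + \<psi> x \<noteq> 0} = closure {x. \<phi> x + \<psi> x \<noteq> 0}"
    using sub by (rule Int_absorb1)
  moreover have "smooth (\<lambda>x. \<phi> x + \<psi> x)" using \<phi> \<psi> by (intro smooth_add) (auto simp: test_functions_def)
  ultimately show ?thesis using sub K(2) by (simp add: test_functions_def subset_trans[OF sub K(2)])
qed

lemma test_functions_bounded:
  assumes "\<phi> \<in> test_functions V" shows "bounded (range \<phi>)"
proof -
  let ?K = "closure {x. \<phi> x \<noteq> 0}"
  have "compact (\<phi> ` ?K)"
    by (rule compact_continuous_image) (use assms smooth_continuous in \<open>auto simp: test_functions_def\<close>)
  then have "bounded (insert 0 (\<phi> ` ?K))" using compact_imp_bounded by auto
  moreover have "\<phi> x \<in> insert 0 (\<phi> ` ?K)" for x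
    using closure_subset[of "{x. \<phi> x \<noteq> 0}"] by (cases "\<phi> x = 0") auto
  then have "range \<phi> \<subseteq> insert 0 (\<phi> ` ?K)" by (rule image_subsetI)
  ultimately show ?thesis by (rule bounded_subset)
qed

lemma test_functions_schwartz:
  assumes "\<phi> \<in> test_functions V" shows "\<phi> \<in> schwartz"
proof (rule schwartz_coinduct[of "test_functions V"])
  fix \<phi> x j assume \<phi>: "\<phi> \<in> test_functions V"
  then have "smooth \<phi>" by (simp add: test_functions_def)
  then show "\<phi> differentiable at x" by (rule smooth_differentiable)
  show "partial_deriv j \<phi> \<in> finite_sums (test_functions V)"
    by (rule finite_sums.base) (rule test_functions_partial_deriv[OF \<phi>])
  show "(\<lambda>x. complex_of_real (x $ j) * \<phi> x) \<in> finite_sums (test_functions V)"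
    by (rule finite_sums.base) (rule test_functions_mult[OF \<phi> smooth_coord])
  show "bounded (range \<phi>)" by (rule test_functions_bounded[OF \<phi>])
qed (rule assms)

section \<open>Integration on Euclidean space\<close>

lemma
  fixes f :: "'a::euclidean_space \<Rightarrow> real \<Rightarrow> complex"
  assumes f: "\<And>b. b \<in> Basis \<Longrightarrow> integrable lborel (f b)"
  shows lborel_integrable_prod_Basis: "integrable lborel (\<lambda>x::'a. \<Prod>b\<in>Basis. f b (x \<bullet> b))"
    and lborel_integral_prod_Basis:
      "(LINT x|lborel. (\<Prod>b\<in>Basis. f b (x \<bullet> b))) = (\<Prod>b\<in>Basis. LINT t|lborel. f b t)"
proof -
  interpret product_sigma_finite "\<lambda>b::'a. lborel :: real measure" ..
  have [measurable]: "f b \<in> borel_measurable borel" if "b \<in> Basis" for b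
    using borel_measurable_integrable[OF f[OF that]] by simp
  have m: "(\<lambda>x::'a. \<Prod>b\<in>Basis. f b (x \<bullet> b)) \<in> borel_measurable borel" by measurable
  have eq: "(\<Prod>b\<in>Basis. f b ((\<Sum>c\<in>Basis. x c *\<^sub>R c) \<bullet> b)) = (\<Prod>b\<in>Basis. f b (x b))" for x :: "'a \<Rightarrow> real"
    by (rule prod.cong) auto
  have T: "(\<lambda>x. \<Sum>b\<in>(Basis::'a set). x b *\<^sub>R b) \<in> measurable (\<Pi>\<^sub>M b\<in>Basis. lborel) borel"
    by measurable
  show "integrable lborel (\<lambda>x::'a. \<Prod>b\<in>Basis. f b (x \<bullet> b))"
    by (subst lborel_eq, subst integrable_distr_eq[OF T]) (use m in \<open>auto simp: eq intro!: product_integrable_prod f\<close>)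
  show "(LINT x|lborel. (\<Prod>b\<in>Basis. f b (x \<bullet> b))) = (\<Prod>b\<in>Basis. LINT t|lborel. f b t)"
    by (subst lborel_eq, subst integral_distr[OF T m]) (auto simp: eq intro!: product_integral_prod f)
qed

text \<open>
  Comparison with a product of one-dimensional integrable functions, since
  \<open>1 + |x|\<^sup>2\<close> dominates each factor \<open>1 + x\<^sub>b\<^sup>2\<close>.
\<close>

lemma integrable_inverse_bracket_prod:
  "integrable lborel (\<lambda>x::'a::euclidean_space. 1 / (1 + (norm x)\<^sup>2) ^ DIM('a))"
proof -
  have "integrable lborel (\<lambda>t::real. inverse (1 + t\<^sup>2))"
    using integrable_inverse_1_plus_square by (simp add: set_integrable_def)
  then have 1: "integrable lborel (\<lambda>t::real. complex_of_real (inverse (1 + t\<^sup>2)))"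
    by (rule integrable_of_real)
  have 2: "integrable lborel (\<lambda>x::'a. \<Prod>b\<in>Basis. complex_of_real (inverse (1 + (x \<bullet> b)\<^sup>2)))"
    by (rule lborel_integrable_prod_Basis) (rule 1)
  have le: "norm (1 / (1 + (norm x)\<^sup>2) ^ DIM('a))
      \<le> norm (\<Prod>b\<in>Basis. complex_of_real (inverse (1 + (x \<bullet> b)\<^sup>2)))" for x :: 'a
  proof -
    have pos: "1 + r\<^sup>2 > 0" for r :: real by (rule add_pos_nonneg) auto
    have "(\<Prod>b\<in>(Basis::'a set). 1 + (x \<bullet> b)\<^sup>2) \<le> (\<Prod>b\<in>(Basis::'a set). 1 + (norm x)\<^sup>2)"
      by (intro prod_mono) (auto intro!: add_nonneg_nonneg simp: Basis_le_norm abs_le_square_iff[symmetric])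
    also have "\<dots> = (1 + (norm x)\<^sup>2) ^ DIM('a)" by simp
    finally have "1 / (1 + (norm x)\<^sup>2) ^ DIM('a) \<le> 1 / (\<Prod>b\<in>Basis. 1 + (x \<bullet> b)\<^sup>2)"
      by (intro divide_left_mono mult_pos_pos prod_pos zero_less_power pos) auto
    also have "\<dots> = (\<Prod>b\<in>Basis. inverse (1 + (x \<bullet> b)\<^sup>2))"
      by (simp add: divide_inverse prod_inversef[symmetric] o_def)
    also have "\<dots> = norm (\<Prod>b\<in>Basis. complex_of_real (inverse (1 + (x \<bullet> b)\<^sup>2)))"
      by (simp only: prod_norm[symmetric] norm_of_real) (intro prod.cong, auto simp: abs_of_pos pos)
    finally show ?thesis using zero_less_power[OF pos, of "norm x" "DIM('a)"]
      by (simp only: real_norm_def abs_of_pos zero_less_divide_1_iff)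
  qed
  show ?thesis
    by (rule Bochner_Integration.integrable_bound[OF 2 _ AE_I2[OF le]]) measurable
qed

lemma integrable_le_bracket:
  fixes \<psi> :: "'a::euclidean_space \<Rightarrow> complex"
  assumes "\<psi> \<in> borel_measurable borel" "\<And>x. norm (\<psi> x) \<le> C / (1 + (norm x)\<^sup>2) ^ DIM('a)"
  shows "integrable lborel \<psi>"
proof (rule Bochner_Integration.integrable_bound)
  show "integrable lborel (\<lambda>x::'a. C * (1 / (1 + (norm x)\<^sup>2) ^ DIM('a)))"
    by (intro integrable_mult_right integrable_inverse_bracket_prod)
  show "AE x in lborel. norm (\<psi> x) \<le> norm (C * (1 / (1 + (norm x)\<^sup>2) ^ DIM('a)))"
    using order_trans[OF assms(2) abs_ge_self] by (intro AE_I2) (simp only: real_norm_def mult_1_right times_divide_eq_right)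
qed (use assms in simp)

lemma norm_integral_le:
  fixes f :: "'a \<Rightarrow> 'b::{banach,second_countable_topology}"
  assumes "integrable M g" "\<And>x. norm (f x) \<le> g x"
  shows "norm (integral\<^sup>L M f) \<le> integral\<^sup>L M g"
proof (cases "integrable M f")
  case True
  have "norm (integral\<^sup>L M f) \<le> (LINT x|M. norm (f x))" by (rule integral_norm_bound)
  also have "\<dots> \<le> integral\<^sup>L M g" using True assms by (intro integral_mono) auto
  finally show ?thesis .
next
  case False
  have "integral\<^sup>L M g \<ge> 0"
    using assms(2) order_trans[OF norm_ge_zero] by (intro Bochner_Integration.integral_nonneg) blast
  with False show ?thesis by (simp add: not_integrable_integral_eq)
qed

lemma schwartz_le_bracket:
  fixes \<phi> :: "real ^ 'n::finite \<Rightarrow> complex"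
  assumes "\<phi> \<in> schwartz"
  obtains C where "\<And>x. norm (\<phi> x) \<le> C / (1 + (norm x)\<^sup>2) ^ m"
proof -
  obtain C where C: "\<And>x. norm (complex_of_real ((1 + (norm x)\<^sup>2) ^ m) * \<phi> x) \<le> C"
    using schwartz_bounded[OF schwartz_norm_power2_mult[OF assms, of m]] unfolding bounded_iff by blast
  have pos: "(1 + (norm x)\<^sup>2) ^ m > 0" for x :: "real^'n" by (intro zero_less_power add_pos_nonneg) auto
  have "norm (\<phi> x) \<le> C / (1 + (norm x)\<^sup>2) ^ m" for x
    using C[of x] pos[of x] unfolding norm_mult norm_of_real
    by (simp only: abs_of_pos pos_le_divide_eq mult.commute)
  then show thesis using that by blast
qed

lemma schwartz_measurable: "\<phi> \<in> schwartz \<Longrightarrow> \<phi> \<in> borel_measurable borel"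
  by (intro borel_measurable_continuous_onI schwartz_continuous)

lemma schwartz_integrable:
  fixes \<phi> :: "real ^ 'n::finite \<Rightarrow> complex"
  assumes "\<phi> \<in> schwartz" shows "integrable lborel \<phi>"
  using schwartz_le_bracket[OF assms, of "DIM(real^'n)"] integrable_le_bracket[OF schwartz_measurable[OF assms]]
  by metis

lemma (in pair_sigma_finite) integrable_pair_le_prod:
  fixes k :: "'a \<times> 'b \<Rightarrow> complex" and A :: "'a \<Rightarrow> real" and B :: "'b \<Rightarrow> real"
  assumes [measurable]: "k \<in> borel_measurable (M1 \<Otimes>\<^sub>M M2)" and A: "integrable M1 A" and B: "integrable M2 B"
    and le: "\<And>x y. norm (k (x, y)) \<le> A x * B y"
  shows "integrable (M1 \<Otimes>\<^sub>M M2) k"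
proof -
  have [measurable]: "A \<in> borel_measurable M1" "B \<in> borel_measurable M2"
    using A B by (auto intro: borel_measurable_integrable)
  have "integrable (M1 \<Otimes>\<^sub>M M2) (\<lambda>(x, y). A x * B y)"
  proof (rule Fubini_integrable)
    show "AE x in M1. integrable M2 (\<lambda>y. case (x, y) of (x, y) \<Rightarrow> A x * B y)"
      using B by auto
    have "integrable M1 (\<lambda>x. \<bar>A x\<bar> * (LINT y|M2. \<bar>B y\<bar>))" using A by auto
    then show "integrable M1 (\<lambda>x. LINT y|M2. norm (case (x, y) of (x, y) \<Rightarrow> A x * B y))"
      by (simp add: abs_mult)
  qed measurable
  moreover have "norm (k z) \<le> norm (case z of (x, y) \<Rightarrow> A x * B y)" for z
    using order_trans[OF le abs_ge_self, of "fst z" "snd z"] by (simp add: case_prod_beta)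
  ultimately show ?thesis
    by (intro Bochner_Integration.integrable_bound[where g=k] AE_I2) (use assms(1) in auto)
qed

text \<open>
  Fubini's theorem under a hypothesis that is easy to verify: domination by a product of integrable functions
  of one variable each.
\<close>

lemma Fubini_le_prod:
  fixes k :: "'a::euclidean_space \<Rightarrow> 'b::euclidean_space \<Rightarrow> complex"
  assumes "case_prod k \<in> borel_measurable (borel \<Otimes>\<^sub>M borel)" "integrable lborel A" "integrable lborel B"
    and "\<And>x y. norm (k x y) \<le> A x * B y"
  shows "(LINT x|lborel. LINT y|lborel. k x y) = (LINT y|lborel. LINT x|lborel. k x y)"
proof -
  have "case_prod k \<in> borel_measurable (lborel \<Otimes>\<^sub>M lborel)"
    by (subst measurable_cong_sets[OF sets_pair_measure_cong[OF sets_lborel sets_lborel] refl]) (rule assms)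
  then have "integrable (lborel \<Otimes>\<^sub>M lborel) (case_prod k)"
    by (rule lborel_pair.integrable_pair_le_prod[OF _ assms(2,3)]) (simp add: assms(4))
  then show ?thesis by (rule lborel_pair.Fubini_integral[symmetric])
qed

section \<open>The Fourier transform of Schwartz functions\<close>

lemma borel_measurable_cis [measurable]:
  "f \<in> borel_measurable M \<Longrightarrow> (\<lambda>x. cis (f x)) \<in> borel_measurable M"
  unfolding cis_conv_exp by measurable

lemma integrable_cis_mult:
  fixes f :: "'a \<Rightarrow> complex"
  assumes "integrable M f" "g \<in> borel_measurable M"
  shows "integrable M (\<lambda>x. cis (g x) * f x)"
  using assms(1) by (rule Bochner_Integration.integrable_bound) (use assms in \<open>auto simp: norm_mult\<close>)

lemma lborel_integral_translate:
  fixes f :: "'a::euclidean_space \<Rightarrow> 'b::{banach,second_countable_topology}"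
  assumes "f \<in> borel_measurable borel"
  shows "(LINT x|lborel. f (x + c)) = (LINT x|lborel. f x)"
  using integral_distr[of "(+) c" lborel borel f] assms lborel_distr_plus[of c] by (simp add: add.commute)

lemma lborel_integrable_translate:
  fixes f :: "'a::euclidean_space \<Rightarrow> 'b::{banach,second_countable_topology}"
  assumes "integrable lborel f"
  shows "integrable lborel (\<lambda>x. f (x + c))"
proof -
  have "integrable (distr lborel borel ((+) c)) f" using assms by (simp only: lborel_distr_plus)
  then have "integrable lborel (\<lambda>x. f (c + x))" by (subst (asm) integrable_distr_eq) (use assms in auto)
  then show ?thesis by (simp only: add.commute)
qed

text \<open>
  Difference quotients have integral zero by translation invariance; the limit is dominated by
  means of the mean value inequality. This replaces integration by parts in one coordinate.
\<close>

lemma integral_partial_deriv_eq_0: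
  fixes \<psi> :: "real ^ 'n::finite \<Rightarrow> complex"
  assumes d: "\<And>x. \<psi> differentiable at x" and int: "integrable lborel \<psi>"
    and bd: "\<And>x. norm (partial_deriv j \<psi> x) \<le> C / (1 + (norm x)\<^sup>2) ^ DIM(real^'n)"
    and m: "partial_deriv j \<psi> \<in> borel_measurable borel"
  shows "(LINT x|lborel. partial_deriv j \<psi> x) = 0"
proof -
  let ?u = "axis j 1 :: real^'n"
  let ?d = "DIM(real^'n)"
  have [measurable]: "\<psi> \<in> borel_measurable borel" using borel_measurable_integrable[OF int] by simp
  note m[measurable]
  define q where "q m x = (\<psi> (x + (1 / real (Suc m)) *\<^sub>R ?u) - \<psi> x) / complex_of_real (1 / real (Suc m))" for m x
  have C: "C \<ge> 0" using order_trans[OF norm_ge_zero bd[of 0]] by simp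
  have q0: "(LINT x|lborel. q m x) = 0" for m
  proof -
    have "(LINT x|lborel. \<psi> (x + c) - \<psi> x) = 0" for c
      using lborel_integral_translate[of \<psi> c] lborel_integrable_translate[OF int, of c]
      by (simp add: Bochner_Integration.integral_diff int)
    then show ?thesis unfolding q_def integral_divide_zero by simp
  qed
  have bound: "norm (q m x) \<le> 3 ^ ?d * C * (1 / (1 + (norm x)\<^sup>2) ^ ?d)" for m x
  proof -
    let ?h = "1 / real (Suc m)"
    have "norm (\<psi> (x + ?h *\<^sub>R ?u) - \<psi> (x + 0 *\<^sub>R ?u)) \<le> 3 ^ ?d * C * (1 / (1 + (norm x)\<^sup>2) ^ ?d) * (?h - 0)"
    proof (rule norm_diff_le_of_vector_derivative_bound[OF vector_derivative_along_axis[OF d]])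
      fix s assume s: "s \<in> {0..?h}"
      have arith: "X \<le> 2 * Y + 2 \<Longrightarrow> 0 \<le> Y \<Longrightarrow> 1 + X \<le> 3 * (1 + Y)" for X Y :: real by simp
      have "?h \<le> 1" by simp
      moreover have "s \<le> ?h" using s by simp
      ultimately have "s \<le> 1" by (rule order_trans[rotated])
      let ?y = "x + s *\<^sub>R ?u"
      have "norm x \<le> norm ?y + 1"
        using norm_triangle_ineq4[of ?y "s *\<^sub>R ?u"] s \<open>s \<le> 1\<close> by simp
      then have "(norm x)\<^sup>2 \<le> (norm ?y + 1)\<^sup>2" by (intro power_mono) auto
      also have "\<dots> \<le> 2 * (norm ?y)\<^sup>2 + 2"
        using sum_squares_bound[of "norm ?y" 1] by (simp add: power2_sum)
      finally have le: "1 + (norm x)\<^sup>2 \<le> 3 * (1 + (norm ?y)\<^sup>2)"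
        using arith[OF _ zero_le_power2] by blast
      have pos: "1 + r\<^sup>2 > 0" for r :: real by (rule add_pos_nonneg) auto
      have "(1 + (norm x)\<^sup>2) ^ ?d \<le> (3 * (1 + (norm ?y)\<^sup>2)) ^ ?d"
        using le pos less_imp_le by (intro power_mono) auto
      then have "(1 + (norm x)\<^sup>2) ^ ?d \<le> 3 ^ ?d * (1 + (norm ?y)\<^sup>2) ^ ?d"
        by (simp only: power_mult_distrib)
      then have "1 / (1 + (norm ?y)\<^sup>2) ^ ?d \<le> 3 ^ ?d * (1 / (1 + (norm x)\<^sup>2) ^ ?d)"
        using zero_less_power[OF pos[of "norm ?y"], of ?d] zero_less_power[OF pos[of "norm x"], of ?d]
        by (simp add: field_simps)
      from mult_left_mono[OF this C]
      have "C / (1 + (norm ?y)\<^sup>2) ^ ?d \<le> 3 ^ ?d * C * (1 / (1 + (norm x)\<^sup>2) ^ ?d)" by (simp add: mult_ac)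
      then show "norm (partial_deriv j \<psi> ?y) \<le> 3 ^ ?d * C * (1 / (1 + (norm x)\<^sup>2) ^ ?d)"
        using order_trans[OF bd] by blast
    qed simp
    then show ?thesis unfolding q_def norm_divide norm_of_real
      by (subst pos_divide_le_eq) (simp_all del: of_nat_Suc)
  qed
  have "(\<lambda>m. LINT x|lborel. q m x) \<longlonglongrightarrow> (LINT x|lborel. partial_deriv j \<psi> x)"
  proof (rule integral_dominated_convergence)
    show "integrable lborel (\<lambda>x::real^'n. 3 ^ ?d * C * (1 / (1 + (norm x)\<^sup>2) ^ ?d))"
      by (intro integrable_mult_right integrable_inverse_bracket_prod)
    show "AE x in lborel. norm (q m x) \<le> 3 ^ ?d * C * (1 / (1 + (norm x)\<^sup>2) ^ ?d)" for m
      using bound by simp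
    show "AE x in lborel. (\<lambda>m. q m x) \<longlonglongrightarrow> partial_deriv j \<psi> x"
    proof (rule AE_I2)
      fix x
      have "((\<lambda>s. \<psi> (x + s *\<^sub>R ?u)) has_vector_derivative partial_deriv j \<psi> x) (at 0)"
        using vector_derivative_along_axis[of \<psi> x 0 j UNIV] d by simp
      then have *: "((\<lambda>h. norm (\<psi> (x + h *\<^sub>R ?u) - \<psi> x - h *\<^sub>R partial_deriv j \<psi> x) / norm h) \<longlongrightarrow> 0) (at 0)"
        by (simp add: has_vector_derivative_def has_derivative_at)
      have "norm (\<psi> (x + h *\<^sub>R ?u) - \<psi> x - h *\<^sub>R partial_deriv j \<psi> x) / norm h
          = norm ((1/h) *\<^sub>R (\<psi> (x + h *\<^sub>R ?u) - \<psi> x) - partial_deriv j \<psi> x)" if "h \<noteq> 0" for h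
      proof -
        have "(1/h) *\<^sub>R (\<psi> (x + h *\<^sub>R ?u) - \<psi> x) - partial_deriv j \<psi> x
            = (1/h) *\<^sub>R (\<psi> (x + h *\<^sub>R ?u) - \<psi> x - h *\<^sub>R partial_deriv j \<psi> x)"
          using that by (simp add: scaleR_diff_right)
        then show ?thesis by (simp only: norm_scaleR) (simp add: divide_inverse mult.commute)
      qed
      then have "((\<lambda>h. norm ((1/h) *\<^sub>R (\<psi> (x + h *\<^sub>R ?u) - \<psi> x) - partial_deriv j \<psi> x)) \<longlongrightarrow> 0) (at 0)"
        by (intro Lim_transform_eventually[OF *]) (simp add: eventually_at_filter)
      then have "((\<lambda>h. (1/h) *\<^sub>R (\<psi> (x + h *\<^sub>R ?u) - \<psi> x)) \<longlongrightarrow> partial_deriv j \<psi> x) (at 0)"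
        using Lim_null tendsto_norm_zero_iff by blast
      moreover have "filterlim (\<lambda>m. 1 / real (Suc m)) (at 0) sequentially"
        using LIMSEQ_inverse_real_of_nat by (auto simp: filterlim_at inverse_eq_divide intro!: always_eventually)
      ultimately have "(\<lambda>m. (1 / (1 / real (Suc m))) *\<^sub>R (\<psi> (x + (1 / real (Suc m)) *\<^sub>R ?u) - \<psi> x)) \<longlonglongrightarrow> partial_deriv j \<psi> x"
        by (rule filterlim_compose)
      then show "(\<lambda>m. q m x) \<longlonglongrightarrow> partial_deriv j \<psi> x"
        by (simp add: q_def scaleR_conv_of_real divide_complex_def mult.commute del: of_nat_Suc)
    qed
    show "(\<lambda>x. q m x) \<in> borel_measurable lborel" for m unfolding q_def by measurable
  qed (use m in simp)
  then show ?thesis using q0 by (simp add: LIMSEQ_const_iff)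
qed

lemma cis_linear_approx: "norm (cis t - 1 - \<i> * complex_of_real t) \<le> \<bar>t\<bar>\<^sup>2 / 2"
proof -
  have "(\<Sum>k\<le>1. (\<i> * complex_of_real t) ^ k / fact k) = 1 + \<i> * complex_of_real t" by simp
  moreover have "Suc 1 = 2" "fact (Suc 1) = (2::real)" by simp_all
  ultimately show ?thesis using iexp_approx1[of t 1] unfolding cis_conv_exp diff_diff_eq by metis
qed

text \<open>
  The second moment of \<open>\<phi>\<close> bounds the remainder quadratically, because
  \<open>|e\<^sup>i\<^sup>\<theta> - 1 - i\<theta>| \<le> \<theta>\<^sup>2/2\<close>.
\<close>

lemma has_derivative_fourier_integral:
  fixes \<phi> :: "'a::euclidean_space \<Rightarrow> complex"
  assumes i0: "integrable lborel \<phi>" and i1: "integrable lborel (\<lambda>x. complex_of_real (norm x) * \<phi> x)"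
    and i2: "integrable lborel (\<lambda>x. complex_of_real ((norm x)\<^sup>2) * \<phi> x)"
  shows "((\<lambda>\<xi>. LINT x|lborel. cis (x \<bullet> \<xi>) * \<phi> x) has_derivative
     (\<lambda>h. LINT x|lborel. \<i> * complex_of_real (x \<bullet> h) * (cis (x \<bullet> \<xi>) * \<phi> x))) (at \<xi>)"
proof -
  let ?F = "\<lambda>\<xi>. LINT x|lborel. cis (x \<bullet> \<xi>) * \<phi> x"
  let ?D = "\<lambda>h. LINT x|lborel. \<i> * complex_of_real (x \<bullet> h) * (cis (x \<bullet> \<xi>) * \<phi> x)"
  have [measurable]: "\<phi> \<in> borel_measurable borel" using borel_measurable_integrable[OF i0] by simp
  have j1: "integrable lborel (\<lambda>x. \<i> * complex_of_real (x \<bullet> h) * (cis (x \<bullet> \<xi>) * \<phi> x))" for h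
  proof (rule Bochner_Integration.integrable_bound)
    show "integrable lborel (\<lambda>x. complex_of_real (norm h) * (complex_of_real (norm x) * \<phi> x))"
      using i1 by (rule integrable_mult_right)
    show "AE x in lborel. norm (\<i> * complex_of_real (x \<bullet> h) * (cis (x \<bullet> \<xi>) * \<phi> x))
      \<le> norm (complex_of_real (norm h) * (complex_of_real (norm x) * \<phi> x))"
    proof (rule AE_I2)
      fix x
      show "norm (\<i> * complex_of_real (x \<bullet> h) * (cis (x \<bullet> \<xi>) * \<phi> x)) \<le> norm (complex_of_real (norm h) * (complex_of_real (norm x) * \<phi> x))"
        using mult_right_mono[OF Cauchy_Schwarz_ineq2 norm_ge_zero, of x h "\<phi> x"] by (simp add: norm_mult mult_ac)
    qed
  qed measurable
  have j0: "integrable lborel (\<lambda>x. cis (x \<bullet> \<eta>) * \<phi> x)" for \<eta>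
    by (rule integrable_cis_mult[OF i0]) measurable
  define B where "B = (LINT x|lborel. norm (complex_of_real ((norm x)\<^sup>2) * \<phi> x))"
  define B1 where "B1 = (LINT x|lborel. norm (complex_of_real (norm x) * \<phi> x))"
  have lin: "bounded_linear ?D"
  proof (rule bounded_linear_intro[where K=B1])
    show "?D (h + k) = ?D h + ?D k" for h k
      using Bochner_Integration.integral_add[OF j1[of h] j1[of k]] by (simp add: inner_add_right algebra_simps)
    show "?D (r *\<^sub>R h) = r *\<^sub>R ?D h" for r h
      unfolding integral_scaleR_right[symmetric] by (simp add: scaleR_conv_of_real mult_ac)
    show "norm (?D h) \<le> norm h * B1" for h
    proof -
      have "norm (?D h) \<le> (LINT x|lborel. norm h * norm (complex_of_real (norm x) * \<phi> x))"
      proof (rule norm_integral_le)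
        show "integrable lborel (\<lambda>x. norm h * norm (complex_of_real (norm x) * \<phi> x))"
          by (rule integrable_mult_right, rule integrable_norm, rule i1)
        show "norm (\<i> * complex_of_real (x \<bullet> h) * (cis (x \<bullet> \<xi>) * \<phi> x)) \<le> norm h * norm (complex_of_real (norm x) * \<phi> x)" for x
          using mult_right_mono[OF Cauchy_Schwarz_ineq2 norm_ge_zero, of x h "\<phi> x"] by (simp add: norm_mult mult_ac)
      qed
      then show ?thesis by (simp add: B1_def)
    qed
  qed
  have err: "norm (?F y - ?F \<xi> - ?D (y - \<xi>)) \<le> (norm (y - \<xi>))\<^sup>2 / 2 * B" for y
  proof -
    let ?h = "y - \<xi>"
    have pt: "cis (x \<bullet> y) * \<phi> x - cis (x \<bullet> \<xi>) * \<phi> x - \<i> * complex_of_real (x \<bullet> ?h) * (cis (x \<bullet> \<xi>) * \<phi> x)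
      = (cis (x \<bullet> ?h) - 1 - \<i> * complex_of_real (x \<bullet> ?h)) * (cis (x \<bullet> \<xi>) * \<phi> x)" for x
    proof -
      have "cis (x \<bullet> y) = cis (x \<bullet> ?h) * cis (x \<bullet> \<xi>)" by (simp add: cis_mult inner_diff_right)
      then show ?thesis by (simp only: left_diff_distrib mult_1_left mult.assoc)
    qed
    have eq: "?F y - ?F \<xi> - ?D ?h = (LINT x|lborel. (cis (x \<bullet> ?h) - 1 - \<i> * complex_of_real (x \<bullet> ?h)) * (cis (x \<bullet> \<xi>) * \<phi> x))"
      using Bochner_Integration.integral_diff[OF Bochner_Integration.integrable_diff[OF j0[of y] j0[of \<xi>]] j1[of ?h]]
        Bochner_Integration.integral_diff[OF j0[of y] j0[of \<xi>]] by (simp only: pt)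
    have "norm (LINT x|lborel. (cis (x \<bullet> ?h) - 1 - \<i> * complex_of_real (x \<bullet> ?h)) * (cis (x \<bullet> \<xi>) * \<phi> x))
      \<le> (LINT x|lborel. (norm ?h)\<^sup>2 / 2 * norm (complex_of_real ((norm x)\<^sup>2) * \<phi> x))"
    proof (rule norm_integral_le)
      show "integrable lborel (\<lambda>x. (norm ?h)\<^sup>2 / 2 * norm (complex_of_real ((norm x)\<^sup>2) * \<phi> x))"
        by (rule integrable_mult_right, rule integrable_norm, rule i2)
      fix x
      have "norm (cis (x \<bullet> ?h) - 1 - \<i> * complex_of_real (x \<bullet> ?h)) \<le> \<bar>x \<bullet> ?h\<bar>\<^sup>2 / 2"
        by (rule cis_linear_approx)
      also have "\<dots> \<le> (norm x * norm ?h)\<^sup>2 / 2"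
        using Cauchy_Schwarz_ineq2[of x ?h] by (intro divide_right_mono power_mono) auto
      finally have "norm (cis (x \<bullet> ?h) - 1 - \<i> * complex_of_real (x \<bullet> ?h)) * norm (\<phi> x) \<le> (norm x * norm ?h)\<^sup>2 / 2 * norm (\<phi> x)"
        by (rule mult_right_mono) simp
      then show "norm ((cis (x \<bullet> ?h) - 1 - \<i> * complex_of_real (x \<bullet> ?h)) * (cis (x \<bullet> \<xi>) * \<phi> x))
         \<le> (norm ?h)\<^sup>2 / 2 * norm (complex_of_real ((norm x)\<^sup>2) * \<phi> x)"
        by (simp add: norm_mult norm_power power_mult_distrib mult_ac)
    qed
    then show ?thesis unfolding eq by (simp add: B_def)
  qed
  show ?thesis
    unfolding has_derivative_at_alt
  proof (intro conjI allI impI lin)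
    fix e :: real assume "e > 0"
    have B: "B \<ge> 0" unfolding B_def by (intro integral_nonneg_AE AE_I2 norm_ge_zero)
    show "\<exists>d>0. \<forall>y. norm (y - \<xi>) < d \<longrightarrow> norm (?F y - ?F \<xi> - ?D (y - \<xi>)) \<le> e * norm (y - \<xi>)"
    proof (rule exI[of _ "e / (B + 1)"], intro conjI allI impI)
      fix y assume y: "norm (y - \<xi>) < e / (B + 1)"
      define n where "n = norm (y - \<xi>)"
      have "n * (B + 1) \<le> e" using y B by (simp add: pos_less_divide_eq n_def)
      moreover have "n * (B / 2) \<le> n * (B + 1)"
        using B by (intro mult_left_mono) (auto simp: n_def)
      ultimately have "n * (B / 2) \<le> e" by (rule order_trans[rotated])
      then have "n * (n * (B / 2)) \<le> n * e" by (rule mult_left_mono) (simp add: n_def)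
      moreover have "n\<^sup>2 / 2 * B = n * (n * (B / 2))" by (simp add: power2_eq_square)
      ultimately show "norm (?F y - ?F \<xi> - ?D (y - \<xi>)) \<le> e * norm (y - \<xi>)"
        using order_trans[OF err[of y]] by (simp only: n_def[symmetric] mult.commute)
    qed (use \<open>e > 0\<close> B in simp)
  qed
qed

abbreviation fourier_integral :: "('a::euclidean_space \<Rightarrow> complex) \<Rightarrow> 'a \<Rightarrow> complex" where
  "fourier_integral \<phi> \<xi> \<equiv> LINT x|lborel. cis (x \<bullet> \<xi>) * \<phi> x"

lemma schwartz_norm_mult_integrable:
  fixes \<phi> :: "real ^ 'n::finite \<Rightarrow> complex"
  assumes "\<phi> \<in> schwartz"
  shows "integrable lborel (\<lambda>x. complex_of_real (norm x ^ m) * \<phi> x)"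
proof (rule Bochner_Integration.integrable_bound)
  show "integrable lborel (\<lambda>x. complex_of_real ((1 + (norm x)\<^sup>2) ^ m) * \<phi> x)"
    by (rule schwartz_integrable[OF schwartz_norm_power2_mult[OF assms]])
  show "AE x in lborel. norm (complex_of_real (norm x ^ m) * \<phi> x) \<le> norm (complex_of_real ((1 + (norm x)\<^sup>2) ^ m) * \<phi> x)"
  proof (rule AE_I2)
    fix x :: "real^'n"
    have "norm x \<le> 1 + (norm x)\<^sup>2"
      using sum_squares_bound[of "norm x" 1] zero_le_power2[of "norm x"] norm_ge_zero[of x] by (simp only: power_one mult_1_right) 
    then have "norm x ^ m \<le> (1 + (norm x)\<^sup>2) ^ m" by (intro power_mono) auto
    then have "norm x ^ m * norm (\<phi> x) \<le> (1 + (norm x)\<^sup>2) ^ m * norm (\<phi> x)" by (rule mult_right_mono) simp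
    then show "norm (complex_of_real (norm x ^ m) * \<phi> x) \<le> norm (complex_of_real ((1 + (norm x)\<^sup>2) ^ m) * \<phi> x)"
      unfolding norm_mult norm_of_real by (simp only: abs_of_nonneg zero_le_power norm_ge_zero add_nonneg_nonneg zero_le_one zero_le_power2)
  qed
qed (use schwartz_measurable[OF assms] in measurable)

lemma fourier_integral_schwartz_has_derivative:
  fixes \<phi> :: "real ^ 'n::finite \<Rightarrow> complex"
  assumes "\<phi> \<in> schwartz"
  shows "(fourier_integral \<phi> has_derivative
     (\<lambda>h. LINT x|lborel. \<i> * complex_of_real (x \<bullet> h) * (cis (x \<bullet> \<xi>) * \<phi> x))) (at \<xi>)"
  using schwartz_norm_mult_integrable[OF assms, of 1] schwartz_norm_mult_integrable[OF assms, of 2]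
  by (intro has_derivative_fourier_integral) (simp_all add: schwartz_integrable[OF assms])

text \<open>
  The function \<open>e\<^bsup>i x\<bullet>\<xi>\<^esup> \<phi>\<close> has a partial derivative with integral zero, and the product rule
  splits that derivative into the two sides.
\<close>

lemma fourier_integral_partial_deriv:
  fixes \<phi> :: "real ^ 'n::finite \<Rightarrow> complex"
  assumes "\<phi> \<in> schwartz"
  shows "fourier_integral (partial_deriv j \<phi>) \<xi> = - \<i> * complex_of_real (\<xi> $ j) * fourier_integral \<phi> \<xi>"
proof -
  let ?e = "\<lambda>x::real^'n. cis (x \<bullet> \<xi>)"
  let ?\<psi> = "\<lambda>x. ?e x * \<phi> x"
  have de: "(?e has_derivative (\<lambda>h. (h \<bullet> \<xi>) *\<^sub>R (\<i> * ?e x))) (at x)" for x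
  proof -
    have "((\<lambda>x. \<i> * complex_of_real (x \<bullet> \<xi>)) has_derivative (\<lambda>h. \<i> * complex_of_real (h \<bullet> \<xi>))) (at x)"
      by (auto intro!: derivative_eq_intros)
    moreover have "(exp has_derivative (*) (exp (\<i> * complex_of_real (x \<bullet> \<xi>)))) (at (\<i> * complex_of_real (x \<bullet> \<xi>)))"
      using DERIV_exp by (simp add: has_field_derivative_def)
    ultimately have "((\<lambda>x. exp (\<i> * complex_of_real (x \<bullet> \<xi>))) has_derivative
        (\<lambda>h. exp (\<i> * complex_of_real (x \<bullet> \<xi>)) * (\<i> * complex_of_real (h \<bullet> \<xi>)))) (at x)"
      by (rule has_derivative_compose)
    then show ?thesis by (simp add: cis_conv_exp scaleR_conv_of_real mult_ac)
  qed
  have pe: "partial_deriv j ?e x = \<i> * complex_of_real (\<xi> $ j) * ?e x" for x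
    using partial_deriv_eqI[OF de, of j x] by (simp add: inner_axis scaleR_conv_of_real mult_ac inner_commute)
  have p\<psi>: "partial_deriv j ?\<psi> = (\<lambda>x. ?e x * partial_deriv j \<phi> x + \<i> * complex_of_real (\<xi> $ j) * (?e x * \<phi> x))"
    using partial_deriv_mult[of ?e _ \<phi> j] de schwartz_differentiable[OF assms]
    by (intro ext) (auto simp: pe differentiable_def mult_ac)
  obtain C1 where C1: "\<And>x. norm (\<phi> x) \<le> C1 / (1 + (norm x)\<^sup>2) ^ DIM(real^'n)"
    using schwartz_le_bracket[OF assms] by metis
  obtain C2 where C2: "\<And>x. norm (partial_deriv j \<phi> x) \<le> C2 / (1 + (norm x)\<^sup>2) ^ DIM(real^'n)"
    using schwartz_le_bracket[OF schwartz_partial_deriv[OF assms]] by metis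
  have bd: "norm (partial_deriv j ?\<psi> x) \<le> (C2 + \<bar>\<xi> $ j\<bar> * C1) / (1 + (norm x)\<^sup>2) ^ DIM(real^'n)" for x
  proof -
    have "norm (partial_deriv j ?\<psi> x) \<le> norm (partial_deriv j \<phi> x) + \<bar>\<xi> $ j\<bar> * norm (\<phi> x)"
      unfolding p\<psi> by (rule order_trans[OF norm_triangle_ineq]) (simp add: norm_mult)
    also have "\<dots> \<le> C2 / (1 + (norm x)\<^sup>2) ^ DIM(real^'n) + \<bar>\<xi> $ j\<bar> * (C1 / (1 + (norm x)\<^sup>2) ^ DIM(real^'n))"
      using C1[of x] C2[of x] by (intro add_mono mult_left_mono) auto
    finally show ?thesis by (simp add: add_divide_distrib)
  qed
  note [measurable] = schwartz_measurable[OF assms] schwartz_measurable[OF schwartz_partial_deriv[OF assms, of j]]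
  have i0: "integrable lborel ?\<psi>" by (rule integrable_cis_mult[OF schwartz_integrable[OF assms]]) measurable
  have i1: "integrable lborel (\<lambda>x. ?e x * partial_deriv j \<phi> x)"
    by (rule integrable_cis_mult[OF schwartz_integrable[OF schwartz_partial_deriv[OF assms]]]) measurable
  have "(LINT x|lborel. partial_deriv j ?\<psi> x) = 0"
  proof (rule integral_partial_deriv_eq_0[OF _ i0 bd])
    show "?\<psi> differentiable at x" for x
      using de schwartz_differentiable[OF assms] by (intro differentiable_mult) (auto simp: differentiable_def)
    show "partial_deriv j ?\<psi> \<in> borel_measurable borel" unfolding p\<psi> by measurable
  qed
  then have "fourier_integral (partial_deriv j \<phi>) \<xi> + \<i> * complex_of_real (\<xi> $ j) * fourier_integral \<phi> \<xi> = 0"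
    unfolding p\<psi> using Bochner_Integration.integral_add[OF i1 integrable_mult_right[OF i0]] by simp
  then show ?thesis by (simp add: eq_neg_iff_add_eq_0)
qed

lemma inv_fourier_conv: "inv_fourier \<phi> \<xi> = complex_of_real (1 / (2 * pi) ^ CARD('n)) * fourier_integral \<phi> \<xi>"
  for \<phi> :: "real ^ 'n::finite \<Rightarrow> complex"
  by (simp add: inv_fourier_def inner_commute)

lemma inv_fourier_partial_deriv:
  assumes "\<phi> \<in> schwartz"
  shows "inv_fourier (partial_deriv j \<phi>) \<xi> = - \<i> * complex_of_real (\<xi> $ j) * inv_fourier \<phi> \<xi>"
  unfolding inv_fourier_conv fourier_integral_partial_deriv[OF assms] by (simp only: mult_ac)

lemma inv_fourier_cmult: "inv_fourier (\<lambda>x. c * \<phi> x) \<xi> = c * inv_fourier \<phi> \<xi>"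
proof -
  have "(LINT x|lborel. cis (x \<bullet> \<xi>) * (c * \<phi> x)) = (LINT x|lborel. c * (cis (x \<bullet> \<xi>) * \<phi> x))"
    by (simp only: mult.left_commute)
  then show ?thesis by (simp add: inv_fourier_conv)
qed

lemma schwartz_integrable_cis: "\<phi> \<in> schwartz \<Longrightarrow> integrable lborel (\<lambda>x. cis (x \<bullet> \<xi>) * \<phi> x)"
  for \<phi> :: "real ^ 'n::finite \<Rightarrow> complex"
  by (rule integrable_cis_mult[OF schwartz_integrable]) measurable

lemma inv_fourier_add:
  assumes "\<phi> \<in> schwartz" "\<psi> \<in> schwartz"
  shows "inv_fourier (\<lambda>x. \<phi> x + \<psi> x) \<xi> = inv_fourier \<phi> \<xi> + inv_fourier \<psi> \<xi>"
  using Bochner_Integration.integral_add[OF assms[THEN schwartz_integrable_cis, of \<xi>]]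
  by (simp add: inv_fourier_conv distrib_left)

text \<open>
  The images of Schwartz functions form a family to which coinduction applies: derivatives
  and coordinates are exchanged by the transform.
\<close>

lemma inv_fourier_schwartz:
  fixes \<phi> :: "real ^ 'n::finite \<Rightarrow> complex"
  assumes "\<phi> \<in> schwartz" shows "inv_fourier \<phi> \<in> schwartz"
proof (rule schwartz_coinduct)
  let ?S = "inv_fourier ` (schwartz :: (real ^ 'n \<Rightarrow> complex) set)"
  let ?c = "complex_of_real (1 / (2 * pi) ^ CARD('n))"
  fix \<theta> :: "real ^ 'n \<Rightarrow> complex" and k assume "\<theta> \<in> ?S"
  then obtain \<phi> :: "real ^ 'n \<Rightarrow> complex" where \<theta>: "\<theta> = inv_fourier \<phi>" and \<phi>: "\<phi> \<in> schwartz" by auto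
  have \<theta>': "\<theta> = (\<lambda>\<xi>. ?c * fourier_integral \<phi> \<xi>)" by (rule ext) (simp only: \<theta> inv_fourier_conv)
  have D: "(fourier_integral \<phi> has_derivative
     (\<lambda>h. LINT x|lborel. \<i> * complex_of_real (x \<bullet> h) * (cis (x \<bullet> \<xi>) * \<phi> x))) (at \<xi>)" for \<xi>
    by (rule fourier_integral_schwartz_has_derivative[OF \<phi>])
  then have df: "fourier_integral \<phi> differentiable at \<xi>" for \<xi> using differentiable_def by blast
  show "\<theta> differentiable at \<xi>" for \<xi>
    unfolding \<theta>' by (intro differentiable_mult df differentiable_const)
  show "partial_deriv k \<theta> \<in> finite_sums ?S"
  proof (rule finite_sums.base)
    have "partial_deriv k \<theta> = inv_fourier (\<lambda>x. \<i> * (complex_of_real (x $ k) * \<phi> x))"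
      unfolding \<theta>' by (rule ext, subst partial_deriv_cmult[OF df], subst partial_deriv_eqI[OF D])
        (simp add: inv_fourier_conv inner_axis mult_ac)
    then show "partial_deriv k \<theta> \<in> ?S" using schwartz_cmult[OF schwartz_coord_mult[OF \<phi>]] by blast
  qed
  show "(\<lambda>x. complex_of_real (x $ k) * \<theta> x) \<in> finite_sums ?S"
  proof (rule finite_sums.base)
    have "(\<lambda>x. complex_of_real (x $ k) * \<theta> x) = inv_fourier (\<lambda>x. \<i> * partial_deriv k \<phi> x)"
      by (rule ext) (simp add: \<theta> inv_fourier_cmult inv_fourier_partial_deriv[OF \<phi>] mult.assoc)
    then show "(\<lambda>x. complex_of_real (x $ k) * \<theta> x) \<in> ?S"
      using schwartz_cmult[OF schwartz_partial_deriv[OF \<phi>]] by blast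
  qed
  have "norm (\<theta> \<xi>) \<le> norm ?c * (LINT x|lborel. norm (\<phi> x))" for \<xi>
    unfolding \<theta>' norm_mult
  proof (rule mult_left_mono)
    show "norm (fourier_integral \<phi> \<xi>) \<le> (LINT x|lborel. norm (\<phi> x))"
      by (rule norm_integral_le) (simp_all add: norm_mult schwartz_integrable[OF \<phi>])
  qed simp
  then show "bounded (range \<theta>)" unfolding bounded_iff by blast
qed (use assms in simp)

section \<open>Gaussian kernels, inversion and injectivity\<close>

text \<open>
  The characteristic function of the normal distribution, rescaled.
\<close>

lemma gaussian_fourier_real:
  fixes r \<eta> :: real
  assumes "r > 0"
  shows "integrable lborel (\<lambda>t. cis (t * \<eta>) * complex_of_real (exp (- t\<^sup>2 / r\<^sup>2)))"
    and "(LINT t|lborel. cis (t * \<eta>) * complex_of_real (exp (- t\<^sup>2 / r\<^sup>2)))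
       = complex_of_real (sqrt pi * r * exp (- r\<^sup>2 * \<eta>\<^sup>2 / 4))"
proof -
  let ?f = "\<lambda>u t. complex_of_real (std_normal_density t) * cis (t * u)"
  have i0: "integrable lborel (\<lambda>t. cis (t * u) * complex_of_real (std_normal_density t))" for u
    by (rule integrable_cis_mult) (auto intro!: integrable_of_real integrable_normal_density)
  have v0: "(LINT t|lborel. cis (t * u) * complex_of_real (std_normal_density t)) = complex_of_real (exp (- u\<^sup>2 / 2))" for u
  proof -
    have "complex_of_real (exp (- u\<^sup>2 / 2)) = char std_normal_distribution u" by (simp add: char_std_normal_distribution)
    also have "\<dots> = (LINT t|lborel. std_normal_density t *\<^sub>R iexp (u * t))"
      unfolding char_def by (subst integral_density) (auto intro!: borel_measurable_normal_density)
    finally show ?thesis by (simp add: cis_conv_exp scaleR_conv_of_real mult_ac)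
  qed
  define c where "c = sqrt 2 / r"
  have c: "c \<noteq> 0" using assms by (simp add: c_def)
  have eq: "cis ((0 + c * t) * (\<eta> / c)) * complex_of_real (std_normal_density (0 + c * t))
     = complex_of_real (1 / sqrt (2 * pi)) * (cis (t * \<eta>) * complex_of_real (exp (- t\<^sup>2 / r\<^sup>2)))" for t
    using c by (simp add: std_normal_density_def c_def power_mult_distrib power_divide mult_ac)
  have I: "integrable lborel (\<lambda>t. complex_of_real (1 / sqrt (2 * pi)) * (cis (t * \<eta>) * complex_of_real (exp (- t\<^sup>2 / r\<^sup>2))))"
    using lborel_integrable_real_affine[OF i0[of "\<eta> / c"] c, of 0] unfolding eq .
  show "integrable lborel (\<lambda>t. cis (t * \<eta>) * complex_of_real (exp (- t\<^sup>2 / r\<^sup>2)))"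
    using integrable_mult_right[OF I, of "complex_of_real (sqrt (2 * pi))"] by (simp flip: mult.assoc)
  have "complex_of_real (exp (- (\<eta> / c)\<^sup>2 / 2)) = \<bar>c\<bar> *\<^sub>R (LINT t|lborel. complex_of_real (1 / sqrt (2 * pi)) * (cis (t * \<eta>) * complex_of_real (exp (- t\<^sup>2 / r\<^sup>2))))"
    unfolding v0[symmetric] by (subst lborel_integral_real_affine[OF c, of _ 0]) (simp only: eq)
  also have "\<dots> = complex_of_real (\<bar>c\<bar> / sqrt (2 * pi)) * (LINT t|lborel. cis (t * \<eta>) * complex_of_real (exp (- t\<^sup>2 / r\<^sup>2)))"
    by (simp add: scaleR_conv_of_real)
  finally have "(LINT t|lborel. cis (t * \<eta>) * complex_of_real (exp (- t\<^sup>2 / r\<^sup>2)))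
    = complex_of_real (sqrt (2 * pi) / \<bar>c\<bar> * exp (- (\<eta> / c)\<^sup>2 / 2))"
    using c by (simp add: field_simps)
  moreover have "sqrt (2 * pi) / \<bar>c\<bar> = sqrt pi * r" using assms by (simp add: c_def real_sqrt_mult)
  moreover have "- (\<eta> / c)\<^sup>2 / 2 = - r\<^sup>2 * \<eta>\<^sup>2 / 4" using assms by (simp add: c_def power_divide field_simps)
  ultimately show "(LINT t|lborel. cis (t * \<eta>) * complex_of_real (exp (- t\<^sup>2 / r\<^sup>2)))
       = complex_of_real (sqrt pi * r * exp (- r\<^sup>2 * \<eta>\<^sup>2 / 4))" by simp
qed

lemma gaussian_fourier:
  fixes \<xi> :: "'a::euclidean_space"
  assumes "r > 0"
  shows "integrable lborel (\<lambda>x::'a. cis (x \<bullet> \<xi>) * complex_of_real (exp (- (norm x)\<^sup>2 / r\<^sup>2)))" (is ?I)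
    and "fourier_integral (\<lambda>x::'a. complex_of_real (exp (- (norm x)\<^sup>2 / r\<^sup>2))) \<xi>
       = complex_of_real ((sqrt pi * r) ^ DIM('a) * exp (- r\<^sup>2 * (norm \<xi>)\<^sup>2 / 4))" (is ?V)
proof -
  have cis_sum: "cis (\<Sum>i\<in>A. f i) = (\<Prod>i\<in>A. cis (f i))" if "finite A" for A :: "'a set" and f
    using that by (induction A rule: finite_induct) (auto simp flip: cis_mult)
  have nrm: "(norm x)\<^sup>2 = (\<Sum>b\<in>Basis. (x \<bullet> b)\<^sup>2)" for x :: 'a
    by (subst power2_norm_eq_inner, subst euclidean_inner) (simp add: power2_eq_square)
  have eq: "cis (x \<bullet> \<xi>) * complex_of_real (exp (- (norm x)\<^sup>2 / r\<^sup>2))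
    = (\<Prod>b\<in>Basis. cis ((x \<bullet> b) * (\<xi> \<bullet> b)) * complex_of_real (exp (- (x \<bullet> b)\<^sup>2 / r\<^sup>2)))" for x :: 'a
  proof -
    have "exp (- (norm x)\<^sup>2 / r\<^sup>2) = (\<Prod>b\<in>Basis. exp (- (x \<bullet> b)\<^sup>2 / r\<^sup>2))"
      by (simp add: nrm exp_sum[symmetric] sum_negf sum_divide_distrib)
    then show ?thesis by (simp add: prod.distrib cis_sum[symmetric] flip: euclidean_inner)
  qed
  show ?I unfolding eq by (rule lborel_integrable_prod_Basis) (rule gaussian_fourier_real(1)[OF assms])
  have "fourier_integral (\<lambda>x::'a. complex_of_real (exp (- (norm x)\<^sup>2 / r\<^sup>2))) \<xi>
    = (\<Prod>b\<in>Basis. complex_of_real (sqrt pi * r * exp (- r\<^sup>2 * (\<xi> \<bullet> b)\<^sup>2 / 4)))"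
    unfolding eq using lborel_integral_prod_Basis[of "\<lambda>b t. cis (t * (\<xi> \<bullet> b)) * complex_of_real (exp (- t\<^sup>2 / r\<^sup>2))"]
      gaussian_fourier_real[OF assms] by simp
  also have "\<dots> = complex_of_real ((sqrt pi * r) ^ DIM('a) * (\<Prod>b\<in>Basis. exp (- r\<^sup>2 * (\<xi> \<bullet> b)\<^sup>2 / 4)))"
    by (simp add: prod.distrib power_mult_distrib)
  also have "(\<Prod>b\<in>Basis. exp (- r\<^sup>2 * (\<xi> \<bullet> b)\<^sup>2 / 4)) = exp (- r\<^sup>2 * (norm \<xi>)\<^sup>2 / 4)"
    by (simp add: nrm exp_sum[symmetric] sum_negf sum_distrib_left sum_divide_distrib)
  finally show ?V .
qed

text \<open>
  The heat kernel at time \<open>r\<^sup>2/4\<close>; the width \<open>r\<close> as parameter avoids square roots of the time.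
\<close>

definition gauss_kernel :: "real \<Rightarrow> 'a::euclidean_space \<Rightarrow> real" where
  "gauss_kernel r x = exp (- (norm x)\<^sup>2 / r\<^sup>2) / (sqrt pi * r) ^ DIM('a)"

lemma gauss_kernel_nonneg: "r > 0 \<Longrightarrow> gauss_kernel r x \<ge> 0"
  by (simp add: gauss_kernel_def)

lemma gauss_kernel_minus: "gauss_kernel r (x - y) = gauss_kernel r (y - x)"
  by (simp add: gauss_kernel_def norm_minus_commute)

lemma gauss_kernel_measurable [measurable]: "gauss_kernel r \<in> borel_measurable borel"
  unfolding gauss_kernel_def by measurable

lemma fourier_integral_gauss_kernel:
  fixes \<xi> :: "'a::euclidean_space"
  assumes "r > 0"
  shows "integrable lborel (\<lambda>x::'a. cis (x \<bullet> \<xi>) * complex_of_real (gauss_kernel r x))" (is ?I)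
    and "fourier_integral (\<lambda>x::'a. complex_of_real (gauss_kernel r x)) \<xi>
       = complex_of_real (exp (- r\<^sup>2 * (norm \<xi>)\<^sup>2 / 4))" (is ?V)
proof -
  let ?k = "complex_of_real ((sqrt pi * r) ^ DIM('a))"
  have k: "?k \<noteq> 0" using assms by simp
  have eq: "cis (x \<bullet> \<xi>) * complex_of_real (gauss_kernel r x) = (cis (x \<bullet> \<xi>) * complex_of_real (exp (- (norm x)\<^sup>2 / r\<^sup>2))) / ?k" for x :: 'a
    by (simp add: gauss_kernel_def)
  show ?I unfolding eq using gaussian_fourier(1)[OF assms] by (rule integrable_divide)
  show ?V unfolding eq integral_divide_zero gaussian_fourier(2)[OF assms] using k by simp
qed

lemma gauss_kernel_integrable: "r > 0 \<Longrightarrow> integrable lborel (gauss_kernel r :: 'a::euclidean_space \<Rightarrow> real)"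
  using fourier_integral_gauss_kernel(1)[of r "0::'a"] by (simp add: complex_of_real_integrable_eq)

lemma gauss_kernel_integral: "r > 0 \<Longrightarrow> (LINT x|lborel. gauss_kernel r (x::'a::euclidean_space)) = 1"
  using fourier_integral_gauss_kernel(2)[of r "0::'a"] by simp

lemma fourier_integral_gaussian:
  fixes y :: "'a::euclidean_space"
  assumes "r > 0"
  shows "integrable lborel (\<lambda>\<xi>::'a. cis (\<xi> \<bullet> y) * complex_of_real (exp (- r\<^sup>2 * (norm \<xi>)\<^sup>2 / 4)))" (is ?I)
    and "fourier_integral (\<lambda>\<xi>::'a. complex_of_real (exp (- r\<^sup>2 * (norm \<xi>)\<^sup>2 / 4))) y
       = complex_of_real ((2 * pi) ^ DIM('a) * gauss_kernel r y)" (is ?V)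
proof -
  have r: "2 / r > 0" using assms by simp
  have eq: "- r\<^sup>2 * (norm \<xi>)\<^sup>2 / 4 = - (norm \<xi>)\<^sup>2 / (2 / r)\<^sup>2" for \<xi> :: 'a
    using assms by (simp add: field_simps)
  show ?I unfolding eq by (rule gaussian_fourier(1)[OF r])
  have "(sqrt pi * (2 / r)) = 2 * pi / (sqrt pi * r)"
    using assms by (simp add: field_simps)
  then have "(sqrt pi * (2 / r)) ^ DIM('a) = (2 * pi) ^ DIM('a) / (sqrt pi * r) ^ DIM('a)"
    by (simp only: power_divide)
  moreover have "- (2 / r)\<^sup>2 * (norm y)\<^sup>2 / 4 = - (norm y)\<^sup>2 / r\<^sup>2" using assms by (simp add: field_simps)
  ultimately show ?V unfolding eq gaussian_fourier(2)[OF r] gauss_kernel_def by simp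
qed

lemma gauss_kernel_scale:
  fixes f :: "'a::euclidean_space \<Rightarrow> complex"
  assumes "r > 0" and [measurable]: "f \<in> borel_measurable borel"
  shows "(LINT y|lborel. f y * complex_of_real (gauss_kernel r (y - x)))
    = (LINT z|lborel. f (x + r *\<^sub>R z) * complex_of_real (gauss_kernel 1 z))"
proof -
  let ?g = "\<lambda>y. f y * complex_of_real (gauss_kernel r (y - x))"
  have eq: "\<bar>r\<bar> ^ DIM('a) *\<^sub>R ?g (x + r *\<^sub>R z) = f (x + r *\<^sub>R z) * complex_of_real (gauss_kernel 1 z)" for z :: 'a
    using assms(1) by (simp add: gauss_kernel_def power_mult_distrib scaleR_conv_of_real)
  have "(LINT y|lborel. ?g y) = (LINT y|density (distr lborel borel (\<lambda>z. x + r *\<^sub>R z)) (\<lambda>_. ennreal (\<bar>r\<bar> ^ DIM('a))). ?g y)"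
    using lborel_affine[of r x] assms(1) by simp
  also have "\<dots> = (LINT z|lborel. \<bar>r\<bar> ^ DIM('a) *\<^sub>R ?g (x + r *\<^sub>R z))"
    by (subst integral_density) (auto simp: integral_distr)
  finally show ?thesis unfolding eq .
qed

lemma gauss_kernel_approximate_identity:
  fixes f :: "'a::euclidean_space \<Rightarrow> complex"
  assumes "continuous_on UNIV f" and bd: "\<And>x. norm (f x) \<le> C"
  shows "(\<lambda>m. LINT y|lborel. f y * complex_of_real (gauss_kernel (1 / real (Suc m)) (y - x))) \<longlonglongrightarrow> f x"
proof -
  have [measurable]: "f \<in> borel_measurable borel" using assms(1) by (rule borel_measurable_continuous_onI)
  let ?h = "\<lambda>m. 1 / real (Suc m)"
  have "(\<lambda>m. LINT z|lborel. f (x + ?h m *\<^sub>R z) * complex_of_real (gauss_kernel 1 z))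
    \<longlonglongrightarrow> (LINT z|lborel. f x * complex_of_real (gauss_kernel 1 (z::'a)))"
  proof (rule integral_dominated_convergence)
    show "integrable lborel (\<lambda>z::'a. C * gauss_kernel 1 z)"
      by (intro integrable_mult_right gauss_kernel_integrable) simp
    show "AE z in lborel. norm (f (x + ?h m *\<^sub>R z) * complex_of_real (gauss_kernel 1 z)) \<le> C * gauss_kernel 1 z" for m
      using bd by (intro AE_I2) (simp add: norm_mult mult_right_mono gauss_kernel_nonneg)
    show "AE z in lborel. (\<lambda>m. f (x + ?h m *\<^sub>R z) * complex_of_real (gauss_kernel 1 z)) \<longlonglongrightarrow> f x * complex_of_real (gauss_kernel 1 z)"
    proof (rule AE_I2)
      fix z :: 'a
      have "(\<lambda>m. x + ?h m *\<^sub>R z) \<longlonglongrightarrow> x + 0 *\<^sub>R z"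
        using LIMSEQ_inverse_real_of_nat by (intro tendsto_intros) (simp add: inverse_eq_divide)
      then have "(\<lambda>m. x + ?h m *\<^sub>R z) \<longlonglongrightarrow> x" by simp
      moreover have "isCont f x" using assms(1) by (simp add: continuous_on_eq_continuous_at)
      ultimately have "(\<lambda>m. f (x + ?h m *\<^sub>R z)) \<longlonglongrightarrow> f x" by (rule isCont_tendsto_compose[rotated])
      then show "(\<lambda>m. f (x + ?h m *\<^sub>R z) * complex_of_real (gauss_kernel 1 z)) \<longlonglongrightarrow> f x * complex_of_real (gauss_kernel 1 z)"
        by (rule tendsto_mult_right)
    qed
  qed measurable
  moreover have "(LINT z|lborel. f x * complex_of_real (gauss_kernel 1 (z::'a))) = f x"
    by (simp add: gauss_kernel_integral)
  moreover have "(LINT y|lborel. f y * complex_of_real (gauss_kernel (?h m) (y - x)))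
     = (LINT z|lborel. f (x + ?h m *\<^sub>R z) * complex_of_real (gauss_kernel 1 z))" for m
    by (rule gauss_kernel_scale) (simp, measurable)
  ultimately show ?thesis by (simp only:)
qed

text \<open>
  Inserting the factor \<open>exp (- r\<^sup>2 |\<xi>|\<^sup>2 / 4)\<close> makes the double integral absolutely convergent. Exchanging the
  integrals produces the convolution of \<open>\<phi>\<close> with a Gaussian kernel of width \<open>r\<close>,
  and \<open>r\<close> tends to \<open>0\<close>.
\<close>

lemma fourier_inv_fourier:
  fixes \<phi> :: "real ^ 'n::finite \<Rightarrow> complex"
  assumes "\<phi> \<in> schwartz"
  shows "fourier (inv_fourier \<phi>) = \<phi>"
proof
  fix x :: "real ^ 'n"
  let ?c = "complex_of_real (1 / (2 * pi) ^ CARD('n))"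
  let ?\<psi> = "inv_fourier \<phi>"
  let ?h = "\<lambda>m. 1 / real (Suc m)"
  define g where "g m \<xi> = exp (- (?h m)\<^sup>2 * (norm (\<xi>::real^'n))\<^sup>2 / 4)" for m \<xi>
  have gi: "integrable lborel (g m)" for m
    using fourier_integral_gaussian(1)[of "?h m" "0::real^'n"] by (simp add: g_def[abs_def] complex_of_real_integrable_eq)
  have [measurable]: "g m \<in> borel_measurable borel" for m
    using borel_measurable_integrable[OF gi] by simp
  have g01: "0 \<le> g m \<xi>" "g m \<xi> \<le> 1" for m \<xi> by (auto simp: g_def)
  note \<psi> = inv_fourier_schwartz[OF assms]
  note [measurable] = schwartz_measurable[OF assms] schwartz_measurable[OF \<psi>]
  have eq: "(LINT \<xi>|lborel. cis (- (\<xi> \<bullet> x)) * ?\<psi> \<xi> * complex_of_real (g m \<xi>))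
    = (LINT y|lborel. \<phi> y * complex_of_real (gauss_kernel (?h m) (y - x)))" for m
  proof -
    have 1: "(LINT y|lborel. ?c * (cis ((y - x) \<bullet> \<xi>) * \<phi> y * complex_of_real (g m \<xi>)))
      = cis (- (\<xi> \<bullet> x)) * ?\<psi> \<xi> * complex_of_real (g m \<xi>)" for \<xi>
    proof -
      have "(y - x) \<bullet> \<xi> = - (\<xi> \<bullet> x) + y \<bullet> \<xi>" for y
        by (simp add: inner_diff_left inner_commute[of x])
      then have "?c * (cis ((y - x) \<bullet> \<xi>) * \<phi> y * complex_of_real (g m \<xi>))
        = (?c * cis (- (\<xi> \<bullet> x)) * complex_of_real (g m \<xi>)) * (cis (y \<bullet> \<xi>) * \<phi> y)" for y
        by (simp only: cis_mult[symmetric] mult_ac)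
      then have "(LINT y|lborel. ?c * (cis ((y - x) \<bullet> \<xi>) * \<phi> y * complex_of_real (g m \<xi>)))
        = (?c * cis (- (\<xi> \<bullet> x)) * complex_of_real (g m \<xi>)) * fourier_integral \<phi> \<xi>"
        by (simp only: integral_mult_right_zero)
      then show ?thesis by (simp only: inv_fourier_conv mult_ac)
    qed
    have 2: "(LINT \<xi>|lborel. ?c * (cis ((y - x) \<bullet> \<xi>) * \<phi> y * complex_of_real (g m \<xi>)))
      = \<phi> y * complex_of_real (gauss_kernel (?h m) (y - x))" for y
    proof -
      have "?c * (cis ((y - x) \<bullet> \<xi>) * \<phi> y * complex_of_real (g m \<xi>))
        = (?c * \<phi> y) * (cis (\<xi> \<bullet> (y - x)) * complex_of_real (g m \<xi>))" for \<xi>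
        by (simp only: mult_ac inner_commute)
      then have "(LINT \<xi>|lborel. ?c * (cis ((y - x) \<bullet> \<xi>) * \<phi> y * complex_of_real (g m \<xi>)))
        = (?c * \<phi> y) * fourier_integral (\<lambda>\<xi>. complex_of_real (g m \<xi>)) (y - x)"
        by (simp only: integral_mult_right_zero)
      also have "fourier_integral (\<lambda>\<xi>. complex_of_real (g m \<xi>)) (y - x)
        = complex_of_real ((2 * pi) ^ DIM(real^'n) * gauss_kernel (?h m) (y - x))"
        unfolding g_def by (rule fourier_integral_gaussian(2)) simp
      finally show ?thesis by simp
    qed
    have "(LINT \<xi>|lborel. LINT y|lborel. ?c * (cis ((y - x) \<bullet> \<xi>) * \<phi> y * complex_of_real (g m \<xi>)))
      = (LINT y|lborel. LINT \<xi>|lborel. ?c * (cis ((y - x) \<bullet> \<xi>) * \<phi> y * complex_of_real (g m \<xi>)))"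
    proof (rule Fubini_le_prod[where A="g m" and B="\<lambda>y. norm ?c * norm (\<phi> y)"])
      show "integrable lborel (\<lambda>y. norm ?c * norm (\<phi> y))"
        by (rule integrable_mult_right, rule integrable_norm, rule schwartz_integrable[OF assms])
      show "norm (?c * (cis ((y - x) \<bullet> \<xi>) * \<phi> y * complex_of_real (g m \<xi>))) \<le> g m \<xi> * (norm ?c * norm (\<phi> y))" for \<xi> y
        by (simp only: norm_mult norm_cis norm_of_real abs_of_nonneg g01 mult_ac mult_1_left mult_1_right order_refl)
      show "integrable lborel (g m)" by (rule gi)
    qed measurable
    then show ?thesis unfolding 1 2 .
  qed
  obtain C where C: "\<And>x. norm (\<phi> x) \<le> C" using schwartz_bounded[OF assms] unfolding bounded_iff by blast
  have "(\<lambda>m. LINT \<xi>|lborel. cis (- (\<xi> \<bullet> x)) * ?\<psi> \<xi> * complex_of_real (g m \<xi>)) \<longlonglongrightarrow> \<phi> x"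
    unfolding eq by (rule gauss_kernel_approximate_identity[OF schwartz_continuous[OF assms] C])
  moreover have "(\<lambda>m. LINT \<xi>|lborel. cis (- (\<xi> \<bullet> x)) * ?\<psi> \<xi> * complex_of_real (g m \<xi>)) \<longlonglongrightarrow> (LINT \<xi>|lborel. cis (- (\<xi> \<bullet> x)) * ?\<psi> \<xi>)"
  proof (rule integral_dominated_convergence[where w="\<lambda>\<xi>. norm (?\<psi> \<xi>)"])
    show "integrable lborel (\<lambda>\<xi>. norm (?\<psi> \<xi>))" by (rule integrable_norm[OF schwartz_integrable[OF \<psi>]])
    show "AE \<xi> in lborel. (\<lambda>m. cis (- (\<xi> \<bullet> x)) * ?\<psi> \<xi> * complex_of_real (g m \<xi>)) \<longlonglongrightarrow> cis (- (\<xi> \<bullet> x)) * ?\<psi> \<xi>"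
    proof (rule AE_I2)
      fix \<xi> :: "real ^ 'n"
      have "?h \<longlonglongrightarrow> 0" using LIMSEQ_inverse_real_of_nat by (simp add: inverse_eq_divide)
      then have "(\<lambda>m. cis (- (\<xi> \<bullet> x)) * ?\<psi> \<xi> * complex_of_real (g m \<xi>)) \<longlonglongrightarrow> cis (- (\<xi> \<bullet> x)) * ?\<psi> \<xi> * complex_of_real (exp (- 0\<^sup>2 * (norm \<xi>)\<^sup>2 / 4))"
        unfolding g_def by (intro tendsto_intros) auto
      then show "(\<lambda>m. cis (- (\<xi> \<bullet> x)) * ?\<psi> \<xi> * complex_of_real (g m \<xi>)) \<longlonglongrightarrow> cis (- (\<xi> \<bullet> x)) * ?\<psi> \<xi>" by simp
    qed
    show "AE \<xi> in lborel. norm (cis (- (\<xi> \<bullet> x)) * ?\<psi> \<xi> * complex_of_real (g m \<xi>)) \<le> norm (?\<psi> \<xi>)" for m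
      by (rule AE_I2) (simp add: norm_mult mult_left_le g01)
  qed measurable
  ultimately have "(LINT \<xi>|lborel. cis (- (\<xi> \<bullet> x)) * ?\<psi> \<xi>) = \<phi> x" by (rule LIMSEQ_unique[rotated])
  then show "fourier (inv_fourier \<phi>) x = \<phi> x" by (simp add: fourier_def)
qed

text \<open>
  Indicators of open boxes are pointwise limits of continuous functions, and boxes generate the
  Borel sets.
\<close>

lemma AE_eq_0_if_continuous_integrals_eq_0:
  fixes F :: "'a::euclidean_space \<Rightarrow> complex"
  assumes F: "integrable lborel F" "(LINT x|lborel. F x) = 0"
    and 0: "\<And>f :: 'a \<Rightarrow> real. continuous_on UNIV f \<Longrightarrow> integrable lborel f \<Longrightarrow> (\<And>x. \<bar>f x\<bar> \<le> 1) \<Longrightarrow>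
       (LINT x|lborel. F x * complex_of_real (f x)) = 0"
  shows "AE x in lborel. F x = 0"
proof (rule sigma_finite_measure.density_zero[OF sigma_finite_lborel F(1)])
  have [measurable]: "F \<in> borel_measurable borel" using borel_measurable_integrable[OF F(1)] by simp
  have box: "(LINT x:box a b|lborel. F x) = 0" for a b :: 'a
  proof -
    let ?C = "- box a b"
    have "?C \<noteq> {}" using bounded_box[of a b] by (metis Compl_empty_eq boolean_algebra_class.boolean_algebra.double_compl not_bounded_UNIV)
    have C: "closed ?C" by (simp add: open_box closed_Compl)
    define f where "f m x = min 1 (real m * infdist x ?C)" for m x
    have out: "f m x = 0" if "x \<notin> box a b" for m x using that by (simp add: f_def)
    have f01: "0 \<le> f m x" "f m x \<le> 1" for m x by (auto simp: f_def infdist_nonneg)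
    have cont: "continuous_on UNIV (f m)" for m unfolding f_def by (intro continuous_intros)
    then have [measurable]: "f m \<in> borel_measurable borel" for m by (rule borel_measurable_continuous_onI)
    have ind: "integrable lborel (indicator (box a b) :: 'a \<Rightarrow> real)"
      by (rule integrable_real_indicator) (use emeasure_bounded_finite[OF bounded_box] in auto)
    have "integrable lborel (f m)" for m
    proof (rule Bochner_Integration.integrable_bound[OF ind])
      show "AE x in lborel. norm (f m x) \<le> norm (indicator (box a b) x :: real)"
        using out f01 by (intro AE_I2) (auto simp: indicator_def)
    qed measurable
    then have z: "(LINT x|lborel. F x * complex_of_real (f m x)) = 0" for m
      using 0[OF cont] f01 by (simp add: abs_of_nonneg)
    have "(\<lambda>m. LINT x|lborel. F x * complex_of_real (f m x)) \<longlonglongrightarrow> (LINT x|lborel. indicator (box a b) x *\<^sub>R F x)"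
    proof (rule integral_dominated_convergence[where w="\<lambda>x. norm (F x)"])
      show "integrable lborel (\<lambda>x. norm (F x))" by (rule integrable_norm[OF F(1)])
      show "AE x in lborel. norm (F x * complex_of_real (f m x)) \<le> norm (F x)" for m
        using f01 by (intro AE_I2) (simp add: norm_mult mult_left_le abs_of_nonneg)
      show "AE x in lborel. (\<lambda>m. F x * complex_of_real (f m x)) \<longlonglongrightarrow> indicator (box a b) x *\<^sub>R F x"
      proof (rule AE_I2)
        fix x
        show "(\<lambda>m. F x * complex_of_real (f m x)) \<longlonglongrightarrow> indicator (box a b) x *\<^sub>R F x"
        proof (cases "x \<in> box a b")
          case True
          then have pos: "infdist x ?C > 0"
            using C \<open>?C \<noteq> {}\<close> by (metis ComplD in_closed_iff_infdist_zero infdist_nonneg order_le_less)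
          obtain N :: nat where N: "1 / infdist x ?C < real N" using reals_Archimedean2 by blast
          have "eventually (\<lambda>m. F x * complex_of_real (f m x) = F x) sequentially"
            using eventually_ge_at_top[of N]
          proof eventually_elim
            case (elim m)
            have "1 < real N * infdist x ?C" using N pos by (simp add: pos_divide_less_eq)
            also have "\<dots> \<le> real m * infdist x ?C" using elim pos by (intro mult_right_mono) auto
            finally show ?case by (simp add: f_def)
          qed
          then show ?thesis using True by (simp add: tendsto_eventually)
        qed (simp add: out)
      qed
    qed measurable
    then show ?thesis unfolding z set_lebesgue_integral_def by (simp add: LIMSEQ_const_iff)
  qed
  have F': "set_integrable lborel A F" if "A \<in> sets borel" for A
    unfolding set_integrable_def using that F(1) by (intro integrable_mult_indicator) auto
  fix A :: "'a set" assume "A \<in> sets lborel"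
  then have "Int_stable (range (\<lambda>(a, b). box a b :: 'a set))" "range (\<lambda>(a, b). box a b :: 'a set) \<subseteq> Pow UNIV"
    "A \<in> sigma_sets UNIV (range (\<lambda>(a, b). box a b))"
    by (auto simp: borel_eq_box Int_stable_def box_Int_box)
  then show "(LINT x:A|lborel. F x) = 0"
  proof (induction rule: sigma_sets_induct_disjoint)
    case (compl A)
    then have [measurable]: "A \<in> sets borel" by (simp add: borel_eq_box)
    have "indicator (UNIV - A) x *\<^sub>R F x = F x - indicator A x *\<^sub>R F x" for x
      by (simp add: indicator_def)
    then have "(LINT x:UNIV - A|lborel. F x) = (LINT x|lborel. F x) - (LINT x:A|lborel. F x)"
      using Bochner_Integration.integral_diff[OF F(1) F'[of A, unfolded set_integrable_def]]
      by (simp add: set_lebesgue_integral_def)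
    then show ?case using compl F(2) by simp
  next
    case (union A)
    have A: "A i \<in> sets borel" for i using union.hyps(2) by (auto simp: borel_eq_box)
    have "(LINT x:(\<Union>i. A i)|lborel. F x) = suminf (\<lambda>i. LINT x:(A i)|lborel. F x)"
    proof (rule lebesgue_integral_countable_add)
      show "A i \<inter> A j = {}" if "i \<noteq> j" for i j using union.hyps(1) that by (auto simp: disjoint_family_on_def)
      show "set_integrable lborel (\<Union>i. A i) F" using A by (intro F') auto
    qed (use A in auto)
    then show ?case using union.IH by simp
  qed (use box in \<open>auto simp: set_lebesgue_integral_def\<close>)
qed

text \<open>
  If the transform vanishes, so do all convolutions of \<open>F\<close> with Gaussian kernels; these test \<open>F\<close>
  against every continuous integrable function in the limit.
\<close>

lemma fourier_integral_injective:
  fixes F :: "'a::euclidean_space \<Rightarrow> complex"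
  assumes F: "integrable lborel F" and 0: "\<And>x. fourier_integral F x = 0"
  shows "AE \<xi> in lborel. F \<xi> = 0"
proof (rule AE_eq_0_if_continuous_integrals_eq_0[OF F])
  have [measurable]: "F \<in> borel_measurable borel" using borel_measurable_integrable[OF F] by simp
  show "(LINT x|lborel. F x) = 0" using 0[of 0] by simp
  fix f :: "'a \<Rightarrow> real" assume cf: "continuous_on UNIV f" and fi: "integrable lborel f" and f1: "\<And>x. \<bar>f x\<bar> \<le> 1"
  have [measurable]: "f \<in> borel_measurable borel" using borel_measurable_integrable[OF fi] by simp
  let ?h = "\<lambda>m. 1 / real (Suc m)"
  let ?G = "\<lambda>m y. complex_of_real (gauss_kernel (?h m) (y::'a))"
  have conv0: "(LINT \<xi>|lborel. F \<xi> * ?G m (\<xi> - \<eta>)) = 0" for m \<eta>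
  proof -
    define g where "g x = exp (- (?h m)\<^sup>2 * (norm (x::'a))\<^sup>2 / 4)" for x
    let ?c = "complex_of_real ((2 * pi) ^ DIM('a))"
    have gi: "integrable lborel g"
      using fourier_integral_gaussian(1)[of "?h m" "0::'a"] by (simp add: g_def[abs_def] complex_of_real_integrable_eq)
    have [measurable]: "g \<in> borel_measurable borel" using borel_measurable_integrable[OF gi] by simp
    have g0: "0 \<le> g x" for x by (simp add: g_def)
    have 1: "(LINT x|lborel. F \<xi> * (cis (x \<bullet> (\<xi> - \<eta>)) * complex_of_real (g x))) = ?c * (F \<xi> * ?G m (\<xi> - \<eta>))" for \<xi>
    proof -
      have "fourier_integral (\<lambda>x. complex_of_real (g x)) (\<xi> - \<eta>) = complex_of_real ((2 * pi) ^ DIM('a) * gauss_kernel (?h m) (\<xi> - \<eta>))"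
        unfolding g_def by (rule fourier_integral_gaussian(2)) simp
      then show ?thesis by (simp only: integral_mult_right_zero of_real_mult mult.left_commute)
    qed
    have 2: "(LINT \<xi>|lborel. F \<xi> * (cis (x \<bullet> (\<xi> - \<eta>)) * complex_of_real (g x))) = 0" for x
    proof -
      have "x \<bullet> (\<xi> - \<eta>) = \<xi> \<bullet> x + - (x \<bullet> \<eta>)" for \<xi>
        by (simp add: inner_diff_right inner_commute[of x \<xi>])
      then have "F \<xi> * (cis (x \<bullet> (\<xi> - \<eta>)) * complex_of_real (g x)) = (cis (- (x \<bullet> \<eta>)) * complex_of_real (g x)) * (cis (\<xi> \<bullet> x) * F \<xi>)" for \<xi>
        by (simp only: cis_mult[symmetric] mult_ac)
      then show ?thesis by (simp only: integral_mult_right_zero 0 mult_zero_right)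
    qed
    have "(LINT \<xi>|lborel. LINT x|lborel. F \<xi> * (cis (x \<bullet> (\<xi> - \<eta>)) * complex_of_real (g x)))
      = (LINT x|lborel. LINT \<xi>|lborel. F \<xi> * (cis (x \<bullet> (\<xi> - \<eta>)) * complex_of_real (g x)))"
    proof (rule Fubini_le_prod[where A="\<lambda>\<xi>. norm (F \<xi>)" and B=g])
      show "integrable lborel (\<lambda>\<xi>. norm (F \<xi>))" by (rule integrable_norm[OF F])
      show "norm (F \<xi> * (cis (x \<bullet> (\<xi> - \<eta>)) * complex_of_real (g x))) \<le> norm (F \<xi>) * g x" for \<xi> x
        by (simp only: norm_mult norm_cis norm_of_real abs_of_nonneg g0 mult_1_left order_refl)
      show "integrable lborel g" by (rule gi)
    qed measurable
    then show ?thesis unfolding 1 2 by (simp add: integral_mult_right_zero)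
  qed
  have z: "(LINT \<xi>|lborel. F \<xi> * (LINT \<eta>|lborel. complex_of_real (f \<eta>) * ?G m (\<eta> - \<xi>))) = 0" for m
  proof -
    have h: "?h m > 0" by simp
    have 1: "(LINT \<xi>|lborel. F \<xi> * (complex_of_real (f \<eta>) * ?G m (\<eta> - \<xi>))) = 0" for \<eta>
    proof -
      have "F \<xi> * (complex_of_real (f \<eta>) * ?G m (\<eta> - \<xi>)) = complex_of_real (f \<eta>) * (F \<xi> * ?G m (\<xi> - \<eta>))" for \<xi>
        unfolding gauss_kernel_minus[of _ \<eta>] by (simp only: mult_ac)
      then show ?thesis by (simp only: integral_mult_right_zero conv0 mult_zero_right)
    qed
    have "(LINT \<xi>|lborel. LINT \<eta>|lborel. F \<xi> * (complex_of_real (f \<eta>) * ?G m (\<eta> - \<xi>)))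
      = (LINT \<eta>|lborel. LINT \<xi>|lborel. F \<xi> * (complex_of_real (f \<eta>) * ?G m (\<eta> - \<xi>)))"
    proof (rule Fubini_le_prod[where A="\<lambda>\<xi>. norm (F \<xi>)" and B="\<lambda>\<eta>. \<bar>f \<eta>\<bar> * (1 / (sqrt pi * ?h m) ^ DIM('a))"])
      show "integrable lborel (\<lambda>\<xi>. norm (F \<xi>))" by (rule integrable_norm[OF F])
      show "integrable lborel (\<lambda>\<eta>. \<bar>f \<eta>\<bar> * (1 / (sqrt pi * ?h m) ^ DIM('a)))"
        by (rule integrable_mult_left, rule integrable_abs[OF fi])
      show "norm (F \<xi> * (complex_of_real (f \<eta>) * ?G m (\<eta> - \<xi>))) \<le> norm (F \<xi>) * (\<bar>f \<eta>\<bar> * (1 / (sqrt pi * ?h m) ^ DIM('a)))" for \<xi> \<eta>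
      proof -
        have "gauss_kernel (?h m) (\<eta> - \<xi>) \<le> 1 / (sqrt pi * ?h m) ^ DIM('a)"
          unfolding gauss_kernel_def by (intro divide_right_mono) auto
        then show ?thesis unfolding norm_mult norm_of_real abs_of_nonneg[OF gauss_kernel_nonneg[OF h]]
          by (intro mult_left_mono) auto
      qed
    qed measurable
    then show ?thesis unfolding 1 by (simp add: integral_mult_right_zero)
  qed
  have "(\<lambda>m. LINT \<xi>|lborel. F \<xi> * (LINT \<eta>|lborel. complex_of_real (f \<eta>) * ?G m (\<eta> - \<xi>))) \<longlonglongrightarrow> (LINT \<xi>|lborel. F \<xi> * complex_of_real (f \<xi>))"
  proof (rule integral_dominated_convergence[where w="\<lambda>\<xi>. norm (F \<xi>)"])
    show "integrable lborel (\<lambda>\<xi>. norm (F \<xi>))" by (rule integrable_norm[OF F])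
    show "AE \<xi> in lborel. (\<lambda>m. F \<xi> * (LINT \<eta>|lborel. complex_of_real (f \<eta>) * ?G m (\<eta> - \<xi>))) \<longlonglongrightarrow> F \<xi> * complex_of_real (f \<xi>)"
      using cf f1 by (intro AE_I2 tendsto_mult_left gauss_kernel_approximate_identity[where C=1]) (auto intro!: continuous_intros)
    show "AE \<xi> in lborel. norm (F \<xi> * (LINT \<eta>|lborel. complex_of_real (f \<eta>) * ?G m (\<eta> - \<xi>))) \<le> norm (F \<xi>)" for m
    proof (rule AE_I2)
      fix \<xi> :: 'a
      have h: "?h m > 0" by simp
      have I: "integrable lborel (\<lambda>\<eta>. gauss_kernel (?h m) (\<eta> - \<xi>))"
        using lborel_integrable_translate[OF gauss_kernel_integrable[OF h], of "- \<xi>"] by simp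
      have "norm (LINT \<eta>|lborel. complex_of_real (f \<eta>) * ?G m (\<eta> - \<xi>)) \<le> (LINT \<eta>|lborel. gauss_kernel (?h m) (\<eta> - \<xi>))"
      proof (rule norm_integral_le[OF I])
        fix \<eta>
        show "norm (complex_of_real (f \<eta>) * ?G m (\<eta> - \<xi>)) \<le> gauss_kernel (?h m) (\<eta> - \<xi>)"
          unfolding norm_mult norm_of_real abs_of_nonneg[OF gauss_kernel_nonneg[OF h]]
          using f1[of \<eta>] gauss_kernel_nonneg[OF h, of "\<eta> - \<xi>"] by (intro mult_left_le_one_le) auto
      qed
      also have "\<dots> = 1"
        using lborel_integral_translate[OF gauss_kernel_measurable, of "?h m" "- \<xi>"] gauss_kernel_integral[OF h, where 'a='a] by simp
      finally show "norm (F \<xi> * (LINT \<eta>|lborel. complex_of_real (f \<eta>) * ?G m (\<eta> - \<xi>))) \<le> norm (F \<xi>)"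
        unfolding norm_mult by (rule mult_left_le) simp
    qed
  qed measurable
  then show "(LINT x|lborel. F x * complex_of_real (f x)) = 0"
    unfolding z by (simp add: LIMSEQ_const_iff)
qed

section \<open>The heat evolution\<close>

lemma power_le_fact_exp:
  fixes x :: real
  assumes "x \<ge> 0" shows "x ^ m \<le> fact m * exp x"
proof -
  have "(\<Sum>n\<in>{m}. x ^ n /\<^sub>R fact n) \<le> suminf (\<lambda>n. x ^ n /\<^sub>R fact n)"
    by (rule sum_le_suminf) (use assms exp_converges[of x] in \<open>auto simp: sums_iff\<close>)
  then have "x ^ m / fact m \<le> exp x"
    using exp_converges[of x] by (simp add: sums_iff divide_inverse mult.commute)
  then show ?thesis by (simp add: pos_divide_le_eq mult.commute)
qed

text \<open>
  With \<open>y = 1/t\<close>, the quotient of the function by \<open>(1 + t)\<^bsup>-1-q\<^esup>\<close> is \<open>(1 + y)\<^bsup>1+q\<^esup> e\<^bsup>-cy\<^esup>\<close>, which is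
  bounded; and \<open>(1 + t)\<^bsup>-1-q\<^esup>\<close> has an explicit primitive.
\<close>

lemma set_integrable_powr_exp_inverse:
  fixes q c :: real
  assumes "q > 0" "c > 0"
  shows "set_integrable lborel {0<..} (\<lambda>t. t powr (-1 - q) * exp (- c / t))"
proof -
  have "set_integrable lborel (einterval (ereal 0) \<infinity>) (\<lambda>t. q * (1 + t) powr (-1 - q))"
  proof (rule interval_integral_FTC_nonneg(1))
    fix t :: real assume "ereal 0 < ereal t"
    then have t: "t > 0" by simp
    show "DERIV (\<lambda>t. - ((1 + t) powr (- q))) t :> q * (1 + t) powr (-1 - q)"
      using t by (auto intro!: derivative_eq_intros simp: minus_diff_commute)
    show "isCont (\<lambda>t. q * (1 + t) powr (-1 - q)) t"
      using t by (intro continuous_intros) auto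
  next
    show "AE x in lborel. ereal 0 < ereal x \<longrightarrow> ereal x < \<infinity> \<longrightarrow> 0 \<le> q * (1 + x) powr (-1 - q)"
      using assms by simp
    have "((\<lambda>t. - ((1 + t) powr (- q))) \<longlongrightarrow> - 1) (at_right (0::real))"
      by (auto intro!: tendsto_eq_intros)
    then show "(((\<lambda>t. - ((1 + t) powr (- q))) \<circ> real_of_ereal) \<longlongrightarrow> - 1) (at_right (ereal 0))"
      by (simp add: ereal_tendsto_simps)
    have "((\<lambda>t. - ((1 + t) powr (- q))) \<longlongrightarrow> - 0) at_top"
      using assms(1) by (intro tendsto_minus tendsto_neg_powr filterlim_tendsto_add_at_top[OF tendsto_const filterlim_ident])
        auto
    then show "(((\<lambda>t. - ((1 + t) powr (- q))) \<circ> real_of_ereal) \<longlongrightarrow> 0) (at_left \<infinity>)"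
      by (simp add: ereal_tendsto_simps)
  qed simp
  moreover have "einterval (ereal 0) \<infinity> = {0<..}" by (auto simp: einterval_def)
  ultimately have I: "integrable lborel (\<lambda>t. indicator {0<..} t *\<^sub>R (q * (1 + t) powr (-1 - q)))"
    by (simp add: set_integrable_def)
  define m where "m = nat \<lceil>1 + q\<rceil>"
  \<comment> \<open>the bound of \<open>(1 + y)\<^sup>m exp (- c y)\<close> obtained from \<open>(c (1 + y))\<^sup>m \<le> m! exp (c (1 + y))\<close>\<close>
  define K where "K = fact m * exp c / c ^ m"
  have K: "t powr (-1 - q) * exp (- c / t) \<le> K * (1 + t) powr (-1 - q)" if "t > 0" for t
  proof -
    have y: "1 + 1 / t > 1" using that by simp
    have "(c * (1 + 1 / t)) ^ m \<le> fact m * exp (c * (1 + 1 / t))"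
      using that assms by (intro power_le_fact_exp) simp
    moreover have "exp (c * (1 + 1 / t)) = exp c * exp (c / t)" by (simp add: distrib_left exp_add)
    ultimately have "(1 + 1 / t) ^ m * c ^ m \<le> fact m * exp c * exp (c / t)"
      by (simp only: power_mult_distrib mult_ac)
    then have "(1 + 1 / t) ^ m \<le> fact m * exp c * exp (c / t) / c ^ m"
      using assms by (subst pos_le_divide_eq) auto
    then have "(1 + 1 / t) ^ m \<le> K * exp (c / t)" by (simp add: K_def)
    moreover have "(1 + 1 / t) powr (1 + q) \<le> (1 + 1 / t) powr real m"
      using y by (intro powr_mono) (auto simp: m_def real_nat_ceiling_ge)
    ultimately have 1: "(1 + 1 / t) powr (1 + q) \<le> K * exp (c / t)"
      using y powr_realpow[of "1 + 1 / t" m] by linarith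
    have "1 + 1 / t = (1 + t) / t" using that by (simp add: field_simps)
    then have "(1 + t) powr (1 + q) / t powr (1 + q) \<le> K * exp (c / t)"
      using 1 that by (simp add: powr_divide)
    then have "inverse (t powr (1 + q)) * inverse (exp (c / t)) \<le> K * inverse ((1 + t) powr (1 + q))"
      using that by (simp add: field_simps)
    moreover have "-1 - q = - (1 + q)" "- c / t = - (c / t)" by auto
    ultimately show ?thesis by (simp only: powr_minus exp_minus)
  qed
  have "K > 0" using assms by (simp add: K_def)
  show ?thesis
    unfolding set_integrable_def
  proof (rule Bochner_Integration.integrable_bound[OF integrable_mult_right[OF I, of "K / q"]])
    show "AE t in lborel. norm (indicator {0<..} t *\<^sub>R (t powr (-1 - q) * exp (- c / t)))
       \<le> norm (K / q * (indicator {0<..} t *\<^sub>R (q * (1 + t) powr (-1 - q))))"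
      using K assms \<open>K > 0\<close> by (intro AE_I2) (auto simp: indicator_def abs_mult)
  qed measurable
qed

text \<open>
  Rapid decay in the integrated sense. Unlike the Schwartz space, this class contains the products of a merely
  measurable density with Schwartz functions.
\<close>

definition has_moments :: "('a::euclidean_space \<Rightarrow> complex) \<Rightarrow> bool" where
  "has_moments F \<longleftrightarrow> F \<in> borel_measurable borel \<and>
     (\<forall>N. integrable lborel (\<lambda>\<xi>. complex_of_real ((1 + norm \<xi>) ^ N) * F \<xi>))"

lemma has_moments_measurable: "has_moments F \<Longrightarrow> F \<in> borel_measurable borel"
  by (simp add: has_moments_def)

lemma has_moments_integrable: "has_moments F \<Longrightarrow> integrable lborel F"
  unfolding has_moments_def by (elim conjE allE[of _ 0]) simp

lemma has_moments_mult:
  fixes F g :: "'a::euclidean_space \<Rightarrow> complex"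
  assumes F: "has_moments F" and g: "g \<in> borel_measurable borel" "\<And>\<xi>. norm (g \<xi>) \<le> C * (1 + norm \<xi>) ^ M"
  shows "has_moments (\<lambda>\<xi>. g \<xi> * F \<xi>)"
  unfolding has_moments_def
proof (intro conjI allI)
  note [measurable] = g(1) has_moments_measurable[OF F]
  show "(\<lambda>\<xi>. g \<xi> * F \<xi>) \<in> borel_measurable borel" by measurable
  fix N
  have "integrable lborel (\<lambda>\<xi>. complex_of_real ((1 + norm \<xi>) ^ (N + M)) * F \<xi>)"
    using F unfolding has_moments_def by blast
  then have I: "integrable lborel (\<lambda>\<xi>. complex_of_real C * (complex_of_real ((1 + norm \<xi>) ^ (N + M)) * F \<xi>))"
    by (rule integrable_mult_right)
  show "integrable lborel (\<lambda>\<xi>. complex_of_real ((1 + norm \<xi>) ^ N) * (g \<xi> * F \<xi>))"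
  proof (rule Bochner_Integration.integrable_bound[OF I _ AE_I2])
    fix \<xi> :: 'a
    have pos: "(1 + norm \<xi>) ^ k \<ge> 0" for k by (intro zero_le_power add_nonneg_nonneg) auto
    have "(1 + norm \<xi>) ^ N * norm (g \<xi>) * norm (F \<xi>) \<le> (1 + norm \<xi>) ^ N * (C * (1 + norm \<xi>) ^ M) * norm (F \<xi>)"
      by (intro mult_right_mono mult_left_mono g pos) auto
    also have "\<dots> = C * ((1 + norm \<xi>) ^ (N + M) * norm (F \<xi>))" by (simp add: power_add mult_ac)
    also have "\<dots> \<le> \<bar>C\<bar> * ((1 + norm \<xi>) ^ (N + M) * norm (F \<xi>))"
      by (intro mult_right_mono mult_nonneg_nonneg pos) auto
    finally show "norm (complex_of_real ((1 + norm \<xi>) ^ N) * (g \<xi> * F \<xi>))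
      \<le> norm (complex_of_real C * (complex_of_real ((1 + norm \<xi>) ^ (N + M)) * F \<xi>))"
      by (simp only: norm_mult norm_of_real abs_of_nonneg[OF pos] mult_ac)
  qed measurable
qed

lemma has_moments_norm_power:
  fixes F :: "'a::euclidean_space \<Rightarrow> complex"
  assumes "has_moments F" shows "has_moments (\<lambda>\<xi>. complex_of_real (norm \<xi> ^ k) * F \<xi>)"
  by (rule has_moments_mult[OF assms, where C=1 and M=k]) (auto simp: norm_power intro!: power_mono)

lemma has_moments_cis:
  fixes F :: "'a::euclidean_space \<Rightarrow> complex"
  assumes "has_moments F" shows "has_moments (\<lambda>\<xi>. cis (x \<bullet> \<xi>) * F \<xi>)"
  by (rule has_moments_mult[OF assms, where C=1 and M=0]) auto

lemma has_moments_inner_power: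
  fixes F :: "'a::euclidean_space \<Rightarrow> complex"
  assumes "has_moments F" shows "has_moments (\<lambda>\<xi>. complex_of_real ((v \<bullet> \<xi>) ^ k) * F \<xi>)"
proof (rule has_moments_mult[OF assms, where C="norm v ^ k" and M=k])
  fix \<xi>
  have "\<bar>v \<bullet> \<xi>\<bar> \<le> norm v * (1 + norm \<xi>)"
    using Cauchy_Schwarz_ineq2[of v \<xi>] by (rule order_trans) (intro mult_left_mono, auto)
  then have "\<bar>v \<bullet> \<xi>\<bar> ^ k \<le> (norm v * (1 + norm \<xi>)) ^ k" by (intro power_mono) auto
  then show "norm (complex_of_real ((v \<bullet> \<xi>) ^ k)) \<le> norm v ^ k * (1 + norm \<xi>) ^ k"
    by (simp only: power_mult_distrib norm_of_real power_abs)
qed measurable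

text \<open>
  For the inverse Fourier transform \<open>g\<close> of \<open>F\<close>, this is up to a constant the value of the heat
  evolution \<open>e\<^bsup>t\<Delta>\<^esup> g\<close> at the origin. Other points are reached by multiplying \<open>F\<close> with characters.
\<close>

definition heat :: "('a::euclidean_space \<Rightarrow> complex) \<Rightarrow> real \<Rightarrow> complex" where
  "heat F t = (LINT \<xi>|lborel. complex_of_real (exp (- t * (norm \<xi>)\<^sup>2)) * F \<xi>)"

lemma heat_integrable:
  fixes F :: "'a::euclidean_space \<Rightarrow> complex"
  assumes F: "integrable lborel F" and "t \<ge> 0"
  shows "integrable lborel (\<lambda>\<xi>. complex_of_real (exp (- t * (norm \<xi>)\<^sup>2)) * F \<xi>)"
proof (rule Bochner_Integration.integrable_bound[OF F _ AE_I2])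
  have [measurable]: "F \<in> borel_measurable borel" using borel_measurable_integrable[OF F] by simp
  show "(\<lambda>\<xi>. complex_of_real (exp (- t * (norm \<xi>)\<^sup>2)) * F \<xi>) \<in> borel_measurable lborel" by measurable
  show "norm (complex_of_real (exp (- t * (norm \<xi>)\<^sup>2)) * F \<xi>) \<le> norm (F \<xi>)" for \<xi>
    unfolding norm_mult norm_of_real using assms(2) by (intro mult_left_le_one_le) auto
qed

lemma heat_measurable [measurable]:
  fixes F :: "'a::euclidean_space \<Rightarrow> complex"
  assumes [measurable]: "F \<in> borel_measurable borel"
  shows "heat F \<in> borel_measurable borel"
  unfolding heat_def by measurable

text \<open>
  The heat evolution at the origin is an average of the transform of \<open>F\<close> with respect to the heat
  kernel at time \<open>t\<close>, and only points at distance at least \<open>\<epsilon>\<close> contribute. Half of the exponent of the kernel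
  yields the decaying factor, the other half remains integrable. This is the
  only place where vanishing on a neighbourhood, rather than at a point, enters.
\<close>

lemma heat_decay:
  fixes F :: "'a::euclidean_space \<Rightarrow> complex"
  assumes F: "integrable lborel F" and 0: "\<And>x. norm x < \<epsilon> \<Longrightarrow> fourier_integral F x = 0"
    and "\<epsilon> > 0" "t > 0"
  shows "norm (heat F t) \<le> sqrt 2 ^ DIM('a) * (LINT \<xi>|lborel. norm (F \<xi>)) * exp (- (\<epsilon>\<^sup>2 / 8) / t)"
proof -
  have [measurable]: "F \<in> borel_measurable borel" using borel_measurable_integrable[OF F] by simp
  \<comment> \<open>the width for which the transform of the kernel is \<open>exp (- t |\<xi>|\<^sup>2)\<close>\<close>
  define r where "r = 2 * sqrt t"
  have r: "r > 0" "r\<^sup>2 = 4 * t" using assms by (auto simp: r_def power_mult_distrib)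
  define B where "B = (LINT \<xi>|lborel. norm (F \<xi>))"
  have "B \<ge> 0" unfolding B_def by (intro integral_nonneg_AE AE_I2 norm_ge_zero)
  have A: "norm (fourier_integral F x) \<le> B" for x
    unfolding B_def by (rule norm_integral_le) (auto simp: norm_mult integrable_norm[OF F])
  have 1: "(LINT x|lborel. cis (x \<bullet> \<xi>) * complex_of_real (gauss_kernel r x) * F \<xi>)
      = complex_of_real (exp (- t * (norm \<xi>)\<^sup>2)) * F \<xi>" for \<xi>
    using fourier_integral_gauss_kernel(2)[OF r(1), of \<xi>] r(2) by (simp add: integral_mult_left_zero)
  have 2: "(LINT \<xi>|lborel. cis (x \<bullet> \<xi>) * complex_of_real (gauss_kernel r x) * F \<xi>)
      = complex_of_real (gauss_kernel r x) * fourier_integral F x" for x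
  proof -
    have "cis (x \<bullet> \<xi>) * complex_of_real (gauss_kernel r x) * F \<xi> = complex_of_real (gauss_kernel r x) * (cis (\<xi> \<bullet> x) * F \<xi>)" for \<xi>
      by (simp only: mult_ac inner_commute)
    then show ?thesis by (simp only: integral_mult_right_zero)
  qed
  have "(LINT \<xi>|lborel. LINT x|lborel. cis (x \<bullet> \<xi>) * complex_of_real (gauss_kernel r x) * F \<xi>)
    = (LINT x|lborel. LINT \<xi>|lborel. cis (x \<bullet> \<xi>) * complex_of_real (gauss_kernel r x) * F \<xi>)"
  proof (rule Fubini_le_prod[where A="\<lambda>\<xi>. norm (F \<xi>)" and B="gauss_kernel r"])
    show "integrable lborel (\<lambda>\<xi>. norm (F \<xi>))" by (rule integrable_norm[OF F])
    show "integrable lborel (gauss_kernel r :: 'a \<Rightarrow> real)" by (rule gauss_kernel_integrable[OF r(1)])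
    show "norm (cis (x \<bullet> \<xi>) * complex_of_real (gauss_kernel r x) * F \<xi>) \<le> norm (F \<xi>) * gauss_kernel r x" for \<xi> x
      by (simp add: norm_mult abs_of_nonneg[OF gauss_kernel_nonneg[OF r(1)]])
  qed measurable
  then have h: "heat F t = (LINT x|lborel. complex_of_real (gauss_kernel r x) * fourier_integral F x)"
    unfolding 1 2 heat_def .
  \<comment> \<open>doubling the time of the kernel, i.e. widening it by \<open>\<surd>2\<close>, halves its exponent\<close>
  have s: "sqrt 2 * r > 0" using r by simp
  let ?K = "sqrt 2 ^ DIM('a) * B * exp (- (\<epsilon>\<^sup>2 / 8) / t)"
  have "norm (heat F t) \<le> (LINT x|lborel. ?K * gauss_kernel (sqrt 2 * r) (x::'a))"
    unfolding h
  proof (rule norm_integral_le)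
    show "integrable lborel (\<lambda>x::'a. ?K * gauss_kernel (sqrt 2 * r) x)"
      by (rule integrable_mult_right[OF gauss_kernel_integrable[OF s]])
    fix x :: 'a
    show "norm (complex_of_real (gauss_kernel r x) * fourier_integral F x) \<le> ?K * gauss_kernel (sqrt 2 * r) x"
    proof (cases "norm x < \<epsilon>")
      case True
      then show ?thesis using 0 \<open>B \<ge> 0\<close> gauss_kernel_nonneg[OF s, of x] by simp
    next
      case False
      have "(norm x)\<^sup>2 \<ge> \<epsilon>\<^sup>2" using False \<open>\<epsilon> > 0\<close> by (intro power_mono) auto
      then have "- (norm x)\<^sup>2 / r\<^sup>2 \<le> - (\<epsilon>\<^sup>2 / 8) / t + - (norm x)\<^sup>2 / (sqrt 2 * r)\<^sup>2"
        using \<open>t > 0\<close> by (simp add: r(2) power_mult_distrib field_simps)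
      then have "exp (- (norm x)\<^sup>2 / r\<^sup>2) \<le> exp (- (\<epsilon>\<^sup>2 / 8) / t) * exp (- (norm x)\<^sup>2 / (sqrt 2 * r)\<^sup>2)"
        unfolding exp_add[symmetric] by simp
      then have "gauss_kernel r x \<le> exp (- (\<epsilon>\<^sup>2 / 8) / t) * exp (- (norm x)\<^sup>2 / (sqrt 2 * r)\<^sup>2) / (sqrt pi * r) ^ DIM('a)"
        unfolding gauss_kernel_def using r(1) by (intro divide_right_mono) auto
      also have "\<dots> = sqrt 2 ^ DIM('a) * exp (- (\<epsilon>\<^sup>2 / 8) / t) * gauss_kernel (sqrt 2 * r) x"
        by (simp add: gauss_kernel_def power_mult_distrib)
      finally have "gauss_kernel r x * norm (fourier_integral F x) \<le> (sqrt 2 ^ DIM('a) * exp (- (\<epsilon>\<^sup>2 / 8) / t) * gauss_kernel (sqrt 2 * r) x) * B"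
        using A[of x] gauss_kernel_nonneg[OF s, of x] by (intro mult_mono) auto
      then show ?thesis by (simp add: norm_mult abs_of_nonneg[OF gauss_kernel_nonneg[OF r(1)]] mult_ac)
    qed
  qed
  then show ?thesis using gauss_kernel_integral[OF s, where 'a='a] by (simp add: B_def)
qed

lemma exp_taylor_bound:
  fixes a b :: real
  assumes "a \<ge> 0" "b \<ge> 0"
  shows "\<bar>exp (- a) - exp (- b) + (a - b) * exp (- b)\<bar> \<le> (a - b)\<^sup>2"
proof -
  have e: "1 - d \<le> exp (- d)" for d :: real using exp_ge_add_one_self[of "- d"] by simp
  show ?thesis
  proof (cases "b \<le> a")
    case True
    define d where "d = a - b"
    have d: "d \<ge> 0" using True by (simp add: d_def)
    have "(1 + d) * exp (- d) \<le> 1" using exp_ge_add_one_self[of d] by (simp add: exp_minus field_simps)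
    moreover have "(1 - d) * d \<le> exp (- d) * d" using e d by (intro mult_right_mono) auto
    ultimately have "exp (- d) - 1 + d \<le> d\<^sup>2" by (simp add: algebra_simps power2_eq_square)
    moreover have "exp (- d) - 1 + d \<ge> 0" using e[of d] by simp
    ultimately have "\<bar>exp (- b) * (exp (- d) - 1 + d)\<bar> \<le> 1 * d\<^sup>2"
      unfolding abs_mult using assms by (intro mult_mono) auto
    moreover have "exp (- b) * (exp (- d) - 1 + d) = exp (- a) - exp (- b) + (a - b) * exp (- b)"
      by (simp add: d_def algebra_simps flip: exp_add)
    ultimately show ?thesis by (simp add: d_def)
  next
    case False
    define d where "d = b - a"
    have d: "d \<ge> 0" using False by (simp add: d_def)
    have "(1 + d) * exp (- d) \<le> 1" using exp_ge_add_one_self[of d] by (simp add: exp_minus field_simps)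
    moreover have "(1 + d) * (1 - d) \<le> (1 + d) * exp (- d)" using e d by (intro mult_left_mono) auto
    ultimately have "\<bar>1 - (1 + d) * exp (- d)\<bar> \<le> d\<^sup>2" by (simp add: algebra_simps power2_eq_square)
    then have "\<bar>exp (- a) * (1 - (1 + d) * exp (- d))\<bar> \<le> 1 * d\<^sup>2"
      unfolding abs_mult using assms by (intro mult_mono) auto
    moreover have "exp (- a) * (1 - (1 + d) * exp (- d)) = exp (- a) - exp (- b) + (a - b) * exp (- b)"
      by (simp add: d_def algebra_simps flip: exp_add)
    ultimately show ?thesis by (simp add: d_def power2_commute)
  qed
qed

text \<open>
  The heat equation: the time derivative of the evolution is the evolution of \<open>\<Delta> g\<close>, that is, of
  \<open>- |\<xi>|\<^sup>2 F\<close>.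
\<close>

lemma heat_has_vector_derivative:
  fixes F :: "'a::euclidean_space \<Rightarrow> complex"
  assumes F: "has_moments F" and "t > 0"
  shows "(heat F has_vector_derivative - heat (\<lambda>\<xi>. complex_of_real (norm \<xi> ^ 2) * F \<xi>) t) (at t)"
  unfolding has_vector_derivative_def
proof (rule has_derivativeI_sandwich[OF \<open>t > 0\<close>])
  let ?F2 = "\<lambda>\<xi>. complex_of_real (norm \<xi> ^ 2) * F \<xi>"
  note F2 = has_moments_norm_power[OF F, of 2] and F4 = has_moments_norm_power[OF F, of 4]
  define K where "K = (LINT \<xi>|lborel. norm (complex_of_real (norm \<xi> ^ 4) * F \<xi>))"
  show "bounded_linear (\<lambda>h. h *\<^sub>R - heat ?F2 t)" by (rule bounded_linear_scaleR_left)
  show "((\<lambda>s. K * \<bar>s - t\<bar>) \<longlongrightarrow> 0) (at t)" by (auto intro!: tendsto_eq_intros)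
  fix s assume s: "s \<in> UNIV" "s \<noteq> t" "dist s t < t"
  then have "s \<ge> 0" by (simp add: dist_real_def abs_less_iff)
  have i1: "integrable lborel (\<lambda>\<xi>. complex_of_real (exp (- s * (norm \<xi>)\<^sup>2)) * F \<xi>)"
    and i2: "integrable lborel (\<lambda>\<xi>. complex_of_real (exp (- t * (norm \<xi>)\<^sup>2)) * F \<xi>)"
    and i3: "integrable lborel (\<lambda>\<xi>. complex_of_real (exp (- t * (norm \<xi>)\<^sup>2)) * ?F2 \<xi>)"
    using \<open>s \<ge> 0\<close> \<open>t > 0\<close> by (intro heat_integrable has_moments_integrable F F2, simp)+
  let ?E = "\<lambda>\<xi>. complex_of_real (exp (- s * (norm \<xi>)\<^sup>2)) * F \<xi> - complex_of_real (exp (- t * (norm \<xi>)\<^sup>2)) * F \<xi>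
      + (s - t) *\<^sub>R (complex_of_real (exp (- t * (norm \<xi>)\<^sup>2)) * ?F2 \<xi>)"
  have "heat F s - heat F t - (s - t) *\<^sub>R - heat ?F2 t = (LINT \<xi>|lborel. ?E \<xi>)"
    unfolding heat_def
    using Bochner_Integration.integral_add[OF Bochner_Integration.integrable_diff[OF i1 i2] integrable_scaleR_right[OF i3, of "s - t"]]
      Bochner_Integration.integral_diff[OF i1 i2] by simp
  also have "norm \<dots> \<le> (LINT \<xi>|lborel. (s - t)\<^sup>2 * norm (complex_of_real (norm \<xi> ^ 4) * F \<xi>))"
  proof (rule norm_integral_le)
    show "integrable lborel (\<lambda>\<xi>. (s - t)\<^sup>2 * norm (complex_of_real (norm \<xi> ^ 4) * F \<xi>))"
      by (rule integrable_mult_right, rule integrable_norm, rule has_moments_integrable[OF F4])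
    fix \<xi> :: 'a
    let ?l = "(norm \<xi>)\<^sup>2"
    have E: "?E \<xi> = complex_of_real (exp (- (s * ?l)) - exp (- (t * ?l)) + (s * ?l - t * ?l) * exp (- (t * ?l))) * F \<xi>"
      by (simp add: scaleR_conv_of_real algebra_simps)
    have "norm (?E \<xi>) \<le> (s * ?l - t * ?l)\<^sup>2 * norm (F \<xi>)"
      unfolding E norm_mult norm_of_real using \<open>s \<ge> 0\<close> \<open>t > 0\<close>
      by (intro mult_right_mono exp_taylor_bound) auto
    also have "(s * ?l - t * ?l)\<^sup>2 = (s - t)\<^sup>2 * norm \<xi> ^ 4"
      by (simp add: left_diff_distrib[symmetric] power_mult_distrib flip: power_mult)
    finally show "norm (?E \<xi>) \<le> (s - t)\<^sup>2 * norm (complex_of_real (norm \<xi> ^ 4) * F \<xi>)"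
      by (simp add: norm_mult norm_power mult.assoc)
  qed
  also have "\<dots> = (s - t)\<^sup>2 * K" by (simp add: K_def)
  finally show "norm (heat F s - heat F t - (s - t) *\<^sub>R - heat ?F2 t) / norm (s - t) \<le> K * \<bar>s - t\<bar>"
    using s(2) by (simp add: pos_divide_le_eq power2_eq_square mult_ac flip: abs_mult)
qed

section \<open>Subordination and integration by parts in time\<close>

text \<open>
  Substitution of \<open>t * l\<close> in Euler's integral for \<open>\<Gamma>(1 - a)\<close>.
\<close>

lemma integral_scaled_gamma:
  fixes a :: real
  assumes a: "0 < a" "a < 1" and "l \<ge> 0"
  defines "\<Gamma> \<equiv> (LINT t:{0<..}|lborel. t powr (-a) * exp (- t))"
  shows "set_integrable lborel {0<..} (\<lambda>t. t powr (-a) * (l * exp (- t * l)))" (is ?I)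
    and "(LINT t:{0<..}|lborel. t powr (-a) * (l * exp (- t * l))) = \<Gamma> * l powr a" (is ?V)
proof -
  have "integrable lborel (\<lambda>t. indicator {0..} t * t powr ((1 - a) - 1) / exp t)"
  proof (rule integrableI_nn_integral_finite)
    show "(\<integral>\<^sup>+ t. ennreal (indicator {0..} t * t powr ((1 - a) - 1) / exp t) \<partial>lborel) = ennreal (Gamma (1 - a))"
      using Gamma_conv_nn_integral_real[of "1 - a"] a by simp
  qed (auto simp: indicator_def)
  also have "(\<lambda>t. indicator {0..} t * t powr ((1 - a) - 1) / exp t) = (\<lambda>t. indicator {0<..} t *\<^sub>R (t powr (-a) * exp (- t)))"
    by (rule ext) (auto simp: indicator_def exp_minus field_simps)
  finally have I1: "integrable lborel (\<lambda>t. indicator {0<..} t *\<^sub>R (t powr (-a) * exp (- t)))" .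
  have "?I \<and> ?V"
  proof (cases "l = 0")
    case True
    then show ?thesis using a by (simp add: set_integrable_def set_lebesgue_integral_def)
  next
    case False
    with \<open>l \<ge> 0\<close> have l: "l > 0" by simp
    let ?f = "\<lambda>t. indicator {0<..} t *\<^sub>R (t powr (-a) * exp (- t))"
    have eq: "?f (0 + l * t) = l powr (-a) / l * (indicator {0<..} t *\<^sub>R (t powr (-a) * (l * exp (- t * l))))" for t
      using l by (auto simp: indicator_def zero_less_mult_iff powr_mult mult_ac)
    have J: "integrable lborel (\<lambda>t. l powr (-a) / l * (indicator {0<..} t *\<^sub>R (t powr (-a) * (l * exp (- t * l)))))"
      unfolding eq[symmetric] by (rule lborel_integrable_real_affine[OF I1]) (use l in simp)
    have "l / l powr (-a) * (l powr (-a) / l * X) = X" for X :: real using l by simp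
    then have i: ?I
      using integrable_mult_right[OF J, of "l / l powr (-a)"] unfolding set_integrable_def by (simp only:)
    have "\<Gamma> = \<bar>l\<bar> *\<^sub>R (LINT t|lborel. ?f (0 + l * t))"
      unfolding \<Gamma>_def set_lebesgue_integral_def using l by (intro lborel_integral_real_affine) simp
    also have "\<dots> = l powr (-a) * (LINT t:{0<..}|lborel. t powr (-a) * (l * exp (- t * l)))"
      unfolding eq integral_mult_right_zero set_lebesgue_integral_def using l by simp
    finally have "\<Gamma> * l powr a = l powr a * l powr (-a) * (LINT t:{0<..}|lborel. t powr (-a) * (l * exp (- t * l)))" by simp
    also have "l powr a * l powr (-a) = 1" using l by (simp flip: powr_add)
    finally show ?thesis using i by simp
  qed
  then show ?I ?V by auto
qed

text \<open>
  Subordination: the preceding integral with \<open>l = |\<xi>|\<^sup>2\<close> expresses \<open>|\<xi>|\<^bsup>2a\<^esup>\<close> by the heat semigroup. The double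
  integral is not dominated by a product near \<open>t = 0\<close>, so its integrability is checked by integrating in \<open>t\<close>
  first, where the value is known exactly.
\<close>

lemma integral_heat_powr:
  fixes F :: "'a::euclidean_space \<Rightarrow> complex"
  assumes a: "0 < a" "a < 1" and F: "has_moments F"
  defines "\<Gamma> \<equiv> (LINT t:{0<..}|lborel. t powr (-a) * exp (- t))"
  defines "F2 \<equiv> \<lambda>\<xi>. complex_of_real (norm \<xi> ^ 2) * F \<xi>"
  shows "set_integrable lborel {0<..} (\<lambda>t. complex_of_real (t powr (-a)) * heat F2 t)" (is ?I)
    and "(LINT t:{0<..}|lborel. complex_of_real (t powr (-a)) * heat F2 t)
      = complex_of_real \<Gamma> * (LINT \<xi>|lborel. complex_of_real (norm \<xi> powr (2 * a)) * F \<xi>)" (is ?V)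
proof -
  note [measurable] = has_moments_measurable[OF F]
  define p where "p \<xi> t = indicator {0<..} t *\<^sub>R (t powr (-a) * ((norm \<xi>)\<^sup>2 * exp (- t * (norm \<xi>)\<^sup>2)))" for \<xi> :: 'a and t :: real
  have p0: "p \<xi> t \<ge> 0" for \<xi> t by (auto simp: p_def)
  have [measurable]: "case_prod p \<in> borel_measurable (borel \<Otimes>\<^sub>M borel)" unfolding p_def by measurable
  have pi: "integrable lborel (p \<xi>)" and pv: "integral\<^sup>L lborel (p \<xi>) = \<Gamma> * norm \<xi> powr (2 * a)" for \<xi>
  proof -
    have sq: "((norm \<xi>)\<^sup>2) powr a = norm \<xi> powr (2 * a)"
      by (cases "\<xi> = 0") (simp_all add: powr_powr flip: powr_numeral)
    show "integrable lborel (p \<xi>)" "integral\<^sup>L lborel (p \<xi>) = \<Gamma> * norm \<xi> powr (2 * a)"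
      using integral_scaled_gamma[OF a, of "(norm \<xi>)\<^sup>2"]
      by (simp_all add: p_def[abs_def] set_integrable_def set_lebesgue_integral_def \<Gamma>_def sq)
  qed
  have \<Gamma>0: "\<Gamma> \<ge> 0" unfolding \<Gamma>_def set_lebesgue_integral_def by (intro integral_nonneg_AE AE_I2) (simp add: indicator_def)
  have m: "has_moments (\<lambda>\<xi>. complex_of_real (norm \<xi> powr (2 * a)) * F \<xi>)"
  proof (rule has_moments_mult[OF F, where C=1 and M=2])
    fix \<xi> :: 'a
    have "norm \<xi> powr (2 * a) \<le> (1 + norm \<xi>) powr (2 * a)" using a by (intro powr_mono2) auto
    also have "\<dots> \<le> (1 + norm \<xi>) powr 2" using a by (intro powr_mono) auto
    also have "\<dots> = (1 + norm \<xi>) ^ 2" by (subst powr_numeral) auto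
    finally show "norm (complex_of_real (norm \<xi> powr (2 * a))) \<le> 1 * (1 + norm \<xi>) ^ 2" by simp
  qed measurable
  define k where "k \<xi> t = complex_of_real (p \<xi> t) * F \<xi>" for \<xi> t
  have km: "case_prod k \<in> borel_measurable (lborel \<Otimes>\<^sub>M lborel)" unfolding k_def by measurable
  have int: "integrable (lborel \<Otimes>\<^sub>M lborel) (case_prod k)"
  proof (rule lborel_pair.Fubini_integrable[OF km])
    show "AE \<xi> in lborel. integrable lborel (\<lambda>t. case (\<xi>, t) of (\<xi>, t) \<Rightarrow> k \<xi> t)"
      unfolding k_def by (intro AE_I2) (simp add: pi)
    have "(LINT t|lborel. norm (k \<xi> t)) = \<Gamma> * norm (complex_of_real (norm \<xi> powr (2 * a)) * F \<xi>)" for \<xi>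
      using pv[of \<xi>] by (simp add: k_def norm_mult abs_of_nonneg[OF p0])
    then show "integrable lborel (\<lambda>\<xi>. LINT t|lborel. norm (case (\<xi>, t) of (\<xi>, t) \<Rightarrow> k \<xi> t))"
      using has_moments_integrable[OF m] by simp
  qed
  have inner: "(LINT \<xi>|lborel. k \<xi> t) = indicator {0<..} t *\<^sub>R (complex_of_real (t powr (-a)) * heat F2 t)" for t
  proof -
    have "k \<xi> t = (complex_of_real (indicator {0<..} t) * complex_of_real (t powr (-a))) * (complex_of_real (exp (- t * (norm \<xi>)\<^sup>2)) * F2 \<xi>)" for \<xi>
      by (simp add: k_def p_def F2_def)
    then show ?thesis by (simp only: integral_mult_right_zero heat_def scaleR_conv_of_real mult.assoc)
  qed
  have "integrable lborel (\<lambda>t. LINT \<xi>|lborel. k \<xi> t)" by (rule lborel_pair.integrable_snd[OF int])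
  then show ?I unfolding inner set_integrable_def .
  have "(LINT t|lborel. LINT \<xi>|lborel. k \<xi> t) = (LINT \<xi>|lborel. LINT t|lborel. k \<xi> t)"
    by (rule lborel_pair.Fubini_integral[OF int])
  also have "(LINT t|lborel. k \<xi> t) = complex_of_real \<Gamma> * (complex_of_real (norm \<xi> powr (2 * a)) * F \<xi>)" for \<xi>
    unfolding k_def using pv[of \<xi>] by simp
  then have "(LINT \<xi>|lborel. LINT t|lborel. k \<xi> t) = complex_of_real \<Gamma> * (LINT \<xi>|lborel. complex_of_real (norm \<xi> powr (2 * a)) * F \<xi>)"
    by (simp only: integral_mult_right_zero)
  finally show ?V unfolding inner set_lebesgue_integral_def .
qed

text \<open>
  Integration by parts on the half line. At \<open>0\<close> the factor \<open>exp (- c / t)\<close> kills the boundary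
  term whatever the power of \<open>t\<close>, at infinity \<open>t\<^bsup>-b\<^esup>\<close> does.
\<close>

lemma integral_by_parts_powr:
  fixes v w :: "real \<Rightarrow> complex"
  assumes "b > 0" "c > 0"
    and v: "\<And>t. t > 0 \<Longrightarrow> (v has_vector_derivative - w t) (at t)"
    and w: "continuous_on {0<..} w"
    and vb: "\<And>t. t > 0 \<Longrightarrow> norm (v t) \<le> C * exp (- c / t)"
    and wi: "set_integrable lborel {0<..} (\<lambda>t. complex_of_real (t powr (-b)) * w t)"
  shows "complex_of_real b * (LINT t:{0<..}|lborel. complex_of_real (t powr (-1 - b)) * v t)
     = - (LINT t:{0<..}|lborel. complex_of_real (t powr (-b)) * w t)"
    and "set_integrable lborel {0<..} (\<lambda>t. complex_of_real (t powr (-1 - b)) * v t)"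
proof -
  have C: "C \<ge> 0" using order_trans[OF norm_ge_zero vb[of 1]] by (simp add: zero_le_mult_iff)
  have vc: "continuous_on {0<..} v"
    using v by (intro continuous_at_imp_continuous_on) (auto intro: has_vector_derivative_continuous)
  have cp: "continuous_on {0<..} (\<lambda>t::real. complex_of_real (t powr e))" for e
    by (intro continuous_intros) auto
  show vi: "set_integrable lborel {0<..} (\<lambda>t. complex_of_real (t powr (-1 - b)) * v t)"
    unfolding set_integrable_def
  proof (rule Bochner_Integration.integrable_bound)
    show "integrable lborel (\<lambda>t. C * (indicator {0<..} t *\<^sub>R (t powr (-1 - b) * exp (- c / t))))"
      using set_integrable_powr_exp_inverse[OF assms(1,2)] unfolding set_integrable_def by (rule integrable_mult_right)
    show "(\<lambda>t. indicator {0<..} t *\<^sub>R (complex_of_real (t powr (-1 - b)) * v t)) \<in> borel_measurable lborel"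
      using borel_measurable_continuous_on_indicator[OF _ continuous_on_mult[OF cp vc]] by simp
    show "AE t in lborel. norm (indicator {0<..} t *\<^sub>R (complex_of_real (t powr (-1 - b)) * v t))
      \<le> norm (C * (indicator {0<..} t *\<^sub>R (t powr (-1 - b) * exp (- c / t))))"
    proof (rule AE_I2)
      fix t :: real
      show "norm (indicator {0<..} t *\<^sub>R (complex_of_real (t powr (-1 - b)) * v t))
        \<le> norm (C * (indicator {0<..} t *\<^sub>R (t powr (-1 - b) * exp (- c / t))))"
        using mult_left_mono[OF vb[of t], of "t powr (-1 - b)"] C by (cases "t > 0") (simp_all add: norm_mult abs_mult mult_ac)
    qed
  qed
  have arith: "x * y = - z" if "X = 0" "X = - x * y - z" for X x y z :: complex
  proof -
    have "- (x * y + z) = 0" using that by simp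
    then show ?thesis by (simp only: neg_equal_0_iff_equal eq_neg_iff_add_eq_0)
  qed
  let ?G = "\<lambda>t. complex_of_real (t powr (-b)) * v t"
  let ?g = "\<lambda>t. - complex_of_real b * (complex_of_real (t powr (-1 - b)) * v t) - complex_of_real (t powr (-b)) * w t"
  have ei: "einterval (ereal 0) \<infinity> = {0<..}" by (auto simp: einterval_def)
  have "(LBINT t=ereal 0..\<infinity>. ?g t) = 0 - 0"
  proof (rule interval_integral_FTC_integrable)
    fix t :: real assume "ereal 0 < ereal t"
    then have t: "t > 0" by simp
    have "((\<lambda>t. complex_of_real (t powr (-b))) has_vector_derivative complex_of_real (- b * t powr (-b - 1))) (at t)"
      using t by (intro has_vector_derivative_of_real) (auto intro!: derivative_eq_intros simp flip: has_real_derivative_iff_has_vector_derivative)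
    from has_vector_derivative_mult[OF this v[OF t]]
    show "(?G has_vector_derivative ?g t) (at t)"
      by (rule has_vector_derivative_eq_rhs) (simp add: algebra_simps minus_diff_commute)
    show "isCont ?g t"
    proof -
      have "continuous_on {0<..} ?g" by (intro continuous_intros cp vc w)
      then show ?thesis using t by (simp add: continuous_on_eq_continuous_at)
    qed
  next
    show "set_integrable lborel (einterval (ereal 0) \<infinity>) ?g"
      unfolding ei by (intro set_integral_diff set_integrable_mult_right vi wi)
    have "((\<lambda>t. C * (t powr (-b) * exp (- c / t))) \<longlongrightarrow> C * 0) (at_right (0::real))"
      using \<open>c > 0\<close> \<open>b > 0\<close> by (intro tendsto_mult_left) real_asymp
    then have "((\<lambda>t. C * (t powr (-b) * exp (- c / t))) \<longlongrightarrow> 0) (at_right (0::real))" by simp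
    then have "(?G \<longlongrightarrow> 0) (at_right 0)"
    proof (rule Lim_null_comparison[rotated])
      show "\<forall>\<^sub>F t in at_right 0. norm (?G t) \<le> C * (t powr (-b) * exp (- c / t))"
        using eventually_at_right_less[of 0]
        by eventually_elim (use mult_left_mono[OF vb, of _ "_ powr (-b)"] in \<open>simp add: norm_mult mult_ac\<close>)
    qed
    then show "((?G \<circ> real_of_ereal) \<longlongrightarrow> 0) (at_right (ereal 0))"
      by (simp only: ereal_tendsto_simps)
    have "((\<lambda>t. C * (t powr (-b) * exp (- c / t))) \<longlongrightarrow> C * 0) at_top"
      using \<open>c > 0\<close> \<open>b > 0\<close> by (intro tendsto_mult_left) real_asymp
    then have "((\<lambda>t. C * (t powr (-b) * exp (- c / t))) \<longlongrightarrow> 0) at_top" by simp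
    then have "(?G \<longlongrightarrow> 0) at_top"
    proof (rule Lim_null_comparison[rotated])
      show "\<forall>\<^sub>F t in at_top. norm (?G t) \<le> C * (t powr (-b) * exp (- c / t))"
        using eventually_gt_at_top[of 0]
        by eventually_elim (use mult_left_mono[OF vb, of _ "_ powr (-b)"] in \<open>simp add: norm_mult mult_ac\<close>)
    qed
    then show "((?G \<circ> real_of_ereal) \<longlongrightarrow> 0) (at_left \<infinity>)"
      by (simp only: ereal_tendsto_simps)
  qed simp
  then have "(LINT t:{0<..}|lborel. ?g t) = 0"
    by (simp add: interval_lebesgue_integral_def ei)
  moreover have "(LINT t:{0<..}|lborel. ?g t) = - complex_of_real b * (LINT t:{0<..}|lborel. complex_of_real (t powr (-1 - b)) * v t)
     - (LINT t:{0<..}|lborel. complex_of_real (t powr (-b)) * w t)"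
    by (subst set_integral_diff(2)[OF set_integrable_mult_right[OF vi] wi]) (simp only: set_integral_mult_right)
  ultimately show "complex_of_real b * (LINT t:{0<..}|lborel. complex_of_real (t powr (-1 - b)) * v t)
     = - (LINT t:{0<..}|lborel. complex_of_real (t powr (-b)) * w t)"
    by (rule arith)
qed

lemma norm_exp_partial_sum_le:
  fixes x :: "'a::{real_normed_algebra_1,banach}"
  shows "norm (\<Sum>j<N. x ^ j /\<^sub>R fact j) \<le> exp (norm x)"
proof -
  have "norm (\<Sum>j<N. x ^ j /\<^sub>R fact j) \<le> (\<Sum>j<N. norm x ^ j /\<^sub>R fact j)"
    by (rule order_trans[OF norm_sum]) (auto intro!: sum_mono mult_left_mono norm_power_ineq)
  also have "\<dots> \<le> suminf (\<lambda>j. norm x ^ j /\<^sub>R fact j)"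
    by (rule sum_le_suminf) (use exp_converges[of "norm x"] in \<open>auto simp: sums_iff\<close>)
  also have "\<dots> = exp (norm x)" using exp_converges[of "norm x"] by (simp add: sums_iff)
  finally show ?thesis .
qed

text \<open>
  By subordination, hypothesis 2 says that \<open>t\<^bsup>-a\<^esup>\<close> is orthogonal to every derivative of positive order of the heat
  evolution. Integrating by parts moves all derivatives onto the power; the factors \<open>a + l\<close> that
  appear do not vanish because \<open>a\<close> is positive.
\<close>

lemma integral_heat_negative_powers_eq_0:
  fixes F :: "'a::euclidean_space \<Rightarrow> complex"
  assumes a: "0 < a" "a < 1" and F: "has_moments F" and "\<epsilon> > 0"
    and 1: "\<And>i x. norm x < \<epsilon> \<Longrightarrow> fourier_integral (\<lambda>\<xi>. complex_of_real (norm \<xi> ^ (2 * i)) * F \<xi>) x = 0"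
    and 2: "\<And>i. (LINT \<xi>|lborel. complex_of_real (norm \<xi> powr (2 * (a + real i))) * F \<xi>) = 0"
  shows "set_integrable lborel {0<..} (\<lambda>t. complex_of_real (t powr (-1 - (a + real j))) * heat F t)"
    and "(LINT t:{0<..}|lborel. complex_of_real (t powr (-1 - (a + real j))) * heat F t) = 0"
proof -
  define Fi where "Fi i = (\<lambda>\<xi>. complex_of_real (norm \<xi> ^ (2 * i)) * F \<xi>)" for i
  have F0: "Fi 0 = F" by (simp add: Fi_def)
  have Fi: "has_moments (Fi i)" for i unfolding Fi_def by (rule has_moments_norm_power[OF F])
  have Fs: "(\<lambda>\<xi>. complex_of_real (norm \<xi> ^ 2) * Fi i \<xi>) = Fi (Suc i)" for i
    by (rule ext) (simp add: Fi_def power2_eq_square mult_ac)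
  have deriv: "(heat (Fi i) has_vector_derivative - heat (Fi (Suc i)) t) (at t)" if "t > 0" for i t
    using heat_has_vector_derivative[OF Fi that, of i] unfolding Fs .
  have cont: "continuous_on {0<..} (heat (Fi i))" for i
    using deriv by (intro continuous_at_imp_continuous_on) (auto intro: has_vector_derivative_continuous)
  have decay: "norm (heat (Fi i) t) \<le> sqrt 2 ^ DIM('a) * (LINT \<xi>|lborel. norm (Fi i \<xi>)) * exp (- (\<epsilon>\<^sup>2 / 8) / t)" if "t > 0" for i t
    by (rule heat_decay[OF has_moments_integrable[OF Fi] _ \<open>\<epsilon> > 0\<close> that]) (unfold Fi_def, rule 1)
  have c: "\<epsilon>\<^sup>2 / 8 > 0" using \<open>\<epsilon> > 0\<close> by simp
  note parts = integral_by_parts_powr[OF _ c deriv cont decay]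
  have P: "set_integrable lborel {0<..} (\<lambda>t. complex_of_real (t powr (- (a + real l))) * heat (Fi (Suc i)) t)
    \<and> (LINT t:{0<..}|lborel. complex_of_real (t powr (- (a + real l))) * heat (Fi (Suc i)) t) = 0" for l i
  proof (induction l arbitrary: i)
    case 0
    have "norm \<xi> powr (2 * a) * norm \<xi> ^ (2 * i) = norm \<xi> powr (2 * (a + real i))" for \<xi> :: 'a
    proof (cases "\<xi> = 0")
      case False
      then have "norm \<xi> ^ (2 * i) = norm \<xi> powr real (2 * i)" using powr_realpow[of "norm \<xi>" "2 * i"] by simp
      then show ?thesis by (simp add: distrib_left flip: powr_add)
    qed (use a in simp)
    then have "complex_of_real (norm \<xi> powr (2 * a)) * Fi i \<xi> = complex_of_real (norm \<xi> powr (2 * (a + real i))) * F \<xi>" for \<xi>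
      by (simp only: Fi_def mult.assoc[symmetric] of_real_mult[symmetric])
    then show ?case
      using integral_heat_powr[OF a Fi, of i] 2[of i] unfolding Fs by simp
  next
    case (Suc l)
    have b: "a + real l > 0" using a by simp
    have e: "- (a + real (Suc l)) = -1 - (a + real l)" by simp
    show ?case
      using parts[OF b, of "Suc i"] Suc.IH[of "Suc i"] b unfolding e by (auto simp del: of_real_add)
  qed
  have b: "a + real j > 0" using a by simp
  show "set_integrable lborel {0<..} (\<lambda>t. complex_of_real (t powr (-1 - (a + real j))) * heat F t)"
    "(LINT t:{0<..}|lborel. complex_of_real (t powr (-1 - (a + real j))) * heat F t) = 0"
    using parts[OF b, of 0] P[of j 0] b unfolding F0 by (auto simp del: of_real_add)
qed

section \<open>Unique continuation on the Fourier side\<close>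

text \<open>
  Up to a constant, \<open>|\<xi>|\<^sup>a K\<^sub>a (2 \<surd>z |\<xi>|)\<close> with a modified Bessel function, that is, the
  Fourier multiplier of the Caffarelli-Silvestre extension at height \<open>2 \<surd>z\<close>.
\<close>

definition heat_weight :: "real \<Rightarrow> real \<Rightarrow> 'a::euclidean_space \<Rightarrow> real" where
  "heat_weight a z \<xi> = (LINT t:{0<..}|lborel. t powr (-1 - a) * exp (- z / t) * exp (- t * (norm \<xi>)\<^sup>2))"

lemma heat_weight_measurable [measurable]: "heat_weight a z \<in> borel_measurable borel"
  unfolding heat_weight_def set_lebesgue_integral_def by measurable

lemma heat_weight_set_integrable:
  fixes \<xi> :: "'a::euclidean_space"
  assumes "a > 0" "z > 0"
  shows "set_integrable lborel {0<..} (\<lambda>t. t powr (-1 - a) * exp (- z / t) * exp (- t * (norm \<xi>)\<^sup>2))"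
  unfolding set_integrable_def
proof (rule Bochner_Integration.integrable_bound[OF set_integrable_powr_exp_inverse[OF assms, unfolded set_integrable_def] _ AE_I2])
  show "norm (indicator {0<..} t *\<^sub>R (t powr (-1 - a) * exp (- z / t) * exp (- t * (norm \<xi>)\<^sup>2)))
    \<le> norm (indicator {0<..} t *\<^sub>R (t powr (-1 - a) * exp (- z / t)))" for t :: real
    by (cases "t > 0") (auto simp: abs_mult intro!: mult_left_le)
qed measurable

lemma heat_weight_pos:
  fixes \<xi> :: "'a::euclidean_space"
  assumes "a > 0" "z > 0"
  shows "heat_weight a z \<xi> > 0"
proof (rule ccontr)
  let ?f = "\<lambda>t. indicator {0<..} t *\<^sub>R (t powr (-1 - a) * exp (- z / t) * exp (- t * (norm \<xi>)\<^sup>2))"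
  have i: "integrable lborel ?f" using heat_weight_set_integrable[OF assms] by (simp only: set_integrable_def)
  have nn: "AE t in lborel. 0 \<le> ?f t" by (intro AE_I2) (simp add: indicator_def)
  assume "\<not> heat_weight a z \<xi> > 0"
  then have "\<not> integral\<^sup>L lborel ?f > 0"
    by (simp only: heat_weight_def set_lebesgue_integral_def not_False_eq_True)
  then have "integral\<^sup>L lborel ?f = 0" using integral_nonneg_AE[OF nn] by linarith
  then have "AE t in lborel. ?f t = 0" using integral_nonneg_eq_0_iff_AE[OF i nn] by simp
  then have "AE t in lborel. t \<notin> {1..2::real}" by eventually_elim (auto simp: indicator_def)
  then have "{1..2::real} \<in> null_sets lborel" by (rule AE_iff_null_sets[THEN iffD2, rotated]) simp
  then show False by (simp add: null_sets_def)
qed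

text \<open>
  The arithmetic-geometric mean inequality gives \<open>z / (2 t) + t |\<xi>|\<^sup>2 \<ge> \<surd>(2 z) |\<xi>|\<close>; the other half of
  \<open>z / t\<close> keeps the integral finite.
\<close>

lemma heat_weight_decay:
  fixes \<xi> :: "'a::euclidean_space"
  assumes "a > 0" "z > 0"
  shows "heat_weight a z \<xi> \<le> (LINT t:{0<..}|lborel. t powr (-1 - a) * exp (- (z / 2) / t)) * exp (- sqrt (2 * z) * norm \<xi>)"
proof -
  let ?n = "norm \<xi>"
  have z2: "z / 2 > 0" using assms by simp
  note i = heat_weight_set_integrable[OF assms, of \<xi>]
  have "heat_weight a z \<xi> \<le> (LINT t:{0<..}|lborel. exp (- sqrt (2 * z) * ?n) * (t powr (-1 - a) * exp (- (z / 2) / t)))"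
    unfolding heat_weight_def
  proof (rule set_integral_mono[OF i])
    show "set_integrable lborel {0<..} (\<lambda>t. exp (- sqrt (2 * z) * ?n) * (t powr (-1 - a) * exp (- (z / 2) / t)))"
      by (rule set_integrable_mult_right) (use set_integrable_powr_exp_inverse[OF assms(1) z2] in simp)
    fix t :: real assume "t \<in> {0<..}"
    then have t: "t > 0" by simp
    have "2 * sqrt (z / (2 * t)) * (sqrt t * ?n) \<le> (sqrt (z / (2 * t)))\<^sup>2 + (sqrt t * ?n)\<^sup>2"
      by (rule sum_squares_bound)
    also have "\<dots> = z / (2 * t) + t * ?n\<^sup>2" using t assms by (simp add: power_mult_distrib)
    also have "2 * sqrt (z / (2 * t)) * (sqrt t * ?n) = sqrt (2 * z) * ?n"
    proof -
      have "2 * sqrt (z / (2 * t)) * sqrt t = sqrt (4 * (z / (2 * t)) * t)"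
        by (simp only: real_sqrt_mult real_sqrt_four)
      also have "4 * (z / (2 * t)) * t = 2 * z" using t by simp
      finally show ?thesis by (simp add: mult.assoc)
    qed
    finally have "sqrt (2 * z) * ?n \<le> z / (2 * t) + t * ?n\<^sup>2" .
    moreover have "- z / t = - (z / (2 * t)) + - (z / 2) / t" using t by (simp add: field_simps)
    ultimately have "- z / t + - t * ?n\<^sup>2 \<le> - sqrt (2 * z) * ?n + - (z / 2) / t" by simp
    then have "exp (- z / t) * exp (- t * ?n\<^sup>2) \<le> exp (- sqrt (2 * z) * ?n) * exp (- (z / 2) / t)"
      by (simp only: exp_add[symmetric] exp_le_cancel_iff)
    then have "t powr (-1 - a) * (exp (- z / t) * exp (- t * ?n\<^sup>2)) \<le> t powr (-1 - a) * (exp (- sqrt (2 * z) * ?n) * exp (- (z / 2) / t))"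
      by (rule mult_left_mono) simp
    then show "t powr (-1 - a) * exp (- z / t) * exp (- t * ?n\<^sup>2) \<le> exp (- sqrt (2 * z) * ?n) * (t powr (-1 - a) * exp (- (z / 2) / t))"
      by (simp only: mult_ac)
  qed
  then show ?thesis by (simp only: set_integral_mult_right mult.commute)
qed

text \<open>
  The powers \<open>t\<^bsup>-1-a-j\<^esup>\<close> are the terms of the exponential series of \<open>t\<^bsup>-1-a\<^esup> exp (- z / t)\<close>. The series
  may be integrated term by term against the heat evolution as long as \<open>z\<close> is smaller than the
  constant in the decay of the evolution.
\<close>

lemma integral_heat_weight_eq_0:
  fixes F :: "'a::euclidean_space \<Rightarrow> complex"
  assumes a: "0 < a" "a < 1" and F: "has_moments F" and "\<epsilon> > 0"
    and 1: "\<And>i x. norm x < \<epsilon> \<Longrightarrow> fourier_integral (\<lambda>\<xi>. complex_of_real (norm \<xi> ^ (2 * i)) * F \<xi>) x = 0"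
    and 2: "\<And>i. (LINT \<xi>|lborel. complex_of_real (norm \<xi> powr (2 * (a + real i))) * F \<xi>) = 0"
    and z: "0 < z" "z < \<epsilon>\<^sup>2 / 8"
  shows "(LINT \<xi>|lborel. complex_of_real (heat_weight a z \<xi>) * F \<xi>) = 0"
proof -
  note [measurable] = has_moments_measurable[OF F]
  note J = integral_heat_negative_powers_eq_0[OF a F \<open>\<epsilon> > 0\<close> 1 2]
  define g where "g j t = indicator {0<..} t *\<^sub>R (complex_of_real (t powr (-1 - (a + real j))) * heat F t)" for j and t :: real
  have gi: "integrable lborel (g j)" and g0: "integral\<^sup>L lborel (g j) = 0" for j
    using J[of j] by (simp_all add: g_def[abs_def] set_integrable_def set_lebesgue_integral_def)
  define S where "S N t = (\<Sum>j<N. complex_of_real ((- z) ^ j / fact j) * g j t)" for N t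
  have S: "S N t = indicator {0<..} t *\<^sub>R (complex_of_real (t powr (-1 - a)) * heat F t * complex_of_real (\<Sum>j<N. (- z / t) ^ j /\<^sub>R fact j))" for N t
  proof (cases "t > 0")
    case True
    have p: "t powr (-1 - (a + real j)) = t powr (-1 - a) / t ^ j" for j
      using True by (simp add: powr_diff[symmetric] diff_diff_eq flip: powr_realpow)
    have R: "t powr (-1 - a) * ((u / t) ^ j /\<^sub>R fact j) = u ^ j / fact j * t powr (-1 - (a + real j))" for u j
      unfolding p using True by (simp add: power_divide field_simps)
    have "S N t = (\<Sum>j<N. complex_of_real (t powr (-1 - a) * ((- z / t) ^ j /\<^sub>R fact j)) * heat F t)"
      unfolding S_def g_def R using True by (simp add: mult_ac)
    also have "\<dots> = complex_of_real (t powr (-1 - a)) * heat F t * complex_of_real (\<Sum>j<N. (- z / t) ^ j /\<^sub>R fact j)"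
      by (simp only: of_real_mult of_real_sum sum_distrib_left mult_ac)
    finally show ?thesis using True by simp
  qed (simp add: S_def g_def)
  have S0: "(LINT t|lborel. S N t) = 0" for N
    unfolding S_def by (subst Bochner_Integration.integral_sum) (simp_all add: gi g0)
  define B where "B = sqrt 2 ^ DIM('a) * (LINT \<xi>|lborel. norm (F \<xi>))"
  have decay: "norm (heat F t) \<le> B * exp (- (\<epsilon>\<^sup>2 / 8) / t)" if "t > 0" for t
    unfolding B_def by (rule heat_decay[OF has_moments_integrable[OF F] _ \<open>\<epsilon> > 0\<close> that]) (use 1[of _ 0] in simp)
  have "B \<ge> 0" using order_trans[OF norm_ge_zero decay[of 1]] by (simp add: zero_le_mult_iff)
  let ?L = "\<lambda>t. indicator {0<..} t *\<^sub>R (complex_of_real (t powr (-1 - a)) * heat F t * complex_of_real (exp (- z / t)))"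
  have "(\<lambda>N. LINT t|lborel. S N t) \<longlonglongrightarrow> (LINT t|lborel. ?L t)"
  proof (rule integral_dominated_convergence)
    have c: "\<epsilon>\<^sup>2 / 8 - z > 0" using z by simp
    show "integrable lborel (\<lambda>t. B * (indicator {0<..} t *\<^sub>R (t powr (-1 - a) * exp (- (\<epsilon>\<^sup>2 / 8 - z) / t))))"
      using set_integrable_powr_exp_inverse[OF a(1) c] unfolding set_integrable_def by (rule integrable_mult_right)
    show "AE t in lborel. norm (S N t) \<le> B * (indicator {0<..} t *\<^sub>R (t powr (-1 - a) * exp (- (\<epsilon>\<^sup>2 / 8 - z) / t)))" for N
    proof (rule AE_I2)
      fix t :: real
      show "norm (S N t) \<le> B * (indicator {0<..} t *\<^sub>R (t powr (-1 - a) * exp (- (\<epsilon>\<^sup>2 / 8 - z) / t)))"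
      proof (cases "t > 0")
        case True
        have n: "norm (- z / t) = z / t" using True z by simp
        have "\<bar>\<Sum>j<N. (- z / t) ^ j /\<^sub>R fact j\<bar> \<le> exp (z / t)"
          using norm_exp_partial_sum_le[of "- z / t" N] unfolding n by (simp only: real_norm_def)
        then have "norm (heat F t) * \<bar>\<Sum>j<N. (- z / t) ^ j /\<^sub>R fact j\<bar> \<le> B * exp (- (\<epsilon>\<^sup>2 / 8) / t) * exp (z / t)"
          using decay[OF True] \<open>B \<ge> 0\<close> by (intro mult_mono) auto
        also have "\<dots> = B * exp (- (\<epsilon>\<^sup>2 / 8 - z) / t)"
          by (simp add: diff_divide_distrib flip: exp_add)
        finally have "t powr (-1 - a) * (norm (heat F t) * \<bar>\<Sum>j<N. (- z / t) ^ j /\<^sub>R fact j\<bar>) \<le> t powr (-1 - a) * (B * exp (- (\<epsilon>\<^sup>2 / 8 - z) / t))"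
          by (rule mult_left_mono) simp
        moreover have "norm (S N t) = t powr (-1 - a) * (norm (heat F t) * \<bar>\<Sum>j<N. (- z / t) ^ j /\<^sub>R fact j\<bar>)"
          unfolding S norm_scaleR norm_mult norm_of_real using True by simp
        ultimately show ?thesis using True by (simp add: mult_ac)
      qed (simp add: S)
    qed
    show "AE t in lborel. (\<lambda>N. S N t) \<longlonglongrightarrow> ?L t"
    proof (rule AE_I2)
      fix t :: real
      have "(\<lambda>N. \<Sum>j<N. (- z / t) ^ j /\<^sub>R fact j) \<longlonglongrightarrow> exp (- z / t)"
        using exp_converges[of "- z / t"] unfolding sums_def .
      then show "(\<lambda>N. S N t) \<longlonglongrightarrow> ?L t" unfolding S
        by (intro tendsto_scaleR tendsto_const tendsto_mult_left tendsto_of_real)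
    qed
    show "?L \<in> borel_measurable lborel" by measurable
    show "(\<lambda>t. S N t) \<in> borel_measurable lborel" for N unfolding S by measurable
  qed
  then have L0: "(LINT t|lborel. ?L t) = 0" unfolding S0 by (simp add: LIMSEQ_const_iff)
  let ?k = "\<lambda>(t::real) \<xi>. complex_of_real (indicator {0<..} t *\<^sub>R (t powr (-1 - a) * exp (- z / t))) * (complex_of_real (exp (- t * (norm \<xi>)\<^sup>2)) * F \<xi>)"
  have "(LINT t|lborel. LINT \<xi>|lborel. ?k t \<xi>) = (LINT \<xi>|lborel. LINT t|lborel. ?k t \<xi>)"
  proof (rule Fubini_le_prod[where A="\<lambda>t. indicator {0<..} t *\<^sub>R (t powr (-1 - a) * exp (- z / t))" and B="\<lambda>\<xi>. norm (F \<xi>)"])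
    show "integrable lborel (\<lambda>t. indicator {0<..} t *\<^sub>R (t powr (-1 - a) * exp (- z / t)))"
      using set_integrable_powr_exp_inverse[OF a(1) z(1)] unfolding set_integrable_def .
    show "integrable lborel (\<lambda>\<xi>. norm (F \<xi>))" by (rule integrable_norm[OF has_moments_integrable[OF F]])
    show "norm (?k t \<xi>) \<le> indicator {0<..} t *\<^sub>R (t powr (-1 - a) * exp (- z / t)) * norm (F \<xi>)" for t \<xi>
      by (cases "t > 0") (auto simp: norm_mult intro!: mult_left_mono mult_left_le_one_le)
  qed measurable
  moreover have "(LINT \<xi>|lborel. ?k t \<xi>) = ?L t" for t
  proof -
    have "(LINT \<xi>|lborel. ?k t \<xi>) = complex_of_real (indicator {0<..} t *\<^sub>R (t powr (-1 - a) * exp (- z / t))) * heat F t"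
      by (simp only: integral_mult_right_zero heat_def)
    then show ?thesis by (simp add: scaleR_conv_of_real mult_ac)
  qed
  moreover have "(LINT t|lborel. ?k t \<xi>) = complex_of_real (heat_weight a z \<xi>) * F \<xi>" for \<xi>
  proof -
    have "?k t \<xi> = complex_of_real (indicator {0<..} t *\<^sub>R (t powr (-1 - a) * exp (- z / t) * exp (- t * (norm \<xi>)\<^sup>2))) * F \<xi>" for t
      by (simp add: mult_ac)
    then show ?thesis
      by (simp only: integral_mult_left_zero heat_weight_def set_lebesgue_integral_def integral_complex_of_real)
  qed
  ultimately show ?thesis using L0 by simp
qed

text \<open>
  The transform of an exponentially decaying function is real analytic, so vanishing moments
  propagate from \<open>0\<close> to all points. Concretely, \<open>x\<close> is reached in \<open>N\<close> steps of length at most \<open>\<mu>/2\<close>, and in each step the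
  exponential series converges under the integral.
\<close>

lemma fourier_integral_eq_0_if_moments_eq_0:
  fixes G :: "'a::euclidean_space \<Rightarrow> complex"
  assumes \<mu>: "\<mu> > 0" and Gm: "G \<in> borel_measurable borel"
    and G: "integrable lborel (\<lambda>\<xi>. complex_of_real (exp (\<mu> * norm \<xi>)) * G \<xi>)"
    and mom: "\<And>v k. (LINT \<xi>|lborel. complex_of_real ((v \<bullet> \<xi>) ^ k) * G \<xi>) = 0"
  shows "fourier_integral G x = 0"
proof -
  note [measurable] = Gm
  obtain N :: nat where N: "norm x / (\<mu> / 2) < real N" using reals_Archimedean2 by blast
  have "N > 0" using N \<mu> by (metis divide_nonneg_pos half_gt_zero norm_ge_zero not_less of_nat_0 of_nat_0_less_iff order_le_less_trans)
  \<comment> \<open>the increment of the \<open>N\<close> steps from \<open>0\<close> to \<open>x\<close>\<close>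
  define w where "w = (1 / real N) *\<^sub>R x"
  have w: "norm w \<le> \<mu> / 2" using N \<mu> \<open>N > 0\<close> by (simp add: w_def field_simps)
  have bound: "\<bar>w \<bullet> \<xi>\<bar> ^ k * exp \<bar>w \<bullet> \<xi>\<bar> \<le> fact k * exp (\<mu> * norm \<xi>)" for k and \<xi> :: 'a
  proof -
    have "\<bar>w \<bullet> \<xi>\<bar> \<le> \<mu> / 2 * norm \<xi>"
      using Cauchy_Schwarz_ineq2[of w \<xi>] mult_right_mono[OF w, of "norm \<xi>"] by simp
    then have "exp (\<bar>w \<bullet> \<xi>\<bar> + \<bar>w \<bullet> \<xi>\<bar>) \<le> exp (\<mu> * norm \<xi>)" by simp
    then have "fact k * exp \<bar>w \<bullet> \<xi>\<bar> * exp \<bar>w \<bullet> \<xi>\<bar> \<le> fact k * exp (\<mu> * norm \<xi>)"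
      unfolding exp_add mult.assoc by (rule mult_left_mono) simp
    moreover have "\<bar>w \<bullet> \<xi>\<bar> ^ k * exp \<bar>w \<bullet> \<xi>\<bar> \<le> fact k * exp \<bar>w \<bullet> \<xi>\<bar> * exp \<bar>w \<bullet> \<xi>\<bar>"
      by (intro mult_right_mono power_le_fact_exp) auto
    ultimately show ?thesis by (rule order_trans[rotated])
  qed
  have dom: "integrable lborel (\<lambda>\<xi>. fact k * norm (complex_of_real (exp (\<mu> * norm \<xi>)) * G \<xi>))" for k
    by (rule integrable_mult_right, rule integrable_norm, rule G)
  have int: "integrable lborel (\<lambda>\<xi>. complex_of_real ((w \<bullet> \<xi>) ^ k) * (cis (y \<bullet> \<xi>) * G \<xi>))" for k y
  proof (rule Bochner_Integration.integrable_bound[OF dom[of k] _ AE_I2])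
    fix \<xi> :: 'a
    have "\<bar>w \<bullet> \<xi>\<bar> ^ k * 1 \<le> \<bar>w \<bullet> \<xi>\<bar> ^ k * exp \<bar>w \<bullet> \<xi>\<bar>" by (intro mult_left_mono) auto
    with bound[of \<xi> k] have "\<bar>w \<bullet> \<xi>\<bar> ^ k * norm (G \<xi>) \<le> fact k * exp (\<mu> * norm \<xi>) * norm (G \<xi>)"
      by (intro mult_right_mono) auto
    then show "norm (complex_of_real ((w \<bullet> \<xi>) ^ k) * (cis (y \<bullet> \<xi>) * G \<xi>)) \<le> norm (fact k * norm (complex_of_real (exp (\<mu> * norm \<xi>)) * G \<xi>))"
      by (simp add: norm_mult norm_power power_abs mult.assoc)
  qed measurable
  have "(LINT \<xi>|lborel. complex_of_real ((w \<bullet> \<xi>) ^ k) * (cis ((real n *\<^sub>R w) \<bullet> \<xi>) * G \<xi>)) = 0" for n k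
  proof (induction n arbitrary: k)
    case 0
    show ?case using mom[of w k] by simp
  next
    case (Suc n)
    let ?y = "real n *\<^sub>R w"
    define S where "S M \<xi> = (\<Sum>m<M. (\<i> ^ m / fact m) * (complex_of_real ((w \<bullet> \<xi>) ^ (k + m)) * (cis (?y \<bullet> \<xi>) * G \<xi>)))" for M \<xi>
    have S: "S M \<xi> = complex_of_real ((w \<bullet> \<xi>) ^ k) * (cis (?y \<bullet> \<xi>) * G \<xi>) * (\<Sum>m<M. (\<i> * complex_of_real (w \<bullet> \<xi>)) ^ m /\<^sub>R fact m)" for M \<xi>
      unfolding S_def sum_distrib_left
      by (rule sum.cong) (simp_all add: power_add power_mult_distrib scaleR_conv_of_real divide_inverse mult_ac)
    have S0: "(LINT \<xi>|lborel. S M \<xi>) = 0" for M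
      unfolding S_def by (subst Bochner_Integration.integral_sum) (simp_all only: Suc.IH int integrable_mult_right integral_mult_right_zero mult_zero_right sum.neutral_const)
    have "(\<lambda>M. LINT \<xi>|lborel. S M \<xi>) \<longlonglongrightarrow> (LINT \<xi>|lborel. complex_of_real ((w \<bullet> \<xi>) ^ k) * (cis ((real (Suc n) *\<^sub>R w) \<bullet> \<xi>) * G \<xi>))"
    proof (rule integral_dominated_convergence[OF _ _ dom[of k]])
      show "AE \<xi> in lborel. norm (S M \<xi>) \<le> fact k * norm (complex_of_real (exp (\<mu> * norm \<xi>)) * G \<xi>)" for M
      proof (rule AE_I2)
        fix \<xi> :: 'a
        have "norm (\<Sum>m<M. (\<i> * complex_of_real (w \<bullet> \<xi>)) ^ m /\<^sub>R fact m) \<le> exp \<bar>w \<bullet> \<xi>\<bar>"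
          using norm_exp_partial_sum_le[of "\<i> * complex_of_real (w \<bullet> \<xi>)" M] by (simp add: norm_mult)
        then have "norm (S M \<xi>) \<le> \<bar>w \<bullet> \<xi>\<bar> ^ k * norm (G \<xi>) * exp \<bar>w \<bullet> \<xi>\<bar>"
          unfolding S norm_mult norm_cis norm_of_real mult_1_left power_abs by (intro mult_left_mono) auto
        also have "\<dots> \<le> fact k * exp (\<mu> * norm \<xi>) * norm (G \<xi>)"
          using mult_right_mono[OF bound[of \<xi> k] norm_ge_zero[of "G \<xi>"]] by (simp only: mult_ac)
        finally show "norm (S M \<xi>) \<le> fact k * norm (complex_of_real (exp (\<mu> * norm \<xi>)) * G \<xi>)"
          by (simp add: norm_mult mult.assoc)
      qed
      show "AE \<xi> in lborel. (\<lambda>M. S M \<xi>) \<longlonglongrightarrow> complex_of_real ((w \<bullet> \<xi>) ^ k) * (cis ((real (Suc n) *\<^sub>R w) \<bullet> \<xi>) * G \<xi>)"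
      proof (rule AE_I2)
        fix \<xi> :: 'a
        have "(\<lambda>M. \<Sum>m<M. (\<i> * complex_of_real (w \<bullet> \<xi>)) ^ m /\<^sub>R fact m) \<longlonglongrightarrow> cis (w \<bullet> \<xi>)"
          using exp_converges[of "\<i> * complex_of_real (w \<bullet> \<xi>)"] unfolding sums_def cis_conv_exp .
        then have "(\<lambda>M. S M \<xi>) \<longlonglongrightarrow> complex_of_real ((w \<bullet> \<xi>) ^ k) * (cis (?y \<bullet> \<xi>) * G \<xi>) * cis (w \<bullet> \<xi>)"
          unfolding S by (rule tendsto_mult_left)
        moreover have "cis ((real (Suc n) *\<^sub>R w) \<bullet> \<xi>) = cis (?y \<bullet> \<xi>) * cis (w \<bullet> \<xi>)"
          by (simp add: cis_mult algebra_simps)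
        ultimately show "(\<lambda>M. S M \<xi>) \<longlonglongrightarrow> complex_of_real ((w \<bullet> \<xi>) ^ k) * (cis ((real (Suc n) *\<^sub>R w) \<bullet> \<xi>) * G \<xi>)"
          by (simp only: mult_ac)
      qed
      show "(\<lambda>\<xi>. S M \<xi>) \<in> borel_measurable lborel" for M unfolding S by measurable
    qed measurable
    then show ?case unfolding S0 by (simp add: LIMSEQ_const_iff)
  qed
  from this[of 0 N] have "(LINT \<xi>|lborel. cis ((real N *\<^sub>R w) \<bullet> \<xi>) * G \<xi>) = 0" by simp
  moreover have "real N *\<^sub>R w = x" using \<open>N > 0\<close> by (simp add: w_def)
  ultimately show ?thesis by (simp add: inner_commute)
qed

text \<open>
  Unique continuation on the Fourier side. Hypothesis 1 says that the inverse transform \<open>g\<close> of \<open>F\<close> and all its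
  derivatives vanish near \<open>x0\<close>, hypothesis 2 that the derivatives of \<open>(-\<Delta>)\<^bsup>a+i\<^esup> g\<close> vanish at \<open>x0\<close>. The heat
  argument applies to \<open>F\<close> times the character of \<open>x0\<close> and a power of a linear form, so that \<open>heat_weight a z * F\<close> has
  vanishing moments at \<open>x0\<close>.
\<close>

lemma AE_eq_0_if_local_integrals_eq_0:
  fixes F :: "'a::euclidean_space \<Rightarrow> complex"
  assumes F: "has_moments F" and a: "0 < a" "a < 1" and \<epsilon>: "\<epsilon> > 0"
    and 1: "\<And>x v k i. norm (x - x0) < \<epsilon> \<Longrightarrow>
      (LINT \<xi>|lborel. complex_of_real (norm \<xi> ^ (2 * i)) * (complex_of_real ((v \<bullet> \<xi>) ^ k) * (cis (x \<bullet> \<xi>) * F \<xi>))) = 0"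
    and 2: "\<And>v k i. (LINT \<xi>|lborel. complex_of_real (norm \<xi> powr (2 * (a + real i))) * (complex_of_real ((v \<bullet> \<xi>) ^ k) * (cis (x0 \<bullet> \<xi>) * F \<xi>))) = 0"
  shows "AE \<xi> in lborel. F \<xi> = 0"
proof -
  note [measurable] = has_moments_measurable[OF F]
  \<comment> \<open>any positive number below \<open>\<epsilon>\<^sup>2/8\<close>, the decay constant of the heat evolution\<close>
  define z where "z = \<epsilon>\<^sup>2 / 16"
  have z: "0 < z" "z < \<epsilon>\<^sup>2 / 8" using \<epsilon> by (auto simp: z_def)
  define G where "G \<xi> = complex_of_real (heat_weight a z \<xi>) * (cis (x0 \<bullet> \<xi>) * F \<xi>)" for \<xi>
  have Gm: "G \<in> borel_measurable borel" unfolding G_def by measurable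
  have G0: "(LINT \<xi>|lborel. complex_of_real ((v \<bullet> \<xi>) ^ k) * G \<xi>) = 0" for v k
  proof -
    let ?F = "\<lambda>\<xi>. complex_of_real ((v \<bullet> \<xi>) ^ k) * (cis (x0 \<bullet> \<xi>) * F \<xi>)"
    have "(LINT \<xi>|lborel. complex_of_real (heat_weight a z \<xi>) * ?F \<xi>) = 0"
    proof (rule integral_heat_weight_eq_0[OF a _ \<epsilon> _ 2 z])
      show "has_moments ?F" by (intro has_moments_inner_power has_moments_cis F)
      fix i and x :: 'a assume x: "norm x < \<epsilon>"
      have eq: "cis (\<xi> \<bullet> x) * (complex_of_real (norm \<xi> ^ (2 * i)) * ?F \<xi>)
        = complex_of_real (norm \<xi> ^ (2 * i)) * (complex_of_real ((v \<bullet> \<xi>) ^ k) * (cis ((x0 + x) \<bullet> \<xi>) * F \<xi>))" for \<xi>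
        by (simp only: inner_add_left cis_mult[symmetric] inner_commute[of \<xi>] mult_ac)
      have "norm (x0 + x - x0) < \<epsilon>" using x by simp
      from 1[OF this] show "fourier_integral (\<lambda>\<xi>. complex_of_real (norm \<xi> ^ (2 * i)) * ?F \<xi>) x = 0"
        by (simp only: eq)
    qed
    then show ?thesis by (simp only: G_def mult_ac)
  qed
  define \<mu> where "\<mu> = sqrt (2 * z)"
  define K where "K = (LINT t:{0<..}|lborel. t powr (-1 - a) * exp (- (z / 2) / t))"
  have Gi: "integrable lborel (\<lambda>\<xi>. complex_of_real (exp (\<mu> * norm \<xi>)) * G \<xi>)"
  proof (rule Bochner_Integration.integrable_bound[OF integrable_mult_right[OF has_moments_integrable[OF F], of "complex_of_real K"] _ AE_I2])
    fix \<xi> :: 'a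
    have "exp (\<mu> * norm \<xi>) * heat_weight a z \<xi> \<le> exp (\<mu> * norm \<xi>) * (K * exp (- \<mu> * norm \<xi>))"
      using heat_weight_decay[OF a(1) z(1), of \<xi>] unfolding K_def \<mu>_def by (rule mult_left_mono) simp
    also have "\<dots> = K * (exp (\<mu> * norm \<xi>) * exp (- \<mu> * norm \<xi>))" by (simp only: mult_ac)
    also have "exp (\<mu> * norm \<xi>) * exp (- \<mu> * norm \<xi>) = 1" by (simp flip: exp_add)
    finally have "exp (\<mu> * norm \<xi>) * heat_weight a z \<xi> * norm (F \<xi>) \<le> \<bar>K\<bar> * norm (F \<xi>)"
      by (intro mult_right_mono) auto
    then show "norm (complex_of_real (exp (\<mu> * norm \<xi>)) * G \<xi>) \<le> norm (complex_of_real K * F \<xi>)"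
      using heat_weight_pos[OF a(1) z(1), of \<xi>] by (simp add: G_def norm_mult mult.assoc)
  qed (use Gm in measurable)
  have \<mu>: "\<mu> > 0" using z by (simp add: \<mu>_def)
  have "integrable lborel G"
  proof (rule Bochner_Integration.integrable_bound[OF Gi _ AE_I2])
    show "norm (G \<xi>) \<le> norm (complex_of_real (exp (\<mu> * norm \<xi>)) * G \<xi>)" for \<xi>
      using mult_right_mono[of 1 "exp (\<mu> * norm \<xi>)" "norm (G \<xi>)"] \<mu> by (simp add: norm_mult)
  qed (use Gm in measurable)
  then have "AE \<xi> in lborel. G \<xi> = 0"
    by (rule fourier_integral_injective) (rule fourier_integral_eq_0_if_moments_eq_0[OF \<mu> Gm Gi G0])
  then show ?thesis
  proof eventually_elim
    case (elim \<xi>)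
    then show ?case using heat_weight_pos[OF a(1) z(1), of \<xi>] by (auto simp: G_def cis_neq_zero)
  qed
qed

section \<open>Bump functions\<close>

text \<open>
  The building blocks of all derivatives of \<open>exp (- 1 / t)\<close>; the family is closed under
  differentiation.
\<close>

definition flat_exp :: "nat \<Rightarrow> real \<Rightarrow> real" where
  "flat_exp k t = (if t > 0 then exp (- 1 / t) / t ^ k else 0)"

lemma flat_exp_le: "\<bar>flat_exp k t\<bar> \<le> fact (k + 2) * t\<^sup>2"
proof (cases "t > 0")
  case True
  have "(1 / t) ^ (k + 2) \<le> fact (k + 2) * exp (1 / t)"
    using True by (intro power_le_fact_exp) simp
  then have "exp (- 1 / t) * (1 / t) ^ (k + 2) \<le> exp (- 1 / t) * (fact (k + 2) * exp (1 / t))"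
    by (rule mult_left_mono) simp
  also have "\<dots> = fact (k + 2) * (exp (- 1 / t) * exp (1 / t))" by (simp only: mult_ac)
  also have "exp (- 1 / t) * exp (1 / t) = 1" by (simp flip: exp_add)
  finally have "exp (- 1 / t) * (1 / t) ^ (k + 2) * t\<^sup>2 \<le> fact (k + 2) * 1 * t\<^sup>2"
    by (rule mult_right_mono) simp
  moreover have "exp (- 1 / t) * (1 / t) ^ (k + 2) * t\<^sup>2 = flat_exp k t"
    using True by (simp add: flat_exp_def power_add power_divide power2_eq_square)
  moreover have "flat_exp k t \<ge> 0" using True by (simp add: flat_exp_def)
  ultimately show ?thesis by simp
qed (simp add: flat_exp_def)

lemma flat_exp_has_real_derivative:
  "(flat_exp k has_real_derivative flat_exp (k + 2) t - real k * flat_exp (k + 1) t) (at t)"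
proof -
  consider "t > 0" | "t < 0" | "t = 0" by linarith
  then show ?thesis
  proof cases
    case 1
    have "((\<lambda>t. exp (- 1 / t) / t ^ k) has_real_derivative flat_exp (k + 2) t - real k * flat_exp (k + 1) t) (at t)"
    proof (cases k)
      case 0
      show ?thesis using 1 unfolding 0
        by (auto intro!: derivative_eq_intros simp: flat_exp_def power2_eq_square field_simps)
    next
      case (Suc m)
      have "((\<lambda>t. exp (- 1 / t) / t ^ k) has_real_derivative
         (exp (- 1 / t) * (1 / t\<^sup>2) * t ^ k - exp (- 1 / t) * (real k * t ^ (k - 1))) / (t ^ k * t ^ k)) (at t)"
        using 1 by (auto intro!: derivative_eq_intros simp: power2_eq_square)
      moreover have "(exp (- 1 / t) * (1 / t\<^sup>2) * t ^ k - exp (- 1 / t) * (real k * t ^ (k - 1))) / (t ^ k * t ^ k)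
         = flat_exp (k + 2) t - real k * flat_exp (k + 1) t"
        using 1 by (simp add: flat_exp_def Suc power_add power2_eq_square field_simps)
      ultimately show ?thesis by simp
    qed
    then show ?thesis
      by (rule has_field_derivative_transform_within_open[of _ _ _ "{0<..}"]) (use 1 in \<open>auto simp: flat_exp_def\<close>)
  next
    case 2
    have "((\<lambda>t::real. 0) has_real_derivative 0) (at t)" by simp
    then have "(flat_exp k has_real_derivative 0) (at t)"
      by (rule has_field_derivative_transform_within_open[of _ _ _ "{..<0}"]) (use 2 in \<open>auto simp: flat_exp_def\<close>)
    then show ?thesis using 2 by (simp add: flat_exp_def)
  next
    case 3
    have "(flat_exp k has_derivative (\<lambda>h. h * 0)) (at 0)"
    proof (rule has_derivativeI_sandwich[of 1])
      show "((\<lambda>y. fact (k + 2) * \<bar>y\<bar>) \<longlongrightarrow> 0) (at (0::real))" by (auto intro!: tendsto_eq_intros)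
      show "norm (flat_exp k y - flat_exp k 0 - (y - 0) * 0) / norm (y - 0) \<le> fact (k + 2) * \<bar>y\<bar>" if "y \<noteq> 0" for y
        using flat_exp_le[of k y] that by (simp add: flat_exp_def[of k 0] pos_divide_le_eq power2_eq_square mult.assoc)
    qed auto
    moreover have "(\<lambda>h. h * 0) = (*) (0::real)" by auto
    ultimately show ?thesis using 3 by (simp add: has_field_derivative_def flat_exp_def)
  qed
qed

definition bump :: "real \<Rightarrow> real ^ 'n::finite \<Rightarrow> real ^ 'n \<Rightarrow> complex" where
  "bump \<delta> y x = complex_of_real (flat_exp 0 (\<delta>\<^sup>2 - (norm (x - y))\<^sup>2))"

lemma bump_smooth:
  fixes y :: "real ^ 'n::finite"
  shows "smooth (bump \<delta> y)"
proof (rule smooth_coinduct)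
  let ?q = "\<lambda>x. \<delta>\<^sup>2 - (norm (x - y))\<^sup>2"
  let ?S = "{\<lambda>x. p x * complex_of_real (flat_exp k (?q x)) | p k. smooth p}"
  have q: "(?q has_derivative (\<lambda>h. - 2 * ((x - y) \<bullet> h))) (at x)" for x
    unfolding power2_norm_eq_inner by (auto intro!: derivative_eq_intros simp: inner_commute)
  have f: "((\<lambda>x. complex_of_real (flat_exp k (?q x))) has_derivative
     (\<lambda>h. complex_of_real ((flat_exp (k + 2) (?q x) - real k * flat_exp (k + 1) (?q x)) * (- 2 * ((x - y) \<bullet> h))))) (at x)" for k x
    by (rule has_derivative_of_real,
        rule has_derivative_compose[OF q flat_exp_has_real_derivative[unfolded has_field_derivative_def]])
  then have d: "(\<lambda>x. complex_of_real (flat_exp k (?q x))) differentiable at x" for k x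
    using differentiable_def by blast
  then show "\<phi> differentiable at x" if "\<phi> \<in> ?S" for \<phi> x
    using that by (auto intro!: differentiable_mult dest: smooth_differentiable)
  show "bump \<delta> y \<in> ?S"
    by (auto simp: bump_def[abs_def] intro!: exI[of _ "\<lambda>x. 1"] exI[of _ 0] smooth_const)
  fix \<phi> j assume "\<phi> \<in> ?S"
  then obtain p k where \<phi>: "\<phi> = (\<lambda>x. p x * complex_of_real (flat_exp k (?q x)))" and p: "smooth p" by auto
  let ?l = "\<lambda>x. complex_of_real (x $ j) + complex_of_real (- (y $ j))"
  have l: "smooth ?l" by (rule smooth_add[OF smooth_coord smooth_const])
  have "partial_deriv j \<phi> = (\<lambda>x. partial_deriv j p x * complex_of_real (flat_exp k (?q x))
      + ((- 2 * (?l x * p x)) * complex_of_real (flat_exp (k + 2) (?q x))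
      + (complex_of_real (2 * real k) * (?l x * p x)) * complex_of_real (flat_exp (k + 1) (?q x))))"
    unfolding \<phi>
    by (rule ext, subst partial_deriv_mult[OF smooth_differentiable[OF p] d], subst partial_deriv_eqI[OF f])
      (simp add: inner_axis algebra_simps)
  also have "\<dots> \<in> finite_sums ?S"
    by (intro finite_sums.add finite_sums.base CollectI exI conjI, rule refl, rule smooth_partial_deriv[OF p], rule refl,
        rule smooth_mult[OF smooth_const smooth_mult[OF l p]], rule refl, rule smooth_mult[OF smooth_const smooth_mult[OF l p]])
  finally show "partial_deriv j \<phi> \<in> finite_sums ?S" .
qed

lemma bump_test_function:
  assumes "cball y \<delta> \<subseteq> V" "\<delta> > 0"
  shows "bump \<delta> y \<in> test_functions V"
proof -
  have "{x. bump \<delta> y x \<noteq> 0} \<subseteq> cball y \<delta>"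
  proof
    fix x assume "x \<in> {x. bump \<delta> y x \<noteq> 0}"
    then have "(norm (x - y))\<^sup>2 < \<delta>\<^sup>2" by (simp add: bump_def flat_exp_def split: if_splits)
    then have "norm (x - y) < \<delta>" by (rule power2_less_imp_less) (use assms(2) in simp)
    then show "x \<in> cball y \<delta>" by (simp add: dist_norm norm_minus_commute)
  qed
  then have sub: "closure {x. bump \<delta> y x \<noteq> 0} \<subseteq> cball y \<delta>" by (rule closure_minimal) simp
  have "compact (cball y \<delta> \<inter> closure {x. bump \<delta> y x \<noteq> 0})" by (rule compact_Int_closed) auto
  with sub show ?thesis using assms(1) by (simp add: test_functions_def bump_smooth Int_absorb1)
qed

lemma inv_fourier_bump: "inv_fourier (bump \<delta> y) \<xi> = cis (y \<bullet> \<xi>) * inv_fourier (bump \<delta> 0) \<xi>"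
proof -
  let ?f = "\<lambda>x. cis (x \<bullet> \<xi>) * bump \<delta> y x"
  have m: "?f \<in> borel_measurable borel"
    using smooth_continuous[OF bump_smooth] by (intro borel_measurable_times borel_measurable_cis) (auto intro: borel_measurable_continuous_onI)
  have "fourier_integral (bump \<delta> y) \<xi> = (LINT x|lborel. ?f (x + y))"
    by (rule lborel_integral_translate[OF m, symmetric])
  also have "?f (x + y) = cis (y \<bullet> \<xi>) * (cis (x \<bullet> \<xi>) * bump \<delta> 0 x)" for x
    by (simp add: bump_def inner_add_left cis_mult[symmetric] mult_ac)
  then have "(LINT x|lborel. ?f (x + y)) = cis (y \<bullet> \<xi>) * fourier_integral (bump \<delta> 0) \<xi>"
    by (simp only: integral_mult_right_zero)
  finally show ?thesis by (simp add: inv_fourier_conv mult_ac)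
qed

text \<open>
  On the support of the bump the phase \<open>x \<bullet> \<xi>\<close> stays below \<open>1 < \<pi>/2\<close> in absolute value, hence the
  integrand has nonnegative real part.
  As \<open>\<delta>\<close> tends to \<open>0\<close>, all frequencies are covered.
\<close>

lemma inv_fourier_bump_neq_0:
  fixes \<xi> :: "real ^ 'n::finite"
  assumes \<delta>: "\<delta> > 0" and \<xi>: "\<delta> * norm \<xi> < 1"
  shows "inv_fourier (bump \<delta> 0) \<xi> \<noteq> 0"
proof
  assume "inv_fourier (bump \<delta> 0) \<xi> = 0"
  then have z: "fourier_integral (bump \<delta> 0) \<xi> = 0" by (simp add: inv_fourier_conv)
  have "bump \<delta> 0 \<in> test_functions (UNIV :: (real^'n) set)" by (rule bump_test_function) (use \<delta> in auto)
  then have I: "integrable lborel (\<lambda>x. cis (x \<bullet> \<xi>) * bump \<delta> 0 x)"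
    by (intro schwartz_integrable_cis test_functions_schwartz)
  then have i: "integrable lborel (\<lambda>x. Re (cis (x \<bullet> \<xi>) * bump \<delta> 0 x))" by (rule integrable_Re)
  have pos: "Re (cis (x \<bullet> \<xi>) * bump \<delta> 0 x) > 0" if x: "norm x < \<delta>" for x
  proof -
    have "\<bar>x \<bullet> \<xi>\<bar> \<le> norm x * norm \<xi>" by (rule Cauchy_Schwarz_ineq2)
    also have "\<dots> \<le> \<delta> * norm \<xi>" using x by (intro mult_right_mono) auto
    finally have "\<bar>x \<bullet> \<xi>\<bar> < pi / 2" using \<xi> pi_gt3 by linarith
    then have "cos (x \<bullet> \<xi>) > 0" by (intro cos_gt_zero_pi) auto
    moreover have "(norm x)\<^sup>2 < \<delta>\<^sup>2" using x by (intro power_strict_mono) auto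
    ultimately show ?thesis by (simp add: bump_def flat_exp_def)
  qed
  have "Re (cis (x \<bullet> \<xi>) * bump \<delta> 0 x) \<ge> 0" for x
  proof (cases "norm x < \<delta>")
    case False
    then have "(norm x)\<^sup>2 \<ge> \<delta>\<^sup>2" using \<delta> by (intro power_mono) auto
    then show ?thesis by (simp add: bump_def flat_exp_def)
  qed (use pos less_imp_le in blast)
  then have nn: "AE x in lborel. 0 \<le> Re (cis (x \<bullet> \<xi>) * bump \<delta> 0 x)" by simp
  have "(LINT x|lborel. Re (cis (x \<bullet> \<xi>) * bump \<delta> 0 x)) = 0"
    using integral_Re[OF I] z by simp
  then have "AE x in lborel. Re (cis (x \<bullet> \<xi>) * bump \<delta> 0 x) = 0"
    using integral_nonneg_eq_0_iff_AE[OF i nn] by simp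
  then have "AE x in lborel. x \<notin> ball (0::real^'n) \<delta>"
  proof eventually_elim
    case (elim x)
    then show ?case using pos[of x] by (auto simp: dist_norm)
  qed
  then have "ball (0::real^'n) \<delta> \<in> null_sets lborel" by (rule AE_iff_null_sets[THEN iffD2, rotated]) simp
  then have "ball (0::real^'n) \<delta> \<in> null_sets lebesgue" by (rule null_sets_completionI)
  then have "negligible (ball (0::real^'n) \<delta>)" by (simp add: negligible_iff_null_sets)
  then have "ball (0::real^'n) \<delta> = {}" using open_not_negligible[OF open_ball] by blast
  then show False using \<delta> by simp
qed

section \<open>Zero sets of polynomials\<close>

definition poly_fun :: "(('n \<Rightarrow>\<^sub>0 nat) \<Rightarrow>\<^sub>0 complex) \<Rightarrow> real ^ 'n::finite \<Rightarrow> complex" where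
  "poly_fun P \<xi> = (\<Sum>\<alpha>\<in>Poly_Mapping.keys P. Poly_Mapping.lookup P \<alpha> * complex_of_real (monomial \<alpha> \<xi>))"

text \<open>
  Positional notation with varying base: each new weight exceeds every sum that the earlier
  coordinates can produce.
\<close>

lemma exists_injective_weights:
  fixes J :: "'n set"
  assumes "finite J"
  shows "\<exists>d :: 'n \<Rightarrow> nat. (\<forall>j. d j \<ge> 1) \<and>
     inj_on (\<lambda>\<alpha>. \<Sum>j\<in>J. \<alpha> j * d j) {\<alpha>. \<forall>j. \<alpha> j \<le> M \<and> (j \<notin> J \<longrightarrow> \<alpha> j = 0)}"
  using assms
proof (induction J rule: finite_induct)
  case empty
  show ?case by (intro exI[of _ "\<lambda>_. 1"]) (auto simp: inj_on_def)
next
  case (insert i J)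
  then obtain d where d: "\<forall>j. d j \<ge> 1" and inj: "inj_on (\<lambda>\<alpha>. \<Sum>j\<in>J. \<alpha> j * d j) {\<alpha>. \<forall>j. \<alpha> j \<le> M \<and> (j \<notin> J \<longrightarrow> \<alpha> j = 0)}" by blast
  define D where "D = (\<Sum>j\<in>J. M * d j) + 1"
  define d' where "d' = d(i := D)"
  have split: "(\<Sum>j\<in>insert i J. \<alpha> j * d' j) = \<alpha> i * D + (\<Sum>j\<in>J. \<alpha> j * d j)" for \<alpha> :: "'n \<Rightarrow> nat"
    using insert.hyps by (simp add: d'_def) (intro sum.cong, auto)
  have lt: "(\<Sum>j\<in>J. \<alpha> j * d j) < D" if "\<forall>j. \<alpha> j \<le> M" for \<alpha> :: "'n \<Rightarrow> nat"
  proof -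
    have "(\<Sum>j\<in>J. \<alpha> j * d j) \<le> (\<Sum>j\<in>J. M * d j)" using that by (intro sum_mono mult_right_mono) auto
    then show ?thesis by (simp add: D_def)
  qed
  have "inj_on (\<lambda>\<alpha>. \<Sum>j\<in>insert i J. \<alpha> j * d' j) {\<alpha>. \<forall>j. \<alpha> j \<le> M \<and> (j \<notin> insert i J \<longrightarrow> \<alpha> j = 0)}"
  proof (rule inj_onI)
    fix \<alpha> \<beta> assume \<alpha>: "\<alpha> \<in> {\<alpha>. \<forall>j. \<alpha> j \<le> M \<and> (j \<notin> insert i J \<longrightarrow> \<alpha> j = 0)}"
      and \<beta>: "\<beta> \<in> {\<alpha>. \<forall>j. \<alpha> j \<le> M \<and> (j \<notin> insert i J \<longrightarrow> \<alpha> j = 0)}"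
      and eq: "(\<Sum>j\<in>insert i J. \<alpha> j * d' j) = (\<Sum>j\<in>insert i J. \<beta> j * d' j)"
    let ?a = "\<Sum>j\<in>J. \<alpha> j * d j" and ?b = "\<Sum>j\<in>J. \<beta> j * d j"
    have a: "?a < D" and b: "?b < D" using \<alpha> \<beta> by (auto intro!: lt)
    have e: "\<alpha> i * D + ?a = \<beta> i * D + ?b" using eq unfolding split .
    have i: "\<alpha> i = \<beta> i"
      using arg_cong[OF e, of "\<lambda>n. n div D"] a b by simp
    then have ab: "?a = ?b" using e by simp
    have "(\<Sum>j\<in>J. (\<alpha>(i := 0)) j * d j) = ?a" "(\<Sum>j\<in>J. (\<beta>(i := 0)) j * d j) = ?b"
      using insert.hyps by (auto intro!: sum.cong)
    then have "\<alpha>(i := 0) = \<beta>(i := 0)"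
      using \<alpha> \<beta> ab by (intro inj_onD[OF inj]) auto
    then show "\<alpha> = \<beta>" using i by (metis fun_upd_triv fun_upd_upd)
  qed
  then show ?case using d by (intro exI[of _ d']) (auto simp: d'_def D_def)
qed

lemma degree_lead_coeff_shifted_monomial:
  fixes x :: "'n::finite \<Rightarrow> complex" and d \<alpha> :: "'n \<Rightarrow> nat"
  assumes d: "\<And>j. d j \<ge> 1"
  defines "p \<equiv> (\<Prod>j\<in>UNIV. ([:x j:] + Polynomial.monom 1 (d j)) ^ \<alpha> j)"
  shows "degree p = (\<Sum>j\<in>UNIV. \<alpha> j * d j)" "lead_coeff p = 1"
proof -
  have q: "degree ([:x j:] + Polynomial.monom 1 (d j)) = d j" for j
    using d[of j] by (subst degree_add_eq_right) (auto simp: degree_monom_eq)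
  have l: "lead_coeff ([:x j:] + Polynomial.monom 1 (d j)) = 1" for j
    using d[of j] by (simp only: q) (simp add: coeff_pCons split: nat.split)
  have nz: "[:x j:] + Polynomial.monom 1 (d j) \<noteq> 0" for j
    using l[of j] leading_coeff_0_iff[of "[:x j:] + Polynomial.monom 1 (d j)"] by (metis zero_neq_one)
  show "lead_coeff p = 1"
    unfolding p_def lead_coeff_prod lead_coeff_power l by simp
  show "degree p = (\<Sum>j\<in>UNIV. \<alpha> j * d j)"
    unfolding p_def by (subst degree_prod_sum_eq) (use nz in \<open>auto simp: degree_power_eq q\<close>)
qed

text \<open>
  Along the curve \<open>t \<mapsto> x + (t\<^bsup>d j\<^esup>)\<^sub>j\<close> the monomials of \<open>P\<close> become monic polynomials in \<open>t\<close>, of pairwise distinct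
  degrees if the weights \<open>d\<close> separate the exponents. Therefore \<open>P\<close> has finitely many zeros on the
  curve, for every \<open>x\<close>. Averaging the zero set over translations along the
  curve shows that it is null.
\<close>

lemma poly_fun_AE_neq_0:
  fixes P :: "('n::finite \<Rightarrow>\<^sub>0 nat) \<Rightarrow>\<^sub>0 complex"
  assumes "P \<noteq> 0"
  shows "AE \<xi> in lborel. poly_fun P \<xi> \<noteq> 0"
proof -
  let ?K = "Poly_Mapping.keys P"
  have K: "finite ?K" "?K \<noteq> {}" using assms by auto
  define M where "M = Max (insert 0 ((\<lambda>(\<alpha>, j). Poly_Mapping.lookup \<alpha> j) ` (?K \<times> (UNIV :: 'n set))))"
  have M: "Poly_Mapping.lookup \<alpha> j \<le> M" if "\<alpha> \<in> ?K" for \<alpha> j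
    unfolding M_def using that by (intro Max_ge) (auto intro!: finite_imageI image_eqI[of _ _ "(\<alpha>, j)"])
  obtain d :: "'n \<Rightarrow> nat" where d: "\<And>j. d j \<ge> 1"
    and inj: "inj_on (\<lambda>\<alpha>. \<Sum>j\<in>UNIV. \<alpha> j * d j) {\<alpha>. \<forall>j. \<alpha> j \<le> M \<and> (j \<notin> UNIV \<longrightarrow> \<alpha> j = 0)}"
    using exists_injective_weights[of "UNIV :: 'n set" M] by auto
  define D where "D \<alpha> = (\<Sum>j\<in>UNIV. Poly_Mapping.lookup \<alpha> j * d j)" for \<alpha>
  have D_inj: "\<alpha> = \<beta>" if "\<alpha> \<in> ?K" "\<beta> \<in> ?K" "D \<alpha> = D \<beta>" for \<alpha> \<beta>
    using inj_onD[OF inj, of "Poly_Mapping.lookup \<alpha>" "Poly_Mapping.lookup \<beta>"] that M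
    by (simp add: D_def poly_mapping_eqI)
  define c where "c t = ((\<chi> j. t ^ d j) :: real ^ 'n)" for t :: real
  have fin: "finite {t. poly_fun P (x + c t) = 0}" for x
  proof -
    define q where "q \<alpha> = (\<Prod>j\<in>UNIV. ([:complex_of_real (x $ j):] + Polynomial.monom 1 (d j)) ^ Poly_Mapping.lookup \<alpha> j)" for \<alpha>
    have deg: "degree (q \<alpha>) = D \<alpha>" and lc: "lead_coeff (q \<alpha>) = 1" for \<alpha>
      unfolding q_def D_def by (rule degree_lead_coeff_shifted_monomial[OF d])+
    define Q where "Q = (\<Sum>\<alpha>\<in>?K. smult (Poly_Mapping.lookup P \<alpha>) (q \<alpha>))"
    have PQ: "poly_fun P (x + c t) = poly Q (complex_of_real t)" for t
      by (simp add: poly_fun_def Q_def q_def poly_sum poly_prod poly_monom monomial_def c_def)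
    \<comment> \<open>the monomial of top degree along the curve cannot be cancelled\<close>
    have "Max (D ` ?K) \<in> D ` ?K" using K by (intro Max_in) auto
    then obtain \<alpha> where \<alpha>: "\<alpha> \<in> ?K" and D\<alpha>: "Max (D ` ?K) = D \<alpha>" by (rule imageE)
    have max: "D \<beta> \<le> D \<alpha>" if "\<beta> \<in> ?K" for \<beta>
      unfolding D\<alpha>[symmetric] using that K(1) by (intro Max_ge) auto
    have "coeff Q (D \<alpha>) = (\<Sum>\<beta>\<in>?K. Poly_Mapping.lookup P \<beta> * coeff (q \<beta>) (D \<alpha>))"
      by (simp add: Q_def coeff_sum)
    also have "\<dots> = (\<Sum>\<beta>\<in>{\<alpha>}. Poly_Mapping.lookup P \<beta> * coeff (q \<beta>) (D \<alpha>))"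
    proof (rule sum.mono_neutral_right)
      show "\<forall>\<beta>\<in>?K - {\<alpha>}. Poly_Mapping.lookup P \<beta> * coeff (q \<beta>) (D \<alpha>) = 0"
      proof
        fix \<beta> assume \<beta>: "\<beta> \<in> ?K - {\<alpha>}"
        then have "D \<beta> < D \<alpha>" using max[of \<beta>] D_inj[of \<beta> \<alpha>] \<alpha> by force
        then show "Poly_Mapping.lookup P \<beta> * coeff (q \<beta>) (D \<alpha>) = 0" by (simp add: coeff_eq_0 deg)
      qed
    qed (use \<alpha> in auto)
    also have "\<dots> = Poly_Mapping.lookup P \<alpha>" using lc[of \<alpha>] by (simp add: deg)
    finally have "Q \<noteq> 0" using \<alpha> by (auto simp: in_keys_iff)
    then have "finite {z. poly Q z = 0}" by (rule poly_roots_finite)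
    then have "finite (complex_of_real -` {z. poly Q z = 0})"
      by (rule finite_vimageI) (simp add: inj_of_real)
    then show ?thesis by (simp add: PQ vimage_def)
  qed
  have [measurable]: "c \<in> borel_measurable borel"
    unfolding c_def by (intro borel_measurable_continuous_onI continuous_intros)
  have [measurable]: "poly_fun P \<in> borel_measurable borel"
    unfolding poly_fun_def monomial_def by (intro borel_measurable_continuous_onI continuous_intros)
  define Z where "Z = {\<xi>. poly_fun P \<xi> = 0}"
  have Z[measurable]: "Z \<in> sets borel" unfolding Z_def by measurable
  have "(\<integral>\<^sup>+x. \<integral>\<^sup>+t. indicator Z (x + c t) * indicator {0..1} t \<partial>lborel \<partial>lborel)
     = (\<integral>\<^sup>+t. \<integral>\<^sup>+x. indicator Z (x + c t) * indicator {0..1} t \<partial>lborel \<partial>lborel)"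
    by (rule lborel_pair.Fubini'[symmetric]) measurable
  also have "\<dots> = (\<integral>\<^sup>+t. emeasure lborel Z * indicator {0..1::real} t \<partial>lborel)"
  proof (rule nn_integral_cong)
    fix t
    have "(\<integral>\<^sup>+x. indicator Z (x + c t) \<partial>lborel) = (\<integral>\<^sup>+x. indicator Z x \<partial>distr lborel borel ((+) (c t)))"
      by (subst nn_integral_distr) (auto simp: add.commute)
    also have "\<dots> = emeasure lborel Z" by (simp add: lborel_distr_plus)
    finally show "(\<integral>\<^sup>+x. indicator Z (x + c t) * indicator {0..1} t \<partial>lborel) = emeasure lborel Z * indicator {0..1} t"
      by (simp add: nn_integral_multc)
  qed
  also have "\<dots> = emeasure lborel Z" by (simp add: nn_integral_cmult)
  finally have e: "emeasure lborel Z = (\<integral>\<^sup>+x. \<integral>\<^sup>+t. indicator Z (x + c t) * indicator {0..1} t \<partial>lborel \<partial>lborel)" ..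
  have "(\<integral>\<^sup>+t. indicator Z (x + c t) * indicator {0..1} t \<partial>lborel) = 0" for x
  proof -
    have "AE t in lborel. t \<notin> {t. poly_fun P (x + c t) = 0}"
      by (rule AE_not_in[OF finite_imp_null_set_lborel[OF fin]])
    then have "AE t in lborel. indicator Z (x + c t) * indicator {0..1} t = (0::ennreal)"
      by eventually_elim (simp add: Z_def)
    then show ?thesis by (subst nn_integral_0_iff_AE) auto
  qed
  then have "Z \<in> null_sets lborel" using e Z by (simp add: null_sets_def)
  from AE_not_in[OF this] show ?thesis by (simp add: Z_def)
qed

section \<open>From distributions to densities\<close>

lemma has_densityD:
  assumes "has_density u h" "\<psi> \<in> schwartz"
  shows "integrable lborel (\<lambda>\<xi>. h \<xi> * \<psi> \<xi>)" "u \<psi> = distr_of h \<psi>"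
  using assms by (auto simp: has_density_def)

lemma has_density_distr_fourier_schwartz:
  fixes f :: "'n::finite distr"
  assumes "has_density (distr_fourier f) h" "\<phi> \<in> schwartz"
  shows "integrable lborel (\<lambda>\<xi>. h \<xi> * inv_fourier \<phi> \<xi>)"
    and "f \<phi> = (LINT \<xi>|lborel. h \<xi> * inv_fourier \<phi> \<xi>)"
  using assms inv_fourier_schwartz[OF assms(2)] fourier_inv_fourier[OF assms(2)]
  by (auto simp: has_density_def distr_fourier_def distr_of_def)

text \<open>
  The weight \<open>(1 + |\<xi>|\<^sup>2)\<^bsup>r/2\<^esup>\<close> is invertible on Schwartz functions.
\<close>

lemma sobolev_imp_has_density:
  fixes f :: "'n::finite distr"
  assumes "f \<in> sobolev r"
  shows "\<exists>h. has_density (distr_fourier f) h"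
proof -
  let ?w = "\<lambda>a (\<xi>::real^'n). complex_of_real ((1 + (norm \<xi>)\<^sup>2) powr a)"
  obtain g where g: "has_density (distr_mult (?w (r / 2)) (distr_fourier f)) g"
    using assms unfolding sobolev_def by blast
  then have [measurable]: "g \<in> borel_measurable borel" by (simp add: has_density_def)
  have pos: "1 + (norm \<xi>)\<^sup>2 > 0" for \<xi> :: "real^'n" by (rule add_pos_nonneg) auto
  have w1: "?w a \<xi> * ?w (- a) \<xi> = 1" for a \<xi>
    using pos[of \<xi>] less_imp_neq[OF pos[of \<xi>]] by (simp add: powr_minus flip: of_real_mult)
  have "has_density (distr_fourier f) (\<lambda>\<xi>. ?w (- (r / 2)) \<xi> * g \<xi>)"
    unfolding has_density_def
  proof (intro conjI ballI)
    show "(\<lambda>\<xi>. ?w (- (r / 2)) \<xi> * g \<xi>) \<in> borel_measurable lborel" by measurable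
    fix \<phi> :: "real ^ 'n \<Rightarrow> complex" assume "\<phi> \<in> schwartz"
    then have \<phi>': "(\<lambda>\<xi>. ?w (- (r / 2)) \<xi> * \<phi> \<xi>) \<in> schwartz" by (rule schwartz_bracket_powr_mult)
    have e: "?w (r / 2) \<xi> * (?w (- (r / 2)) \<xi> * \<phi> \<xi>) = \<phi> \<xi>" for \<xi>
      unfolding mult.assoc[symmetric] w1 by simp
    have c: "?w (- (r / 2)) \<xi> * g \<xi> * \<phi> \<xi> = g \<xi> * (?w (- (r / 2)) \<xi> * \<phi> \<xi>)" for \<xi>
      by (simp only: mult_ac)
    show "integrable lborel (\<lambda>\<xi>. ?w (- (r / 2)) \<xi> * g \<xi> * \<phi> \<xi>)"
      unfolding c by (rule has_densityD(1)[OF g \<phi>'])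
    have "distr_mult (?w (r / 2)) (distr_fourier f) (\<lambda>\<xi>. ?w (- (r / 2)) \<xi> * \<phi> \<xi>) = distr_of g (\<lambda>\<xi>. ?w (- (r / 2)) \<xi> * \<phi> \<xi>)"
      by (rule has_densityD(2)[OF g \<phi>'])
    then show "distr_fourier f \<phi> = distr_of (\<lambda>\<xi>. ?w (- (r / 2)) \<xi> * g \<xi>) \<phi>"
      unfolding distr_mult_def distr_of_def e c .
  qed
  then show ?thesis by blast
qed

text \<open>
  The two signs, from duality and from the transform of a derivative, combine so that \<open>D\<^sub>j\<close> becomes
  multiplication by \<open>\<xi>\<^sub>j\<close>.
\<close>

lemma foldr_distr_D:
  fixes u :: "'n::finite distr"
  assumes u: "\<And>\<phi>. \<phi> \<in> schwartz \<Longrightarrow> u \<phi> = (LINT \<xi>|lborel. h \<xi> * inv_fourier \<phi> \<xi>)"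
    and "\<phi> \<in> schwartz"
  shows "foldr distr_D js u \<phi> = (LINT \<xi>|lborel. h \<xi> * (coord_prod js \<xi> * inv_fourier \<phi> \<xi>))"
  using assms(2)
proof (induction js arbitrary: \<phi>)
  case Nil
  then show ?case by (simp add: u)
next
  case (Cons j js)
  have p: "(\<lambda>x. - \<i> * partial_deriv j \<phi> x) \<in> schwartz"
    by (rule schwartz_cmult[OF schwartz_partial_deriv[OF Cons.prems]])
  have "inv_fourier (\<lambda>x. - \<i> * partial_deriv j \<phi> x) \<xi> = - (complex_of_real (\<xi> $ j) * inv_fourier \<phi> \<xi>)" for \<xi>
    unfolding inv_fourier_cmult inv_fourier_partial_deriv[OF Cons.prems] by (simp flip: mult.assoc)
  then have e: "h \<xi> * (coord_prod js \<xi> * inv_fourier (\<lambda>x. - \<i> * partial_deriv j \<phi> x) \<xi>)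
    = - (h \<xi> * (coord_prod (j # js) \<xi> * inv_fourier \<phi> \<xi>))" for \<xi>
    by (simp add: mult_ac)
  show ?case
    using Cons.IH[OF p] unfolding e by (simp add: distr_D_def)
qed

lemma distr_multi_D_conv_foldr: "distr_multi_D \<alpha> u = foldr distr_D (list_of_index \<alpha>) u"
  by (simp add: distr_multi_D_def list_of_index_def foldr_funpow_conv_foldr)

lemma schwartz_coord_prod_mult:
  "\<phi> \<in> schwartz \<Longrightarrow> (\<lambda>x. coord_prod ks x * \<phi> x) \<in> schwartz"
  by (induction ks) (auto simp: mult.assoc intro: schwartz_coord_mult)

lemma poly_fun_conv: "poly_fun P \<xi> = (\<Sum>\<alpha>\<in>Poly_Mapping.keys P. Poly_Mapping.lookup P \<alpha> * coord_prod (list_of_index \<alpha>) \<xi>)"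
  by (simp add: poly_fun_def monomial_conv_coord_prod)

lemma schwartz_poly_fun_mult:
  fixes \<phi> :: "real ^ 'n::finite \<Rightarrow> complex"
  assumes "\<phi> \<in> schwartz" shows "(\<lambda>\<xi>. poly_fun P \<xi> * \<phi> \<xi>) \<in> schwartz"
  unfolding poly_fun_conv sum_distrib_right mult.assoc
  by (intro schwartz_sum schwartz_cmult schwartz_coord_prod_mult assms) simp

lemma poly_D_conv_integral:
  fixes f :: "'n::finite distr"
  assumes h: "has_density (distr_fourier f) h" and \<phi>: "\<phi> \<in> schwartz"
  shows "poly_D P f \<phi> = (LINT \<xi>|lborel. h \<xi> * (poly_fun P \<xi> * inv_fourier \<phi> \<xi>))"
proof -
  let ?c = "\<lambda>\<alpha> \<xi>. coord_prod (list_of_index \<alpha>) \<xi> * inv_fourier \<phi> \<xi>"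
  have i: "integrable lborel (\<lambda>\<xi>. h \<xi> * ?c \<alpha> \<xi>)" for \<alpha>
    by (rule has_densityD(1)[OF h schwartz_coord_prod_mult[OF inv_fourier_schwartz[OF \<phi>]]])
  have "poly_D P f \<phi> = (\<Sum>\<alpha>\<in>Poly_Mapping.keys P. Poly_Mapping.lookup P \<alpha> * (LINT \<xi>|lborel. h \<xi> * ?c \<alpha> \<xi>))"
    unfolding poly_D_def distr_multi_D_conv_foldr
    by (simp add: foldr_distr_D[OF has_density_distr_fourier_schwartz(2)[OF h] \<phi>])
  also have "\<dots> = (LINT \<xi>|lborel. (\<Sum>\<alpha>\<in>Poly_Mapping.keys P. Poly_Mapping.lookup P \<alpha> * (h \<xi> * ?c \<alpha> \<xi>)))"
    unfolding integral_mult_right_zero[symmetric]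
    by (rule Bochner_Integration.integral_sum[symmetric]) (rule integrable_mult_right[OF i])
  also have "\<dots> = (LINT \<xi>|lborel. h \<xi> * (poly_fun P \<xi> * inv_fourier \<phi> \<xi>))"
    by (simp only: poly_fun_conv sum_distrib_left sum_distrib_right mult_ac)
  finally show ?thesis .
qed

text \<open>
  Multipliers that act on \<open>C\<^sub>c\<^sup>\<infinity>(V)\<close> through the Fourier transform. All polynomials
  belong to this class, since they are the symbols of differential operators.
\<close>

definition local_symbols :: "(real ^ 'n::finite) set \<Rightarrow> (real ^ 'n \<Rightarrow> complex) set" where
  "local_symbols V = {Q. \<forall>\<phi>\<in>test_functions V. \<exists>\<psi>\<in>test_functions V. \<forall>\<xi>. inv_fourier \<psi> \<xi> = Q \<xi> * inv_fourier \<phi> \<xi>}"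

lemma local_symbols_const: "(\<lambda>\<xi>. c) \<in> local_symbols V"
  unfolding local_symbols_def by (auto intro!: bexI[OF _ test_functions_cmult] simp: inv_fourier_cmult)

lemma local_symbols_mult:
  assumes "P \<in> local_symbols V" "Q \<in> local_symbols V"
  shows "(\<lambda>\<xi>. P \<xi> * Q \<xi>) \<in> local_symbols V"
  unfolding local_symbols_def
proof (rule CollectI, rule ballI)
  fix \<phi> assume "\<phi> \<in> test_functions V"
  then obtain \<psi> where \<psi>: "\<psi> \<in> test_functions V" "\<And>\<xi>. inv_fourier \<psi> \<xi> = Q \<xi> * inv_fourier \<phi> \<xi>"
    using assms(2) unfolding local_symbols_def by blast
  then obtain \<theta> where "\<theta> \<in> test_functions V" "\<And>\<xi>. inv_fourier \<theta> \<xi> = P \<xi> * inv_fourier \<psi> \<xi>"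
    using assms(1) unfolding local_symbols_def by blast
  then show "\<exists>\<theta>\<in>test_functions V. \<forall>\<xi>. inv_fourier \<theta> \<xi> = P \<xi> * Q \<xi> * inv_fourier \<phi> \<xi>"
    by (auto simp: \<psi> mult.assoc)
qed

lemma local_symbols_add:
  assumes "P \<in> local_symbols V" "Q \<in> local_symbols V"
  shows "(\<lambda>\<xi>. P \<xi> + Q \<xi>) \<in> local_symbols V"
  unfolding local_symbols_def
proof (rule CollectI, rule ballI)
  fix \<phi> assume \<phi>: "\<phi> \<in> test_functions V"
  obtain \<psi> where \<psi>: "\<psi> \<in> test_functions V" "\<And>\<xi>. inv_fourier \<psi> \<xi> = P \<xi> * inv_fourier \<phi> \<xi>"
    using assms(1) \<phi> unfolding local_symbols_def by blast
  obtain \<theta> where \<theta>: "\<theta> \<in> test_functions V" "\<And>\<xi>. inv_fourier \<theta> \<xi> = Q \<xi> * inv_fourier \<phi> \<xi>"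
    using assms(2) \<phi> unfolding local_symbols_def by blast
  show "\<exists>\<eta>\<in>test_functions V. \<forall>\<xi>. inv_fourier \<eta> \<xi> = (P \<xi> + Q \<xi>) * inv_fourier \<phi> \<xi>"
    by (rule bexI[OF _ test_functions_add[OF \<psi>(1) \<theta>(1)]])
      (simp add: inv_fourier_add[OF test_functions_schwartz[OF \<psi>(1)] test_functions_schwartz[OF \<theta>(1)]] \<psi> \<theta> distrib_right)
qed

lemma local_symbols_coord: "(\<lambda>\<xi>. complex_of_real (\<xi> $ j)) \<in> local_symbols V"
  unfolding local_symbols_def
proof (rule CollectI, rule ballI)
  fix \<phi> assume \<phi>: "\<phi> \<in> test_functions V"
  show "\<exists>\<psi>\<in>test_functions V. \<forall>\<xi>. inv_fourier \<psi> \<xi> = complex_of_real (\<xi> $ j) * inv_fourier \<phi> \<xi>"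
    by (rule bexI[OF _ test_functions_cmult[OF test_functions_partial_deriv[OF \<phi>, of j], of \<i>]])
      (simp add: inv_fourier_cmult inv_fourier_partial_deriv[OF test_functions_schwartz[OF \<phi>]] mult.assoc)
qed

lemma local_symbols_sum:
  "finite A \<Longrightarrow> (\<And>i. i \<in> A \<Longrightarrow> P i \<in> local_symbols V) \<Longrightarrow> (\<lambda>\<xi>. \<Sum>i\<in>A. P i \<xi>) \<in> local_symbols V"
  by (induction A rule: finite_induct) (auto intro: local_symbols_const local_symbols_add)

lemma local_symbols_power: "P \<in> local_symbols V \<Longrightarrow> (\<lambda>\<xi>. P \<xi> ^ k) \<in> local_symbols V"
  by (induction k) (auto intro: local_symbols_const local_symbols_mult)

lemma local_symbols_inner: "(\<lambda>\<xi>. complex_of_real (v \<bullet> \<xi>)) \<in> local_symbols V"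
  unfolding inner_vec_def by (auto intro!: local_symbols_sum local_symbols_mult local_symbols_const local_symbols_coord)

lemma local_symbols_norm: "(\<lambda>\<xi>. complex_of_real (norm \<xi> ^ (2 * k))) \<in> local_symbols V"
proof -
  have "(\<lambda>\<xi>. (\<Sum>j\<in>UNIV. complex_of_real (\<xi> $ j) ^ 2) ^ k) \<in> local_symbols V"
    by (intro local_symbols_power local_symbols_sum local_symbols_coord) simp
  then show ?thesis by (simp add: power_mult norm_power2_vec)
qed

lemma local_symbols_poly_fun: "poly_fun P \<in> local_symbols V"
proof -
  have "coord_prod ks \<in> local_symbols V" for ks
  proof (induction ks)
    case (Cons k ks)
    have "coord_prod (k # ks) = (\<lambda>\<xi>. complex_of_real (\<xi> $ k) * coord_prod ks \<xi>)" by (rule ext) simp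
    then show ?case using local_symbols_mult[OF local_symbols_coord Cons] by simp
  qed (simp add: local_symbols_const)
  then have "(\<lambda>\<xi>. \<Sum>\<alpha>\<in>Poly_Mapping.keys P. Poly_Mapping.lookup P \<alpha> * coord_prod (list_of_index \<alpha>) \<xi>) \<in> local_symbols V"
    by (intro local_symbols_sum local_symbols_mult local_symbols_const) simp_all
  then show ?thesis by (simp add: poly_fun_conv[abs_def])
qed

text \<open>
  A density that is integrable against each Schwartz function may be multiplied by polynomial
  weights, which the Schwartz factor absorbs.
\<close>

lemma has_moments_density_mult_schwartz:
  fixes h :: "real ^ 'n::finite \<Rightarrow> complex"
  assumes h: "h \<in> borel_measurable borel" "\<And>\<phi>. \<phi> \<in> schwartz \<Longrightarrow> integrable lborel (\<lambda>\<xi>. h \<xi> * \<phi> \<xi>)"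
    and \<phi>: "\<phi> \<in> schwartz"
  shows "has_moments (\<lambda>\<xi>. h \<xi> * \<phi> \<xi>)"
  unfolding has_moments_def
proof (intro conjI allI)
  note [measurable] = h(1) schwartz_measurable[OF \<phi>]
  show "(\<lambda>\<xi>. h \<xi> * \<phi> \<xi>) \<in> borel_measurable borel" by measurable
  fix N
  have "integrable lborel (\<lambda>\<xi>. h \<xi> * (complex_of_real ((1 + (norm \<xi>)\<^sup>2) ^ N) * \<phi> \<xi>))"
    by (rule h(2)[OF schwartz_norm_power2_mult[OF \<phi>]])
  then have I: "integrable lborel (\<lambda>\<xi>. complex_of_real (2 ^ N) * (h \<xi> * (complex_of_real ((1 + (norm \<xi>)\<^sup>2) ^ N) * \<phi> \<xi>)))"
    by (rule integrable_mult_right)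
  show "integrable lborel (\<lambda>\<xi>. complex_of_real ((1 + norm \<xi>) ^ N) * (h \<xi> * \<phi> \<xi>))"
  proof (rule Bochner_Integration.integrable_bound[OF I _ AE_I2])
    fix \<xi> :: "real ^ 'n"
    have arith: "1 + n \<le> 2 * (1 + n\<^sup>2)" for n :: real
    proof -
      have "1 + n \<le> 2 * (1 + X)" if "2 * n \<le> X + 1" "0 \<le> X" for X using that by simp
      from this[of "n\<^sup>2"] show ?thesis using sum_squares_bound[of n 1] by simp
    qed
    have "(1 + norm \<xi>) ^ N \<le> (2 * (1 + (norm \<xi>)\<^sup>2)) ^ N"
      by (rule power_mono[OF arith]) simp
    then have "(1 + norm \<xi>) ^ N * norm (h \<xi> * \<phi> \<xi>) \<le> 2 ^ N * (1 + (norm \<xi>)\<^sup>2) ^ N * norm (h \<xi> * \<phi> \<xi>)"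
      unfolding power_mult_distrib by (rule mult_right_mono) simp
    moreover have "\<bar>(1 + norm \<xi>) ^ N\<bar> = (1 + norm \<xi>) ^ N" "\<bar>(1 + (norm \<xi>)\<^sup>2) ^ N\<bar> = (1 + (norm \<xi>)\<^sup>2) ^ N" "\<bar>2 ^ N\<bar> = (2 ^ N :: real)"
      by (simp_all add: abs_of_nonneg)
    ultimately show "norm (complex_of_real ((1 + norm \<xi>) ^ N) * (h \<xi> * \<phi> \<xi>))
      \<le> norm (complex_of_real (2 ^ N) * (h \<xi> * (complex_of_real ((1 + (norm \<xi>)\<^sup>2) ^ N) * \<phi> \<xi>)))"
      unfolding norm_mult norm_of_real by (simp only: mult_ac)
  qed measurable
qed

section \<open>Unique continuation for admissible distributions\<close>

text \<open>
  The main argument for a distribution \<open>f\<close> whose Fourier transform has a density \<open>h\<close>. On the Fourier side both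
  hypotheses are integrals of \<open>h\<close> against transforms of test functions; for translates of a small bump
  they become the vanishing integrals required of \<open>F = P h\<close> times the transform of the bump.
\<close>

lemma fractional_unique_continuation:
  fixes V :: "(real ^ 'n::finite) set" and f :: "'n distr"
  assumes V: "open V" "V \<noteq> {}"
    and dens: "\<exists>h. has_density (distr_fourier f) h"
    and P: "P \<noteq> 0" "vanishes_on (poly_D P f) V"
    and s: "s \<notin> \<int>" "vanishes_on (frac_laplacian s f) V"
    and \<phi>: "\<phi> \<in> schwartz"
  shows "f \<phi> = 0"
proof -
  define h where "h = (SOME h. has_density (distr_fourier f) h)"
  have h: "has_density (distr_fourier f) h" unfolding h_def by (rule someI_ex[OF dens])
  then have [measurable]: "h \<in> borel_measurable borel" by (simp add: has_density_def)
  have hi: "integrable lborel (\<lambda>\<xi>. h \<xi> * \<phi> \<xi>)" if "\<phi> \<in> schwartz" for \<phi>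
    using h that unfolding has_density_def by blast
  let ?p = "poly_fun P"
  have A: "(LINT \<xi>|lborel. h \<xi> * (?p \<xi> * (Q \<xi> * inv_fourier \<phi> \<xi>))) = 0"
    if \<phi>: "\<phi> \<in> test_functions V" and Q: "Q \<in> local_symbols V" for \<phi> Q
  proof -
    obtain \<psi> where \<psi>: "\<psi> \<in> test_functions V" "\<And>\<xi>. inv_fourier \<psi> \<xi> = Q \<xi> * inv_fourier \<phi> \<xi>"
      using \<phi> Q unfolding local_symbols_def by blast
    have "poly_D P f \<psi> = 0" using P(2) \<psi>(1) unfolding vanishes_on_def by blast
    then show ?thesis unfolding poly_D_conv_integral[OF h test_functions_schwartz[OF \<psi>(1)]] \<psi>(2) .
  qed
  have B: "(LINT \<xi>|lborel. complex_of_real (norm \<xi> powr (2 * s)) * h \<xi> * (Q \<xi> * inv_fourier \<phi> \<xi>)) = 0"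
    if \<phi>: "\<phi> \<in> test_functions V" and Q: "Q \<in> local_symbols V" for \<phi> Q
  proof -
    obtain \<psi> where \<psi>: "\<psi> \<in> test_functions V" "\<And>\<xi>. inv_fourier \<psi> \<xi> = Q \<xi> * inv_fourier \<phi> \<xi>"
      using \<phi> Q unfolding local_symbols_def by blast
    have "frac_laplacian s f \<psi> = 0" using s(2) \<psi>(1) unfolding vanishes_on_def by blast
    then show ?thesis unfolding frac_laplacian_def Let_def h_def[symmetric] distr_inv_fourier_def distr_of_def \<psi>(2) .
  qed
  obtain x0 where "x0 \<in> V" using V(2) by blast
  then obtain r where r: "r > 0" "cball x0 r \<subseteq> V" using V(1) open_contains_cball by blast
  define a where "a = frac s"
  have a: "0 < a" "a < 1" using s(1) by (auto simp: a_def frac_gt_0_iff frac_lt_1)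
  \<comment> \<open>the factor \<open>|\<xi>|\<^bsup>2M\<^esup>\<close> raises the exponents \<open>a + i\<close>, which for positive \<open>s\<close> may be smaller than \<open>s\<close>\<close>
  define M where "M = nat \<lfloor>s\<rfloor>"
  have key: "AE \<xi> in lborel. complex_of_real (norm \<xi> ^ (2 * M)) * (h \<xi> * (?p \<xi> * inv_fourier (bump \<delta> 0) \<xi>)) = 0"
    if \<delta>: "0 < \<delta>" "\<delta> \<le> r / 2" for \<delta>
  proof (rule AE_eq_0_if_local_integrals_eq_0[OF _ a])
    have bV: "bump \<delta> x \<in> test_functions V" if "norm (x - x0) < r / 2" for x
    proof (rule bump_test_function[OF _ \<delta>(1)])
      have "cball x \<delta> \<subseteq> cball x0 r"
      proof
        fix y assume "y \<in> cball x \<delta>"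
        then show "y \<in> cball x0 r"
          using that \<delta>(2) dist_triangle[of x0 y x] by (simp add: dist_norm norm_minus_commute)
      qed
      then show "cball x \<delta> \<subseteq> V" using r(2) by blast
    qed
    have b0: "inv_fourier (bump \<delta> 0) \<in> schwartz"
    proof (rule inv_fourier_schwartz, rule test_functions_schwartz[of _ UNIV], rule bump_test_function)
    qed (use \<delta> in auto)
    show "has_moments (\<lambda>\<xi>. complex_of_real (norm \<xi> ^ (2 * M)) * (h \<xi> * (?p \<xi> * inv_fourier (bump \<delta> 0) \<xi>)))"
      by (rule has_moments_norm_power[OF has_moments_density_mult_schwartz[OF _ hi schwartz_poly_fun_mult[OF b0]]]) measurable
    show "0 < r / 2" using r by simp
    fix x :: "real ^ 'n" and v :: "real ^ 'n" and k i :: nat assume x: "norm (x - x0) < r / 2"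
    have eq: "complex_of_real (norm \<xi> ^ (2 * i)) * (complex_of_real ((v \<bullet> \<xi>) ^ k) * (cis (x \<bullet> \<xi>) * (complex_of_real (norm \<xi> ^ (2 * M)) * (h \<xi> * (?p \<xi> * inv_fourier (bump \<delta> 0) \<xi>)))))
      = h \<xi> * (?p \<xi> * ((complex_of_real (norm \<xi> ^ (2 * i)) * (complex_of_real (v \<bullet> \<xi>) ^ k * complex_of_real (norm \<xi> ^ (2 * M)))) * inv_fourier (bump \<delta> x) \<xi>))" for \<xi>
      unfolding inv_fourier_bump[of \<delta> x] by (simp only: mult_ac of_real_power)
    show "(LINT \<xi>|lborel. complex_of_real (norm \<xi> ^ (2 * i)) * (complex_of_real ((v \<bullet> \<xi>) ^ k) * (cis (x \<bullet> \<xi>) * (complex_of_real (norm \<xi> ^ (2 * M)) * (h \<xi> * (?p \<xi> * inv_fourier (bump \<delta> 0) \<xi>)))))) = 0"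
      unfolding eq
      by (rule A[OF bV[OF x] local_symbols_mult[OF local_symbols_norm local_symbols_mult[OF local_symbols_power[OF local_symbols_inner] local_symbols_norm]]])
  next
    fix v :: "real ^ 'n" and k i :: nat
    have "bump \<delta> x0 \<in> test_functions V"
      by (rule bump_test_function[OF subset_trans[OF subset_cball r(2)] \<delta>(1)]) (use \<delta> r in simp)
    note B0 = B[OF this local_symbols_mult[OF local_symbols_norm local_symbols_mult[OF local_symbols_power[OF local_symbols_inner] local_symbols_poly_fun]]]
    \<comment> \<open>\<open>a + i + M\<close> and \<open>s\<close> differ by a nonnegative integer, and even powers of \<open>|\<xi>|\<close> are polynomials\<close>
    define K where "K = nat (int i + int M - \<lfloor>s\<rfloor>)"
    have "\<lfloor>s\<rfloor> \<le> int M" by (simp add: M_def int_nat_eq)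
    then have "int i + int M - \<lfloor>s\<rfloor> \<ge> 0" by simp
    then have "int K = int i + int M - \<lfloor>s\<rfloor>" by (simp add: K_def)
    then have "real K = real i + real M - real_of_int \<lfloor>s\<rfloor>"
      by (metis of_int_add of_int_diff of_int_of_nat_eq)
    then have K: "2 * (a + real i) + real (2 * M) = 2 * s + real (2 * K)"
      by (simp add: a_def frac_def)
    have "norm \<xi> powr (2 * (a + real i)) * norm \<xi> ^ (2 * M) = norm \<xi> powr (2 * s) * norm \<xi> ^ (2 * K)" for \<xi> :: "real^'n"
    proof (cases "\<xi> = 0")
      case False
      then have "norm \<xi> ^ m = norm \<xi> powr real m" for m using powr_realpow[of "norm \<xi>" m] by simp
      then show ?thesis by (simp only: powr_add[symmetric] K)
    qed (use a in simp)
    then have W: "complex_of_real (norm \<xi> powr (2 * (a + real i))) * complex_of_real (norm \<xi> ^ (2 * M))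
       = complex_of_real (norm \<xi> powr (2 * s)) * complex_of_real (norm \<xi> ^ (2 * K))" for \<xi> :: "real^'n"
      by (simp only: of_real_mult[symmetric])
    have eq: "complex_of_real (norm \<xi> powr (2 * (a + real i))) * (complex_of_real ((v \<bullet> \<xi>) ^ k) * (cis (x0 \<bullet> \<xi>) * (complex_of_real (norm \<xi> ^ (2 * M)) * (h \<xi> * (?p \<xi> * inv_fourier (bump \<delta> 0) \<xi>)))))
      = (complex_of_real (norm \<xi> powr (2 * (a + real i))) * complex_of_real (norm \<xi> ^ (2 * M))) * (h \<xi> * (complex_of_real (v \<bullet> \<xi>) ^ k * (?p \<xi> * (cis (x0 \<bullet> \<xi>) * inv_fourier (bump \<delta> 0) \<xi>))))" for \<xi>
      by (simp only: mult_ac of_real_power)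
    have eq2: "(complex_of_real (norm \<xi> powr (2 * (a + real i))) * complex_of_real (norm \<xi> ^ (2 * M))) * (h \<xi> * (complex_of_real (v \<bullet> \<xi>) ^ k * (?p \<xi> * (cis (x0 \<bullet> \<xi>) * inv_fourier (bump \<delta> 0) \<xi>))))
      = complex_of_real (norm \<xi> powr (2 * s)) * h \<xi> * ((complex_of_real (norm \<xi> ^ (2 * K)) * (complex_of_real (v \<bullet> \<xi>) ^ k * ?p \<xi>)) * inv_fourier (bump \<delta> x0) \<xi>)" for \<xi>
      unfolding W inv_fourier_bump[of \<delta> x0] by (simp only: mult_ac)
    show "(LINT \<xi>|lborel. complex_of_real (norm \<xi> powr (2 * (a + real i))) * (complex_of_real ((v \<bullet> \<xi>) ^ k) * (cis (x0 \<bullet> \<xi>) * (complex_of_real (norm \<xi> ^ (2 * M)) * (h \<xi> * (?p \<xi> * inv_fourier (bump \<delta> 0) \<xi>)))))) = 0"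
      unfolding eq eq2 by (rule B0)
  qed
  \<comment> \<open>bumps of shrinking support, to exhaust the frequency space\<close>
  define \<delta> where "\<delta> m = r / 2 / real (Suc m)" for m
  have \<delta>: "0 < \<delta> m" "\<delta> m \<le> r / 2" for m
    using r by (auto simp: \<delta>_def divide_le_eq mult_le_cancel_left1)
  have "AE \<xi> in lborel. \<forall>m. complex_of_real (norm \<xi> ^ (2 * M)) * (h \<xi> * (?p \<xi> * inv_fourier (bump (\<delta> m) 0) \<xi>)) = 0"
    unfolding AE_all_countable using key[OF \<delta>] by blast
  moreover have "AE \<xi> in lborel. \<xi> \<noteq> (0::real^'n)"
    using AE_not_in[OF finite_imp_null_set_lborel[of "{0::real^'n}"]] by simp
  ultimately have "AE \<xi> in lborel. h \<xi> = 0"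
    using poly_fun_AE_neq_0[OF P(1)]
  proof eventually_elim
    case (elim \<xi>)
    obtain m :: nat where "r / 2 * norm \<xi> < real m" using reals_Archimedean2 by blast
    then have "\<delta> m * norm \<xi> < 1" by (simp add: \<delta>_def divide_less_eq)
    then have "inv_fourier (bump (\<delta> m) 0) \<xi> \<noteq> 0" by (rule inv_fourier_bump_neq_0[OF \<delta>(1)])
    moreover have "complex_of_real (norm \<xi> ^ (2 * M)) * (h \<xi> * (?p \<xi> * inv_fourier (bump (\<delta> m) 0) \<xi>)) = 0"
      using elim(1) by blast
    ultimately show ?case using elim(2,3) by simp
  qed
  then have "AE \<xi> in lborel. h \<xi> * inv_fourier \<phi> \<xi> = 0" by eventually_elim simp
  then have "(LINT \<xi>|lborel. h \<xi> * inv_fourier \<phi> \<xi>) = 0" by (rule integral_eq_zero_AE)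
  then show ?thesis using has_density_distr_fourier_schwartz(2)[OF h \<phi>] by simp
qed

theorem theorem1p1:
  fixes V :: "(real ^ 'n::finite) set"
  assumes "open V" and "V \<noteq> {}"
  shows "(\<forall>s::real. \<forall>f\<in>admissible V.
            - real CARD('n) / 4 < s \<and> s \<notin> \<int> \<and> vanishes_on (frac_laplacian s f) V
              \<longrightarrow> (\<forall>\<phi>\<in>schwartz. f \<phi> = 0)) \<and>
         (\<forall>s::real. \<forall>f\<in>rapidly_decreasing \<inter> admissible V.
            - real CARD('n) / 2 < s \<and> s \<notin> \<int> \<and> vanishes_on (frac_laplacian s f) V
              \<longrightarrow> (\<forall>\<phi>\<in>schwartz. f \<phi> = 0))"
proof -
  have "f \<phi> = 0" if f: "f \<in> admissible V" and s: "s \<notin> \<int>" "vanishes_on (frac_laplacian s f) V" and \<phi>: "\<phi> \<in> schwartz"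
    for s f \<phi>
  proof -
    obtain r where "f \<in> sobolev r" using f unfolding admissible_def sobolev_minus_infinity_def by blast
    moreover obtain P where "P \<noteq> 0" "vanishes_on (poly_D P f) V" using f unfolding admissible_def by blast
    ultimately show ?thesis
      using fractional_unique_continuation[OF assms sobolev_imp_has_density _ _ s \<phi>] by blast
  qed
  then show ?thesis by blast
qed

end
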